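(* Let $\nu\ge 1$ and $j\ge 1$ be integers, and let $c_\nu = 2\nu\binom{2\nu-1}{\nu-1}$. Let $\kappa_g^{(2\nu)}(j)$ denote the number of connected labeled maps of genus $g$ with exactly $j$ vertices, each of degree $2\nu$; equivalently, $\kappa_g^{(2\nu)}(j)$ are the Taylor coefficients of the generating function $e_g(-t)=\sum_{j\ge 1}\kappa_g^{(2\nu)}(j)\,\frac{t^j}{j!}$. Then $$\kappa_0^{(2\nu)}(j) = \frac{c_\nu^{\,j}\,(\nu j-1)!}{\big((\nu-1)j+2\big)!}$$ and $$\kappa_1^{(2\nu)}(j) = \frac{(j-1)!\,c_\nu^{\,j}}{12}\sum_{k=1}^{j}(\nu-1)^k\binom{\nu j}{j-k}.$$
   Context: A map $D$ on a compact, oriented, connected surface $X$ is a pair $D=(K(D),[\iota])$ where $K(D)$ is a connected 1-complex (multiple edges and loops allowed), $[\iota]$ is an isotopy class of inclusions $\iota:K(D)\to X$, the complement of $K(D)$ in $X$ is a disjoint union of open cells (faces), and the complement of the vertex set $K_0(D)$ in $K(D)$ is a disjoint union of open segments (edges). The genus of the map is the genus of $X$. Maps are counted as labeled maps: the $j$ vertices are labeled $1,\dots,j$, and at each vertex the $2\nu$ incident half-edges are labeled $1,\dots,2\nu$ in the cyclic order given by the orientation of the surface (equivalently, one half-edge is distinguished at each vertex). Two labeled maps are identified when an orientation-preserving homeomorphism of surfaces carries one to the other preserving all labels. Equivalently, let $H=\{1,\dots,j\}\times \mathbb{Z}/2\nu\mathbb{Z}$ and let $\sigma$ be the permutation $\sigma(i,a)=(i,a+1)$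 of $H$. Then $\kappa_g^{(2\nu)}(j)$ is the number of fixed-point-free involutions $\tau$ of $H$ such that the group generated by $\sigma$ and $\tau$ acts transitively on $H$ and, with $F$ the number of cycles of $\sigma\tau$, $j-\nu j+F=2-2g$. Convention: $0!=1$. *)

theory Defs
  imports Complex_Main "HOL-Combinatorics.Orbits" "HOL-Algebra.Generated_Groups"
begin

text \<open>
  A labeled map with \<open>j\<close> vertices, each of degree \<open>2 * \<nu>\<close>, on a compact, connected, oriented
  surface is encoded by its gluing involution. The half-edge \<open>(i, a)\<close> is the one carrying the
  cyclic label \<open>a\<close> (residues modulo \<open>2 * \<nu>\<close>) at the vertex \<open>i\<close>; the permutation \<open>\<sigma>\<close> turns around
  the vertices in the positive sense, and the cycles of the involution \<open>\<tau>\<close> are the edges. Since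
  all half-edges are labeled, two labeled maps are identified precisely if their involutions
  are equal.
\<close>

definition half_edges :: "nat \<Rightarrow> nat \<Rightarrow> (nat \<times> nat) set" where
  "half_edges \<nu> j = {1..j} \<times> {0..<2 * \<nu>}"

definition vertex_rotation :: "nat \<Rightarrow> nat \<Rightarrow> nat \<times> nat \<Rightarrow> nat \<times> nat" where
  "vertex_rotation \<nu> j h =
     (if h \<in> half_edges \<nu> j then (fst h, (snd h + 1) mod (2 * \<nu>)) else h)"

definition perm_group :: "'a set \<Rightarrow> ('a \<Rightarrow> 'a) monoid" where
  "perm_group H = \<lparr> carrier = {p. p permutes H}, mult = (\<circ>), one = id \<rparr>"

definition fixed_point_free_involution_on :: "'a set \<Rightarrow> ('a \<Rightarrow> 'a) \<Rightarrow> bool" where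
  "fixed_point_free_involution_on H \<tau> \<longleftrightarrow>
     \<tau> permutes H \<and> (\<forall>h\<in>H. \<tau> h \<noteq> h \<and> \<tau> (\<tau> h) = h)"

definition generates_transitively_on :: "'a set \<Rightarrow> ('a \<Rightarrow> 'a) set \<Rightarrow> bool" where
  "generates_transitively_on H S \<longleftrightarrow>
     (\<forall>x\<in>H. \<forall>y\<in>H. \<exists>p\<in>generate (perm_group H) S. p x = y)"

text \<open>Fixed points count as cycles: a face may be bounded by a single half-edge.\<close>

definition num_cycles_on :: "'a set \<Rightarrow> ('a \<Rightarrow> 'a) \<Rightarrow> nat" where
  "num_cycles_on H p = card (orbit p ` H)"

text \<open>
  The faces are the cycles of \<open>\<sigma> \<circ> \<tau>\<close>, so the last condition says that the Euler characteristic
  (vertices minus edges plus faces) is \<open>2 - 2 * g\<close>.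
\<close>

definition labeled_maps :: "nat \<Rightarrow> nat \<Rightarrow> nat \<Rightarrow> (nat \<times> nat \<Rightarrow> nat \<times> nat) set" where
  "labeled_maps g \<nu> j =
     {\<tau>. fixed_point_free_involution_on (half_edges \<nu> j) \<tau> \<and>
         generates_transitively_on (half_edges \<nu> j) {vertex_rotation \<nu> j, \<tau>} \<and>
         int j - int (\<nu> * j) + int (num_cycles_on (half_edges \<nu> j) (vertex_rotation \<nu> j \<circ> \<tau>))
           = 2 - 2 * int g}"

definition map_count :: "nat \<Rightarrow> nat \<Rightarrow> nat \<Rightarrow> nat"  (\<open>\<kappa>\<close>) where
  "\<kappa> g \<nu> j = card (labeled_maps g \<nu> j)"

definition c_const :: "nat \<Rightarrow> nat" where
  "c_const \<nu> = 2 * \<nu> * ((2 * \<nu> - 1) choose (\<nu> - 1))"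

end

theory Submission
  imports Defs "HOL-Computational_Algebra.Computational_Algebra"
begin

text \<open>
  A map is a gluing \<open>\<tau>\<close> of half-edges, and its faces are the cycles of \<open>\<sigma> \<circ> \<tau>\<close>. The proof turns the
  removal of one edge (Tutte's method) into recursions for generating functions, solves these in
  closed form after a change of variables, and extracts coefficients by Lagrange inversion.

  \<^item> Removing the edge \<open>{h, \<tau> h}\<close> replaces \<open>\<sigma>\<close> by \<open>\<sigma> \<circ> (h \<tau>h)\<close> with both ends deleted: a vertex splits in
    two if the edge is a loop, and two vertices fuse otherwise. Weighting a gluing, connected or not,
    by \<open>X\<close> to the number of faces, this gives \<open>maps_poly_root_edge\<close>. Since the degrees change, vertices
    of arbitrary degrees, also of degree 0, have to be admitted.

  \<^item> A gluing is a connected gluing of the component of a given vertex and an arbitrary gluing of the rest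
    (\<open>maps_poly_components\<close>). This relation is triangular, so it determines the polynomials of connected
    gluings from those of all gluings; the recursion for the former, \<open>connected_poly_root_edge\<close>, is
    deduced from that for the latter by showing that its right-hand side satisfies the same relation.

  \<^item> By induction along the recursion, the number of faces of a connected gluing obeys Euler's formula with
    a natural number \<open>g\<close> as genus. Comparing coefficients yields \<open>genus_count_root_edge\<close>. In genus 0 with
    one or two marked vertices, and in genus 1 with one marked vertex, all others having degree
    \<open>2 * \<nu>\<close>, the recursions form a closed system.

  \<^item> Let \<open>t\<close> mark the ordinary vertices, put \<open>t = u / (c * (1 + u) ^ \<nu>)\<close> and \<open>R = 1 + u\<close>, so that
    \<open>R = 1 + c * t * R ^ \<nu>\<close>, and let \<open>z = 1 / x\<^sup>2\<close> mark the degree of the marked vertex. The planar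
    one-point function \<open>W\<close> is determined by the requirement that \<open>V'(x) - 2 * W(x)\<close> is the square root of
    \<open>x\<^sup>2 - 4 * R\<close> times a polynomial, where \<open>V(x) = x\<^sup>2 / 2 - t * x ^ (2 * \<nu>)\<close>: its square is then a
    polynomial, and the vanishing of the negative powers of \<open>x\<close> is the recursion (\<open>disc_recursion\<close>).
    The other two functions solve linear recursions, again by a polynomiality argument
    (\<open>annulus_recursion\<close>, \<open>torus_disc_recursion\<close>). All recursions have a unique solution, as \<open>t\<close> has no
    constant term (\<open>fps_recursion_zero\<close>).

  \<^item> Maps with \<open>j\<close> vertices of degree \<open>2 * \<nu>\<close> are counted by the marked functions at degree \<open>2 * \<nu>\<close>. There
    the two-point function is \<open>c\<^sup>2 / (2 * \<nu>) * R ^ (2 * \<nu>)\<close>, and the genus 1 function times \<open>dt/du\<close> is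
    \<open>(\<nu> - 1) / (12 * (1 - (\<nu> - 1) * u))\<close>; \<open>fps_Lagrange_inversion\<close> turns both into the claimed sums.
\<close>

section \<open>Removing an edge from a gluing\<close>

text \<open>
  The cycles of \<open>p\<close> with \<open>x\<close> skipped. Keeping \<open>x\<close> as a fixed point makes deletions compose as functions
  on the same type.
\<close>

definition delete_point :: "'a \<Rightarrow> ('a \<Rightarrow> 'a) \<Rightarrow> 'a \<Rightarrow> 'a" where
  "delete_point x p = transpose x (p x) \<circ> p"

lemma delete_point_fixes: "inj p \<Longrightarrow> delete_point x p x = x"
  by (simp add: delete_point_def)

lemma delete_point_skip: "inj p \<Longrightarrow> y \<noteq> x \<Longrightarrow> p y = x \<Longrightarrow> delete_point x p y = p x"
  by (simp add: delete_point_def)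

lemma delete_point_other: "inj p \<Longrightarrow> y \<noteq> x \<Longrightarrow> p y \<noteq> x \<Longrightarrow> delete_point x p y = p y"
  by (simp add: delete_point_def transpose_def inj_eq)

lemma delete_point_permutes:
  assumes "p permutes H" shows "delete_point x p permutes (H - {x})"
proof (cases "x \<in> H")
  case True
  have "delete_point x p permutes H"
    unfolding delete_point_def
    by (rule permutes_compose[OF assms permutes_swap_id[OF True]])
      (use assms True in \<open>simp add: permutes_in_image\<close>)
  moreover have "delete_point x p x = x" using assms by (simp add: delete_point_fixes permutes_inj)
  ultimately show ?thesis
    by (auto intro: permutes_superset)
next
  case False
  then have "p x = x" using assms by (simp add: permutes_def)
  then show ?thesis using assms False by (simp add: delete_point_def)
qed

text \<open>
  Both permutations run through a cycle in the same order, except that the visit of \<open>x\<close> is skipped. For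
  the converse inclusion the induction also has to pass through \<open>x\<close>, where it keeps track of the
  successor \<open>p x\<close> instead.
\<close>

lemma orbit_delete_point:
  assumes p: "p permutes H" and y: "y \<noteq> x"
  shows "orbit (delete_point x p) y = orbit p y - {x}"
proof -
  define q where "q = delete_point x p"
  have inj: "inj p" using p by (rule permutes_inj)
  have injq: "inj q" using delete_point_permutes[OF p] unfolding q_def by (rule permutes_inj)
  have qx: "q x = x" using inj by (simp add: q_def delete_point_fixes)
  have A: "z \<in> orbit p y \<and> z \<noteq> x" if "z \<in> orbit q y" for z
    using that
  proof induction
    case base
    show ?case
    proof (cases "p y = x")
      case True
      then have "q y = p x" using inj y by (simp add: q_def delete_point_skip)
      moreover have "p x \<in> orbit p y" using True by (metis orbit.simps)
      moreover have "q y \<noteq> x" using injq qx y by (metis injD)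
      ultimately show ?thesis by simp
    next
      case False
      then show ?thesis using inj y by (simp add: q_def delete_point_other orbit.base)
    qed
  next
    case (step z)
    show ?case
    proof (cases "p z = x")
      case True
      then have "q z = p x" using inj step by (simp add: q_def delete_point_skip)
      moreover have "p x \<in> orbit p y" using True step by (metis orbit.simps)
      moreover have "q z \<noteq> x" using injq qx step by (metis injD)
      ultimately show ?thesis by simp
    next
      case False
      then show ?thesis using inj step by (simp add: q_def delete_point_other orbit.step)
    qed
  qed
  have B: "if z = x then p x \<in> orbit q y else z \<in> orbit q y" if "z \<in> orbit p y" for z
    using that
  proof induction
    case base
    show ?case
    proof (cases "p y = x")
      case True
      then have "q y = p x" using inj y by (simp add: q_def delete_point_skip)
      then show ?thesis using True by (metis orbit.base)
    next
      case False
      then have "q y = p y" using inj y by (simp add: q_def delete_point_other)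
      then show ?thesis using False by (metis orbit.base)
    qed
  next
    case (step z)
    show ?case
    proof (cases "z = x")
      case True then show ?thesis using step by auto
    next
      case z: False
      show ?thesis
      proof (cases "p z = x")
        case True
        then have "q z = p x" using inj z by (simp add: q_def delete_point_skip)
        then show ?thesis using True step z by (metis orbit.step)
      next
        case False
        then have "q z = p z" using inj z by (simp add: q_def delete_point_other)
        then show ?thesis using False step z by (metis orbit.step)
      qed
    qed
  qed
  show ?thesis unfolding q_def[symmetric]
  proof (intro equalityI subsetI)
    fix z assume "z \<in> orbit q y" then show "z \<in> orbit p y - {x}" using A by blast
  next
    fix z assume z: "z \<in> orbit p y - {x}"
    then have "if z = x then p x \<in> orbit q y else z \<in> orbit q y" by (intro B) blast
    then show "z \<in> orbit q y" using z by simp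
  qed
qed

lemma permutes_imp_permutation: "finite H \<Longrightarrow> p permutes H \<Longrightarrow> permutation p"
  unfolding permutation_permutes by blast

text \<open>
  Distinct cycles other than \<open>{x}\<close> remain distinct and nonempty without \<open>x\<close>, so at most the cycle \<open>{x}\<close>
  is lost.
\<close>

lemma num_cycles_delete_point:
  assumes H: "finite H" and p: "p permutes H" and x: "x \<in> H"
  shows "num_cycles_on H p =
    num_cycles_on (H - {x}) (delete_point x p) + (if p x = x then 1 else 0)"
proof -
  let ?q = "delete_point x p"
  have perm: "permutation p" using H p by (rule permutes_imp_permutation)
  have self: "y \<in> orbit p y" for y using perm by (rule permutation_self_in_orbit)
  have img: "orbit ?q ` (H - {x}) = (\<lambda>C. C - {x}) ` (orbit p ` (H - {x}))"
    unfolding image_image by (rule image_cong[OF refl]) (simp add: orbit_delete_point[OF p])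
  have inj: "inj_on (\<lambda>C. C - {x}) (orbit p ` (H - {x}))"
  proof (rule inj_onI)
    fix A B assume A: "A \<in> orbit p ` (H - {x})" and B: "B \<in> orbit p ` (H - {x})"
      and eq: "A - {x} = B - {x}"
    obtain a where a: "a \<noteq> x" "A = orbit p a" using A by auto
    obtain b where b: "b \<noteq> x" "B = orbit p b" using B by auto
    have "a \<in> orbit p b" using self[of a] a b eq by auto
    then show "A = B" using a b orbit_cyclic_eq3[OF cyclic_on_orbit[OF p H], of a b] by simp
  qed
  have card: "card (orbit ?q ` (H - {x})) = card (orbit p ` (H - {x}))"
    unfolding img using inj by (rule card_image)
  show ?thesis
  proof (cases "p x = x")
    case True
    have "orbit p ` H = insert (orbit p x) (orbit p ` (H - {x}))"
      using x by (metis image_insert insert_Diff)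
    moreover have ox: "orbit p x = {x}" using True by (simp add: orbit_eq_singleton_iff)
    moreover have "{x} \<notin> orbit p ` (H - {x})"
    proof
      assume "{x} \<in> orbit p ` (H - {x})"
      then obtain y where "y \<in> H - {x}" "{x} = orbit p y" by (rule imageE)
      then show False using self[of y] by simp
    qed
    ultimately show ?thesis
      using True H card by (simp add: num_cycles_on_def)
  next
    case False
    have "orbit p x = orbit p (p x)"
      using orbit_cyclic_eq3[OF cyclic_on_orbit[OF p H], of "p x" x] orbit.base[of p x] by simp
    moreover have "p x \<in> H - {x}" using False p x by (simp add: permutes_in_image)
    ultimately have "orbit p x \<in> orbit p ` (H - {x})" by (rule image_eqI)
    moreover have "orbit p ` H = insert (orbit p x) (orbit p ` (H - {x}))"
      using x by (metis image_insert insert_Diff)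
    ultimately have "orbit p ` H = orbit p ` (H - {x})" by (simp only: insert_absorb)
    then show ?thesis using False card by (simp add: num_cycles_on_def)
  qed
qed

definition gluings :: "'a set \<Rightarrow> ('a \<Rightarrow> 'a) set" where
  "gluings H = {\<tau>. fixed_point_free_involution_on H \<tau>}"

lemma finite_gluings: "finite H \<Longrightarrow> finite (gluings H)"
  by (rule finite_subset[OF _ finite_permutations[of H]])
     (auto simp: gluings_def fixed_point_free_involution_on_def)

definition face_poly :: "'a set \<Rightarrow> ('a \<Rightarrow> 'a) \<Rightarrow> real poly" where
  "face_poly H \<sigma> = (\<Sum>\<tau>\<in>gluings H. monom 1 (num_cycles_on H (\<sigma> \<circ> \<tau>)))"

text \<open>
  A gluing that joins \<open>h\<close> and \<open>h'\<close> is a gluing of the other half-edges next to the transposition of \<open>h\<close>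
  and \<open>h'\<close>. Composition with the transposition is its own inverse, so the same map serves in both
      directions.
\<close>

lemma gluings_root:
  assumes h: "h \<in> H" and h': "h' \<in> H" "h' \<noteq> h"
  shows "bij_betw (\<lambda>\<tau>. transpose h h' \<circ> \<tau>) (gluings (H - {h, h'})) {\<tau> \<in> gluings H. \<tau> h = h'}"
proof (rule bij_betwI[where g = "\<lambda>\<tau>. transpose h h' \<circ> \<tau>"])
  show "(\<lambda>\<tau>. transpose h h' \<circ> \<tau>) \<in> gluings (H - {h, h'}) \<rightarrow> {\<tau> \<in> gluings H. \<tau> h = h'}"
  proof
    fix \<tau> assume "\<tau> \<in> gluings (H - {h, h'})"
    then have \<tau>: "\<tau> permutes (H - {h, h'})" "\<And>x. x \<in> H - {h, h'} \<Longrightarrow> \<tau> x \<noteq> x \<and> \<tau> (\<tau> x) = x"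
      by (auto simp: gluings_def fixed_point_free_involution_on_def)
    have fixd: "\<tau> h = h" "\<tau> h' = h'" using \<tau>(1) by (auto simp: permutes_def)
    have im: "\<tau> x \<in> H - {h, h'}" if "x \<in> H - {h, h'}" for x using \<tau>(1) that by (meson permutes_in_image)
    have "transpose h h' \<circ> \<tau> permutes H"
      by (rule permutes_compose[OF permutes_subset[OF \<tau>(1)] permutes_swap_id[OF h h'(1)]]) auto
    moreover have "(transpose h h' \<circ> \<tau>) x \<noteq> x \<and> (transpose h h' \<circ> \<tau>) ((transpose h h' \<circ> \<tau>) x) = x"
      if "x \<in> H" for x
    proof (cases "x \<in> {h, h'}")
      case True then show ?thesis using fixd h' by auto
    next
      case False
      then have x: "x \<in> H - {h, h'}" using that by auto
      then have "transpose h h' (\<tau> x) = \<tau> x" using im[OF x] by (auto simp: transpose_def)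
      then show ?thesis using \<tau>(2)[OF x] x by (auto simp: transpose_def)
    qed
    ultimately show "transpose h h' \<circ> \<tau> \<in> {\<tau> \<in> gluings H. \<tau> h = h'}"
      using fixd by (simp add: gluings_def fixed_point_free_involution_on_def)
  qed
  show "(\<lambda>\<tau>. transpose h h' \<circ> \<tau>) \<in> {\<tau> \<in> gluings H. \<tau> h = h'} \<rightarrow> gluings (H - {h, h'})"
  proof
    fix \<tau> assume "\<tau> \<in> {\<tau> \<in> gluings H. \<tau> h = h'}"
    then have \<tau>: "\<tau> permutes H" "\<And>x. x \<in> H \<Longrightarrow> \<tau> x \<noteq> x \<and> \<tau> (\<tau> x) = x" "\<tau> h = h'"
      by (auto simp: gluings_def fixed_point_free_involution_on_def)
    have th': "\<tau> h' = h" using \<tau> h by metis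
    have inj: "inj \<tau>" using \<tau>(1) by (rule permutes_inj)
    have off: "transpose h h' (\<tau> x) = \<tau> x" "\<tau> x \<in> H - {h, h'}" if "x \<in> H - {h, h'}" for x
    proof -
      have "\<tau> x \<noteq> h" "\<tau> x \<noteq> h'" using that inj \<tau>(3) th' by (metis DiffD2 injD insertCI)+
      then show "transpose h h' (\<tau> x) = \<tau> x" "\<tau> x \<in> H - {h, h'}"
        using that \<tau>(1) by (auto simp: permutes_in_image)
    qed
    have "transpose h h' \<circ> \<tau> permutes H"
      by (rule permutes_compose[OF \<tau>(1) permutes_swap_id[OF h h'(1)]])
    then have "transpose h h' \<circ> \<tau> permutes H - {h, h'}"
      by (rule permutes_superset) (use \<tau>(3) th' in auto)
    moreover have "(transpose h h' \<circ> \<tau>) x \<noteq> x \<and> (transpose h h' \<circ> \<tau>) ((transpose h h' \<circ> \<tau>) x) = x"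
      if "x \<in> H - {h, h'}" for x
      using off[OF that] off(1)[OF off(2)[OF that]] \<tau>(2)[of x] that by auto
    ultimately show "transpose h h' \<circ> \<tau> \<in> gluings (H - {h, h'})"
      by (simp add: gluings_def fixed_point_free_involution_on_def)
  qed
qed (auto simp: fun_eq_iff)

text \<open>
  The vertex rotation that is left when the edge \<open>{h, h'}\<close> is removed.
\<close>

definition merge_delete :: "'a \<Rightarrow> 'a \<Rightarrow> ('a \<Rightarrow> 'a) \<Rightarrow> 'a \<Rightarrow> 'a" where
  "merge_delete h h' \<sigma> = delete_point h' (delete_point h (\<sigma> \<circ> transpose h h'))"

text \<open>
  As \<open>\<tau>\<close> fixes \<open>h\<close> and \<open>h'\<close>, deleting them from \<open>\<sigma> \<circ> (h h') \<circ> \<tau>\<close> is the same as deleting them from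
  \<open>\<sigma> \<circ> (h h')\<close>. Hence faces survive the removal of the edge unless they consist of deleted half-edges only.
\<close>

lemma num_cycles_root:
  assumes H: "finite H" and s: "\<sigma> permutes H" and h: "h \<in> H" and h': "h' \<in> H" "h' \<noteq> h"
    and t: "\<tau> \<in> gluings (H - {h, h'})"
  shows "num_cycles_on H (\<sigma> \<circ> (transpose h h' \<circ> \<tau>)) =
    num_cycles_on (H - {h, h'}) (merge_delete h h' \<sigma> \<circ> \<tau>)
     + ((if \<sigma> h' = h then 1 else 0)
        + (if delete_point h (\<sigma> \<circ> transpose h h') h' = h' then 1 else 0))"
proof -
  define \<rho> where "\<rho> = \<sigma> \<circ> transpose h h'"
  have tp: "\<tau> permutes (H - {h, h'})"
    using t by (simp add: gluings_def fixed_point_free_involution_on_def)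
  have fixd: "\<tau> h = h" "\<tau> h' = h'" using tp by (auto simp: permutes_def)
  have \<rho>p: "\<rho> permutes H" unfolding \<rho>_def
    by (rule permutes_compose[OF permutes_swap_id[OF h h'(1)] s])
  have tpH: "\<tau> permutes H" using tp by (rule permutes_subset) auto
  have pH: "\<rho> \<circ> \<tau> permutes H" using tpH \<rho>p by (rule permutes_compose)
  have comp1: "delete_point h (\<rho> \<circ> \<tau>) = delete_point h \<rho> \<circ> \<tau>"
    using fixd by (simp add: delete_point_def comp_assoc)
  have comp2: "delete_point h' (delete_point h \<rho> \<circ> \<tau>) = delete_point h' (delete_point h \<rho>) \<circ> \<tau>"
    using fixd by (simp add: delete_point_def comp_assoc)
  have "num_cycles_on H (\<rho> \<circ> \<tau>) = num_cycles_on (H - {h}) (delete_point h \<rho> \<circ> \<tau>)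
     + (if \<rho> h = h then 1 else 0)"
    using num_cycles_delete_point[OF H pH h] fixd by (simp add: comp1)
  moreover have "num_cycles_on (H - {h}) (delete_point h \<rho> \<circ> \<tau>) =
     num_cycles_on (H - {h} - {h'}) (delete_point h' (delete_point h \<rho>) \<circ> \<tau>)
     + (if delete_point h \<rho> h' = h' then 1 else 0)"
  proof -
    have "delete_point h \<rho> \<circ> \<tau> permutes (H - {h})" using delete_point_permutes[OF pH, of h] comp1 by simp
    from num_cycles_delete_point[OF _ this, of h'] H h' fixd show ?thesis by (simp add: comp2)
  qed
  moreover have "H - {h} - {h'} = H - {h, h'}" by auto
  moreover have "\<rho> h = \<sigma> h'" by (simp add: \<rho>_def)
  ultimately show ?thesis by (simp add: \<rho>_def merge_delete_def comp_assoc)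
qed

lemma face_poly_root:
  assumes H: "finite H" and s: "\<sigma> permutes H" and h: "h \<in> H"
  shows "face_poly H \<sigma> = (\<Sum>h'\<in>H - {h}.
     monom 1 ((if \<sigma> h' = h then 1 else 0)
        + (if delete_point h (\<sigma> \<circ> transpose h h') h' = h' then 1 else 0))
      * face_poly (H - {h, h'}) (merge_delete h h' \<sigma>))"
proof -
  have dec: "gluings H = (\<Union>h'\<in>H - {h}. {\<tau> \<in> gluings H. \<tau> h = h'})"
    using h by (auto simp: gluings_def fixed_point_free_involution_on_def permutes_in_image)
  have "face_poly H \<sigma> = (\<Sum>h'\<in>H - {h}. \<Sum>\<tau>\<in>{\<tau> \<in> gluings H. \<tau> h = h'}.
      monom 1 (num_cycles_on H (\<sigma> \<circ> \<tau>)))"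
    unfolding face_poly_def
    by (subst dec, rule sum.UNION_disjoint) (use H in \<open>auto simp: finite_gluings\<close>)
  also have "\<dots> = (\<Sum>h'\<in>H - {h}. 
     monom 1 ((if \<sigma> h' = h then 1 else 0)
        + (if delete_point h (\<sigma> \<circ> transpose h h') h' = h' then 1 else 0))
      * face_poly (H - {h, h'}) (merge_delete h h' \<sigma>))" (is "_ = (\<Sum>h'\<in>_. ?f h' * _)")
  proof (rule sum.cong[OF refl])
    fix h' assume h': "h' \<in> H - {h}"
    have "(\<Sum>\<tau>\<in>{\<tau> \<in> gluings H. \<tau> h = h'}. monom (1::real) (num_cycles_on H (\<sigma> \<circ> \<tau>)))
      = (\<Sum>\<tau>\<in>gluings (H - {h, h'}). monom 1 (num_cycles_on H (\<sigma> \<circ> (transpose h h' \<circ> \<tau>))))"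
      using h h' by (intro sum.reindex_bij_betw[symmetric] gluings_root) auto
    also have "\<dots> = (\<Sum>\<tau>\<in>gluings (H - {h, h'}).
        ?f h' * monom 1 (num_cycles_on (H - {h, h'}) (merge_delete h h' \<sigma> \<circ> \<tau>)))"
      using h' by (intro sum.cong refl) (simp add: num_cycles_root[OF H s h] mult_monom add.commute)
    finally show "(\<Sum>\<tau>\<in>{\<tau> \<in> gluings H. \<tau> h = h'}. monom 1 (num_cycles_on H (\<sigma> \<circ> \<tau>)))
      = ?f h' * face_poly (H - {h, h'}) (merge_delete h h' \<sigma>)"
      by (simp add: face_poly_def sum_distrib_left)
  qed
  finally show ?thesis .
qed

section \<open>Vertices as cyclic lists\<close>

text \<open>
  The list is a cycle of \<open>p\<close>, read from an arbitrary starting point. The empty list qualifies as well: it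
  is a vertex without half-edges.
\<close>

definition cyclic_along :: "('a \<Rightarrow> 'a) \<Rightarrow> 'a list \<Rightarrow> bool" where
  "cyclic_along p xs \<longleftrightarrow> map p xs = rotate1 xs"

lemma cyclic_along_append_swap:
  assumes "cyclic_along p (xs @ ys)" shows "cyclic_along p (ys @ xs)"
proof -
  have "cyclic_along p (rotate n zs)" if "cyclic_along p zs" for n zs
    using that by (induction n) (simp_all add: cyclic_along_def rotate1_map[symmetric])
  from this[OF assms, of "length xs"] show ?thesis by (simp add: rotate_append)
qed

lemma transpose_list_id: "a \<notin> set xs \<Longrightarrow> b \<notin> set xs \<Longrightarrow> map (transpose a b) xs = xs"
  by (induction xs) (auto simp: transpose_def)

lemma cyclic_along_delete_head:
  assumes "cyclic_along p (x # ys)" "distinct (x # ys)"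
  shows "cyclic_along (delete_point x p) ys"
proof (cases ys)
  case Nil then show ?thesis by (simp add: cyclic_along_def)
next
  case (Cons y zs)
  have px: "p x = y" and eq: "map p ys = zs @ [x]"
    using assms(1) by (simp_all add: cyclic_along_def Cons)
  have "map (delete_point x p) ys = map (transpose x y) (map p ys)"
    by (simp add: delete_point_def px)
  also have "\<dots> = map (transpose x y) zs @ [y]" by (simp only: eq) simp
  also have "\<dots> = zs @ [y]" using assms(2) by (simp add: Cons transpose_list_id)
  finally show ?thesis by (simp add: cyclic_along_def Cons)
qed

lemma cyclic_along_delete_outside:
  assumes "cyclic_along p zs" "x \<notin> set zs" "inj p"
  shows "cyclic_along (delete_point x p) zs"
proof -
  have "p ` set zs = set zs" using assms(1) unfolding cyclic_along_def by (metis set_map set_rotate1)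
  then have "p x \<notin> set zs" using assms(2,3) by (metis inj_image_mem_iff)
  moreover have "map (delete_point x p) zs = map (transpose x (p x)) (map p zs)"
    by (simp add: delete_point_def)
  ultimately show ?thesis
    using assms(1,2) by (simp only: cyclic_along_def transpose_list_id set_rotate1 simp_thms)
qed

lemma map_comp_transpose:
  "a \<notin> set xs \<Longrightarrow> b \<notin> set xs \<Longrightarrow> map (p \<circ> transpose a b) xs = map p xs"
  by (metis map_map transpose_list_id)

lemma merge_delete_outside:
  assumes "cyclic_along \<sigma> zs" "h \<notin> set zs" "h' \<notin> set zs" "inj \<sigma>"
  shows "cyclic_along (merge_delete h h' \<sigma>) zs"
proof -
  have inj: "inj (\<sigma> \<circ> transpose h h')" using assms(4) by (intro inj_compose) auto
  have "cyclic_along (\<sigma> \<circ> transpose h h') zs"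
    using assms(1) map_comp_transpose[OF assms(2,3), of \<sigma>] by (simp only: cyclic_along_def)
  then have c: "cyclic_along (delete_point h (\<sigma> \<circ> transpose h h')) zs"
    by (rule cyclic_along_delete_outside) (use assms inj in auto)
  have "inj (delete_point h (\<sigma> \<circ> transpose h h'))"
    unfolding delete_point_def by (intro inj_compose inj) auto
  with c show ?thesis
    unfolding merge_delete_def by (intro cyclic_along_delete_outside[OF _ assms(3)])
qed

lemma cyclic_along_Cons: "cyclic_along p (x # xs) \<longleftrightarrow> p x # map p xs = xs @ [x]"
  by (simp add: cyclic_along_def)

lemma cyclic_along_hd: "cyclic_along p (x # xs) \<Longrightarrow> p x = hd (xs @ [x])"
  by (metis cyclic_along_Cons list.sel(1))

text \<open>
  Composing with a transposition of two points of the cycle \<open>(h xs h' ys)\<close> cuts it into \<open>(h ys)\<close> and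
  \<open>(h' xs)\<close>. The last two claims identify the faces lost in \<open>num_cycles_root\<close> with the new vertices of
  degree 0.
\<close>

lemma merge_delete_same_cycle:
  assumes c: "cyclic_along \<sigma> (h # xs @ h' # ys)" and d: "distinct (h # xs @ h' # ys)"
    and inj: "inj \<sigma>"
  shows "cyclic_along (merge_delete h h' \<sigma>) ys" "cyclic_along (merge_delete h h' \<sigma>) xs"
    "\<sigma> h' = h \<longleftrightarrow> ys = []" "delete_point h (\<sigma> \<circ> transpose h h') h' = h' \<longleftrightarrow> xs = []"
proof -
  define \<rho> where "\<rho> = \<sigma> \<circ> transpose h h'"
  have inj\<rho>: "inj \<rho>" unfolding \<rho>_def using inj by (intro inj_compose) auto
  have inj\<rho>': "inj (delete_point h \<rho>)" unfolding delete_point_def by (intro inj_compose inj\<rho>) auto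
  have "(\<sigma> h # map \<sigma> xs) @ (\<sigma> h' # map \<sigma> ys) = (xs @ [h']) @ (ys @ [h])"
    using c by (simp add: cyclic_along_def)
  then have 1: "\<sigma> h # map \<sigma> xs = xs @ [h']" and 2: "\<sigma> h' # map \<sigma> ys = ys @ [h]"
    by (subst (asm) append_eq_append_conv; simp)+
  have "map \<rho> xs = map \<sigma> xs"
    unfolding \<rho>_def by (rule map_comp_transpose) (use d in auto)
  moreover have "map \<rho> ys = map \<sigma> ys"
    unfolding \<rho>_def by (rule map_comp_transpose) (use d in auto)
  ultimately have c1: "cyclic_along \<rho> (h # ys)" and c2: "cyclic_along \<rho> (h' # xs)"
    using 1 2 unfolding cyclic_along_Cons by (simp_all only: ) (simp_all add: \<rho>_def)
  have c3: "cyclic_along (delete_point h \<rho>) ys" by (rule cyclic_along_delete_head) (use c1 d in auto)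
  have c4: "cyclic_along (delete_point h \<rho>) (h' # xs)"
    by (rule cyclic_along_delete_outside) (use c2 d inj\<rho> in auto)
  show "cyclic_along (merge_delete h h' \<sigma>) ys"
    unfolding merge_delete_def \<rho>_def[symmetric]
    by (rule cyclic_along_delete_outside) (use c3 d inj\<rho>' in auto)
  show "cyclic_along (merge_delete h h' \<sigma>) xs"
    unfolding merge_delete_def \<rho>_def[symmetric]
    by (rule cyclic_along_delete_head) (use c4 d in auto)
  show "\<sigma> h' = h \<longleftrightarrow> ys = []" using 2 d by (cases ys) auto
  show "delete_point h (\<sigma> \<circ> transpose h h') h' = h' \<longleftrightarrow> xs = []"
    unfolding \<rho>_def[symmetric] using cyclic_along_hd[OF c4] d by (cases xs) auto
qed

text \<open>
  Composing with a transposition of points of different cycles \<open>(h as)\<close> and \<open>(h' bs)\<close> fuses them into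
  \<open>(h bs h' as)\<close>. A face is lost only if both vertices have degree 1.
\<close>

lemma merge_delete_two_cycles:
  assumes c: "cyclic_along \<sigma> (h # as)" "cyclic_along \<sigma> (h' # bs)"
    and d: "distinct ((h # as) @ (h' # bs))" and inj: "inj \<sigma>"
  shows "cyclic_along (merge_delete h h' \<sigma>) (as @ bs)"
    "\<sigma> h' \<noteq> h" "delete_point h (\<sigma> \<circ> transpose h h') h' = h' \<longleftrightarrow> as @ bs = []"
proof -
  define \<rho> where "\<rho> = \<sigma> \<circ> transpose h h'"
  have 1: "\<sigma> h # map \<sigma> as = as @ [h]" and 2: "\<sigma> h' # map \<sigma> bs = bs @ [h']"
    using c by (simp_all add: cyclic_along_Cons)
  have m1: "map \<rho> as = map \<sigma> as"
    unfolding \<rho>_def by (rule map_comp_transpose) (use d in auto)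
  have m2: "map \<rho> bs = map \<sigma> bs"
    unfolding \<rho>_def by (rule map_comp_transpose) (use d in auto)
  have "map \<rho> (h # bs @ h' # as) = (\<sigma> h' # map \<sigma> bs) @ (\<sigma> h # map \<sigma> as)"
    using m1 m2 by (simp add: \<rho>_def)
  also have "\<dots> = bs @ h' # as @ [h]" by (simp only: 1 2) simp
  finally have "cyclic_along \<rho> (h # (bs @ h' # as))" by (simp add: cyclic_along_def)
  then have "cyclic_along (delete_point h \<rho>) (bs @ h' # as)"
    by (rule cyclic_along_delete_head) (use d in auto)
  then have c4: "cyclic_along (delete_point h \<rho>) (h' # (as @ bs))"
    using cyclic_along_append_swap by fastforce
  show "cyclic_along (merge_delete h h' \<sigma>) (as @ bs)"
    unfolding merge_delete_def \<rho>_def[symmetric]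
    by (rule cyclic_along_delete_head) (use c4 d in auto)
  show "\<sigma> h' \<noteq> h" using 2 d by (cases bs) auto
  show "delete_point h (\<sigma> \<circ> transpose h h') h' = h' \<longleftrightarrow> as @ bs = []"
    unfolding \<rho>_def[symmetric] using cyclic_along_hd[OF c4] d
    by (cases as; cases bs) auto
qed

text \<open>
  Vertices are labeled by \<open>S\<close>, and \<open>L i\<close> lists the half-edges around the vertex \<open>i\<close>. Lists, unlike the
  orbits of \<open>\<sigma>\<close>, can represent vertices of degree 0.
\<close>

definition rotation_system ::
  "nat set \<Rightarrow> (nat \<Rightarrow> 'a list) \<Rightarrow> 'a set \<Rightarrow> ('a \<Rightarrow> 'a) \<Rightarrow> bool" where
  "rotation_system S L H \<sigma> \<longleftrightarrow> finite S \<and> \<sigma> permutes H \<and> H = (\<Union>i\<in>S. set (L i)) \<and>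
     (\<forall>i\<in>S. distinct (L i) \<and> cyclic_along \<sigma> (L i)) \<and>
     (\<forall>i\<in>S. \<forall>j\<in>S. i \<noteq> j \<longrightarrow> set (L i) \<inter> set (L j) = {})"

lemma merge_delete_permutes:
  assumes "\<sigma> permutes H" "h \<in> H" "h' \<in> H"
  shows "merge_delete h h' \<sigma> permutes (H - {h, h'})"
proof -
  have "\<sigma> \<circ> transpose h h' permutes H"
    by (rule permutes_compose[OF permutes_swap_id[OF assms(2,3)] assms(1)])
  from delete_point_permutes[OF delete_point_permutes[OF this, of h], of h']
  have "merge_delete h h' \<sigma> permutes (H - {h} - {h'})" by (simp add: merge_delete_def)
  also have "H - {h} - {h'} = H - {h, h'}" by auto
  finally show ?thesis .
qed

text \<open>
  The removed edge is a loop at \<open>r\<close>; the fresh label \<open>s\<close> names the second half of the vertex.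
\<close>

lemma rotation_system_split:
  assumes sys: "rotation_system S L H \<sigma>" and r: "r \<in> S" and Lr: "L r = h # xs @ h' # ys"
    and s: "s \<notin> S"
  shows "rotation_system (insert s S) (L(r := ys, s := xs)) (H - {h, h'}) (merge_delete h h' \<sigma>)"
    "\<sigma> h' = h \<longleftrightarrow> ys = []" "delete_point h (\<sigma> \<circ> transpose h h') h' = h' \<longleftrightarrow> xs = []"
proof -
  have S: "finite S" "\<sigma> permutes H" and H: "H = (\<Union>i\<in>S. set (L i))"
    and L: "\<And>i. i \<in> S \<Longrightarrow> distinct (L i)" "\<And>i. i \<in> S \<Longrightarrow> cyclic_along \<sigma> (L i)"
    and disj: "\<And>i j. i \<in> S \<Longrightarrow> j \<in> S \<Longrightarrow> i \<noteq> j \<Longrightarrow> set (L i) \<inter> set (L j) = {}"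
    using sys by (auto simp: rotation_system_def)
  have inj: "inj \<sigma>" using S(2) by (rule permutes_inj)
  note same = merge_delete_same_cycle[OF L(2)[OF r, unfolded Lr] L(1)[OF r, unfolded Lr] inj]
  show "\<sigma> h' = h \<longleftrightarrow> ys = []" "delete_point h (\<sigma> \<circ> transpose h h') h' = h' \<longleftrightarrow> xs = []"
    using same by auto
  have rs: "r \<noteq> s" using r s by auto
  have d: "distinct (h # xs @ h' # ys)" using L(1)[OF r] Lr by simp
  have hH: "h \<in> H" "h' \<in> H" unfolding H by (rule UN_I[OF r], simp add: Lr)+
  have off: "h \<notin> set (L i)" "h' \<notin> set (L i)" "set (L i) \<inter> set xs = {}" "set (L i) \<inter> set ys = {}"
    if "i \<in> S" "i \<noteq> r" for i
    using disj[OF that(1) r that(2)] Lr by auto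
  let ?L = "L(r := ys, s := xs)"
  have L's: "?L s = xs" and L'r: "?L r = ys" and L'o: "\<And>i. i \<in> S \<Longrightarrow> i \<noteq> r \<Longrightarrow> ?L i = L i"
    using rs s by auto
  have cases_S: "i = s \<or> i = r \<or> (i \<in> S \<and> i \<noteq> r)" if "i \<in> insert s S" for i using that by auto
  show "rotation_system (insert s S) ?L (H - {h, h'}) (merge_delete h h' \<sigma>)"
    unfolding rotation_system_def
  proof (intro conjI ballI impI)
    show "finite (insert s S)" using S by simp
    show "merge_delete h h' \<sigma> permutes (H - {h, h'})" using S(2) hH by (rule merge_delete_permutes)
    have "(\<Union>i\<in>insert s S. set (?L i)) = set xs \<union> set ys \<union> (\<Union>i\<in>S - {r}. set (L i))"
      using rs s r by (auto split: if_splits)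
    moreover have "H = {h, h'} \<union> set xs \<union> set ys \<union> (\<Union>i\<in>S - {r}. set (L i))"
      unfolding H using r Lr by (auto; force)
    moreover have "{h, h'} \<inter> (set xs \<union> set ys \<union> (\<Union>i\<in>S - {r}. set (L i))) = {}"
      using d off by auto
    ultimately show "H - {h, h'} = (\<Union>i\<in>insert s S. set (?L i))" by blast
  next
    fix i assume "i \<in> insert s S"
    then show "distinct (?L i)" using cases_S[of i] L's L'r L'o L(1) d by auto
  next
    fix i assume "i \<in> insert s S"
    then show "cyclic_along (merge_delete h h' \<sigma>) (?L i)"
      using cases_S[of i] L's L'r L'o same(1,2) merge_delete_outside[OF L(2) off(1,2) inj] by metis
  next
    fix i j assume i: "i \<in> insert s S" and j: "j \<in> insert s S" and ij: "i \<noteq> j"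
    show "set (?L i) \<inter> set (?L j) = {}"
      by (insert cases_S[OF i] cases_S[OF j] ij, elim disjE conjE)
        (use L's L'r L'o[of i] L'o[of j] off(3,4)[of i] off(3,4)[of j] disj[of i j] d rs in
            \<open>auto split: if_splits\<close>)
  qed
qed

text \<open>
  The removed edge joins \<open>r\<close> to another vertex \<open>i\<close>; the fused vertex keeps the label \<open>r\<close>.
\<close>

lemma rotation_system_merge:
  assumes sys: "rotation_system S L H \<sigma>" and r: "r \<in> S" and i: "i \<in> S" "i \<noteq> r"
    and Lr: "L r = h # as" and Li: "L i = xs @ h' # ys"
  shows "rotation_system (S - {i}) (L(r := as @ ys @ xs)) (H - {h, h'}) (merge_delete h h' \<sigma>)"
    "\<sigma> h' \<noteq> h" "delete_point h (\<sigma> \<circ> transpose h h') h' = h' \<longleftrightarrow> as @ ys @ xs = []"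
proof -
  have S: "finite S" "\<sigma> permutes H" and H: "H = (\<Union>i\<in>S. set (L i))"
    and L: "\<And>i. i \<in> S \<Longrightarrow> distinct (L i)" "\<And>i. i \<in> S \<Longrightarrow> cyclic_along \<sigma> (L i)"
    and disj: "\<And>i j. i \<in> S \<Longrightarrow> j \<in> S \<Longrightarrow> i \<noteq> j \<Longrightarrow> set (L i) \<inter> set (L j) = {}"
    using sys by (auto simp: rotation_system_def)
  have inj: "inj \<sigma>" using S(2) by (rule permutes_inj)
  have d: "distinct ((h # as) @ (h' # ys @ xs))"
    using L(1)[OF r] L(1)[OF i(1)] disj[OF i(1) r i(2)] Lr Li by auto
  have c: "cyclic_along \<sigma> (h' # ys @ xs)"
    using cyclic_along_append_swap[of \<sigma> xs "h' # ys"] L(2)[OF i(1)] Li by simp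
  note two = merge_delete_two_cycles[OF L(2)[OF r, unfolded Lr] c d inj]
  show "\<sigma> h' \<noteq> h" "delete_point h (\<sigma> \<circ> transpose h h') h' = h' \<longleftrightarrow> as @ ys @ xs = []"
    using two by auto
  have hH: "h \<in> H" unfolding H by (rule UN_I[OF r]) (simp add: Lr)
  have hH': "h' \<in> H" unfolding H by (rule UN_I[OF i(1)]) (simp add: Li)
  have off: "h \<notin> set (L k)" "h' \<notin> set (L k)" "set (L k) \<inter> set (as @ ys @ xs) = {}"
    if "k \<in> S" "k \<noteq> r" "k \<noteq> i" for k
    using disj[OF that(1) r that(2)] disj[OF that(1) i(1) that(3)] Lr Li by auto
  let ?L = "L(r := as @ ys @ xs)"
  show "rotation_system (S - {i}) ?L (H - {h, h'}) (merge_delete h h' \<sigma>)"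
    unfolding rotation_system_def
  proof (intro conjI ballI impI)
    show "finite (S - {i})" using S by simp
    show "merge_delete h h' \<sigma> permutes (H - {h, h'})" using S(2) hH hH' by (rule merge_delete_permutes)
    have "(\<Union>k\<in>S - {i}. set (?L k)) = set (as @ ys @ xs) \<union> (\<Union>k\<in>S - {r, i}. set (L k))"
      using r i by (auto split: if_splits)
    moreover have "H = {h, h'} \<union> set (as @ ys @ xs) \<union> (\<Union>k\<in>S - {r, i}. set (L k))"
    proof -
      have "S = {r, i} \<union> (S - {r, i})" using r i by auto
      then have "H = set (L r) \<union> set (L i) \<union> (\<Union>k\<in>S - {r, i}. set (L k))" unfolding H by blast
      then show ?thesis unfolding Lr Li by auto
    qed
    moreover have "{h, h'} \<inter> (set (as @ ys @ xs) \<union> (\<Union>k\<in>S - {r, i}. set (L k))) = {}"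
      using d off by auto
    ultimately show "H - {h, h'} = (\<Union>k\<in>S - {i}. set (?L k))" by blast
  next
    fix k assume "k \<in> S - {i}"
    then show "distinct (?L k)" using L(1)[of k] d by auto
  next
    fix k assume "k \<in> S - {i}"
    then show "cyclic_along (merge_delete h h' \<sigma>) (?L k)"
      using two(1) merge_delete_outside[OF L(2) off(1,2) inj] by (cases "k = r") auto
  next
    fix k l assume "k \<in> S - {i}" "l \<in> S - {i}" "k \<noteq> l"
    then show "set (?L k) \<inter> set (?L l) = {}"
      using off(3)[of k] off(3)[of l] disj[of k l] by (cases "k = r"; cases "l = r") auto
  qed
qed

section \<open>The root-edge recursion for all gluings\<close>

definition transport :: "('a \<Rightarrow> 'b) \<Rightarrow> ('b \<Rightarrow> 'a) \<Rightarrow> 'b set \<Rightarrow> ('a \<Rightarrow> 'a) \<Rightarrow> 'b \<Rightarrow> 'b" where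
  "transport f g H' p = (\<lambda>y. if y \<in> H' then f (p (g y)) else y)"

lemma transport_gluings:
  assumes f: "\<And>x. x \<in> H \<Longrightarrow> f x \<in> H' \<and> g (f x) = x" and g: "\<And>y. y \<in> H' \<Longrightarrow> g y \<in> H \<and> f (g y) = y"
    and t: "\<tau> \<in> gluings H"
  shows "transport f g H' \<tau> \<in> gluings H'" "transport g f H (transport f g H' \<tau>) = \<tau>"
proof -
  have \<tau>: "\<tau> permutes H" "\<And>x. x \<in> H \<Longrightarrow> \<tau> x \<noteq> x \<and> \<tau> (\<tau> x) = x"
    using t by (auto simp: gluings_def fixed_point_free_involution_on_def)
  have im: "\<tau> x \<in> H" if "x \<in> H" for x using \<tau>(1) that by (simp add: permutes_in_image)
  have inv: "transport f g H' \<tau> (transport f g H' \<tau> y) = y" for y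
    using f g im \<tau>(2) by (simp add: transport_def)
  have "transport f g H' \<tau> permutes H'"
    unfolding permutes_def
  proof (intro conjI allI impI)
    fix y show "\<exists>!x. transport f g H' \<tau> x = y" using inv by metis
  qed (simp add: transport_def)
  moreover have "transport f g H' \<tau> y \<noteq> y" if "y \<in> H'" for y
    using that f g im \<tau>(2) unfolding transport_def by metis
  ultimately show "transport f g H' \<tau> \<in> gluings H'"
    using inv by (simp add: gluings_def fixed_point_free_involution_on_def)
  show "transport g f H (transport f g H' \<tau>) = \<tau>"
  proof
    fix x show "transport g f H (transport f g H' \<tau>) x = \<tau> x"
      using f im permutes_not_in[OF \<tau>(1)] by (cases "x \<in> H") (simp_all add: transport_def)
  qed
qed

lemma orbit_semiconj:
  assumes p: "\<And>x. x \<in> H \<Longrightarrow> p x \<in> H" and conj: "\<And>x. x \<in> H \<Longrightarrow> f (p x) = q (f x)" and x: "x \<in> H"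
  shows "orbit q (f x) = f ` orbit p x"
proof (intro equalityI subsetI)
  fix y assume "y \<in> orbit q (f x)"
  then have "\<exists>z\<in>orbit p x. z \<in> H \<and> y = f z"
  proof induction
    case base
    show ?case using orbit.base[of p x] p[OF x] conj[OF x] by metis
  next
    case (step y)
    then obtain z where "z \<in> orbit p x" "z \<in> H" "y = f z" by metis
    then show ?case using orbit.step[of z p x] p[of z] conj[of z] by metis
  qed
  then show "y \<in> f ` orbit p x" by (metis image_eqI)
next
  fix y assume "y \<in> f ` orbit p x"
  then obtain z where z: "z \<in> orbit p x" "y = f z" by (rule imageE) metis
  from z(1) have "z \<in> H \<and> f z \<in> orbit q (f x)"
  proof induction
    case base
    show ?case using orbit.base[of q "f x"] p[OF x] conj[OF x] by metis
  next
    case (step z)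
    then show ?case using orbit.step[of "f z" q "f x"] p[of z] conj[of z] by metis
  qed
  then show "y \<in> orbit q (f x)" using z(2) by simp
qed

lemma num_cycles_on_semiconj:
  assumes p: "\<And>x. x \<in> H \<Longrightarrow> p x \<in> H" and conj: "\<And>x. x \<in> H \<Longrightarrow> f (p x) = q (f x)"
    and inj: "inj_on f H"
  shows "num_cycles_on (f ` H) q = num_cycles_on H p"
proof -
  have "orbit q ` f ` H = (\<lambda>C. f ` C) ` orbit p ` H"
    unfolding image_image
      by (rule image_cong[OF refl]) (rule orbit_semiconj[where H = H], use p conj in auto)
  moreover have "orbit p ` H \<subseteq> Pow H"
  proof
    fix C assume "C \<in> orbit p ` H"
    then obtain x where x: "x \<in> H" "C = orbit p x" by (rule imageE) metis
    have "z \<in> H" if "z \<in> orbit p x" for z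
      using that by induction (use p x in metis)+
    then show "C \<in> Pow H" using x by blast
  qed
  then have "inj_on (\<lambda>C. f ` C) (orbit p ` H)"
    using inj by (metis inj_on_image_Pow inj_on_subset)
  ultimately show ?thesis by (simp add: num_cycles_on_def card_image)
qed

text \<open>
  Transport along \<open>f\<close> is a bijection of gluings which maps faces to faces.
\<close>

lemma face_poly_conj:
  assumes bij: "bij_betw f H H'" and s: "\<sigma> permutes H"
    and conj: "\<And>x. x \<in> H \<Longrightarrow> f (\<sigma> x) = \<sigma>' (f x)"
  shows "face_poly H \<sigma> = face_poly H' \<sigma>'"
proof -
  define g where "g = inv_into H f"
  have f: "\<And>x. x \<in> H \<Longrightarrow> f x \<in> H' \<and> g (f x) = x"
    using bij unfolding g_def by (simp add: bij_betw_apply bij_betw_inv_into_left)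
  have g: "\<And>y. y \<in> H' \<Longrightarrow> g y \<in> H \<and> f (g y) = y"
    using bij unfolding g_def
    by (metis bij_betw_imp_surj_on bij_betw_inv_into_right inv_into_into)
  show ?thesis
    unfolding face_poly_def
  proof (rule sum.reindex_bij_witness[where j = "transport f g H'" and i = "transport g f H"])
    fix \<tau> assume t: "\<tau> \<in> gluings H"
    show "transport g f H (transport f g H' \<tau>) = \<tau>" "transport f g H' \<tau> \<in> gluings H'"
      using transport_gluings[OF f g t] by auto
    have \<tau>: "\<tau> permutes H" using t by (auto simp: gluings_def fixed_point_free_involution_on_def)
    have "num_cycles_on (f ` H) (\<sigma>' \<circ> transport f g H' \<tau>) = num_cycles_on H (\<sigma> \<circ> \<tau>)"
    proof (rule num_cycles_on_semiconj)
      show "(\<sigma> \<circ> \<tau>) x \<in> H" if "x \<in> H" for x using \<tau> s that by (simp add: permutes_in_image)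
      show "f ((\<sigma> \<circ> \<tau>) x) = (\<sigma>' \<circ> transport f g H' \<tau>) (f x)" if "x \<in> H" for x
        using that f conj \<tau> by (simp add: transport_def permutes_in_image)
      show "inj_on f H" using bij by (rule bij_betw_imp_inj_on)
    qed
    then show "monom 1 (num_cycles_on H' (\<sigma>' \<circ> transport f g H' \<tau>)) = monom 1 (num_cycles_on H (\<sigma> \<circ> \<tau>))"
      using bij by (simp add: bij_betw_imp_surj_on)
  next
    fix \<tau> assume t: "\<tau> \<in> gluings H'"
    show "transport f g H' (transport g f H \<tau>) = \<tau>" "transport g f H \<tau> \<in> gluings H"
      using transport_gluings[OF g f t] by auto
  qed
qed

definition half_edges_of :: "nat set \<Rightarrow> (nat \<Rightarrow> nat) \<Rightarrow> (nat \<times> nat) set" where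
  "half_edges_of S d = Sigma S (\<lambda>i. {0..<d i})"

definition rotation_of :: "nat set \<Rightarrow> (nat \<Rightarrow> nat) \<Rightarrow> nat \<times> nat \<Rightarrow> nat \<times> nat" where
  "rotation_of S d h = (if h \<in> half_edges_of S d then (fst h, Suc (snd h) mod d (fst h)) else h)"

text \<open>
  A vertex of degree 0 has no half-edges, hence contributes no cycle, but by itself it is a map on the sphere
  with one face. The first factor counts these faces; with it, the faces lost when an edge is removed
  (\<open>num_cycles_root\<close>) are accounted for by the vertices that the removal leaves bare.
\<close>

definition maps_poly :: "nat set \<Rightarrow> (nat \<Rightarrow> nat) \<Rightarrow> real poly" where
  "maps_poly S d = monom 1 (card {i\<in>S. d i = 0}) * face_poly (half_edges_of S d) (rotation_of S d)"

lemma map_rotation_of: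
  assumes "i \<in> S"
  shows "map (rotation_of S d) (map (Pair i) [0..<d i]) = rotate1 (map (Pair i) [0..<d i])"
  using assms by (intro nth_equalityI) (auto simp: nth_rotate1 rotation_of_def half_edges_of_def)

lemma rotation_of_permutes: "finite S \<Longrightarrow> rotation_of S d permutes half_edges_of S d"
proof (rule bij_imp_permutes)
  assume S: "finite S"
  have fin: "finite (half_edges_of S d)" using S by (simp add: half_edges_of_def)
  have img: "rotation_of S d ` Pair i ` {0..<d i} = Pair i ` {0..<d i}" if "i \<in> S" for i
    using map_rotation_of[OF that, of d] by (metis set_map set_rotate1 set_upt)
  have "rotation_of S d ` half_edges_of S d = half_edges_of S d"
  proof -
    have H: "half_edges_of S d = (\<Union>i\<in>S. Pair i ` {0..<d i})" by (auto simp: half_edges_of_def)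
    show ?thesis unfolding H image_UN using img by (intro SUP_cong) auto
  qed
  then show "bij_betw (rotation_of S d) (half_edges_of S d) (half_edges_of S d)"
    using fin by (simp add: bij_betw_def eq_card_imp_inj_on)
qed (simp add: rotation_of_def)

lemma rotation_system_of:
  "finite S \<Longrightarrow> rotation_system S (\<lambda>i. map (Pair i) [0..<d i]) (half_edges_of S d) (rotation_of S d)"
  unfolding rotation_system_def cyclic_along_def
  using map_rotation_of[of _ S d] rotation_of_permutes[of S d]
  by (auto simp: half_edges_of_def distinct_map inj_on_def simp del: map_map)

text \<open>
  Numbering the half-edges around each vertex along its list conjugates an arbitrary rotation system to the
  standard one. So the polynomial depends on the degrees only, and after the removal of an edge one may
  return to the standard rotation system.
\<close>

lemma face_poly_rotation_system:
  assumes sys: "rotation_system S L H \<sigma>" and d: "\<And>i. i \<in> S \<Longrightarrow> length (L i) = d i"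
  shows "monom 1 (card {i\<in>S. L i = []}) * face_poly H \<sigma> = maps_poly S d"
proof -
  have S: "finite S" "\<sigma> permutes H" and H: "H = (\<Union>i\<in>S. set (L i))"
    and L: "\<And>i. i \<in> S \<Longrightarrow> distinct (L i)" "\<And>i. i \<in> S \<Longrightarrow> map \<sigma> (L i) = rotate1 (L i)"
    and disj: "\<And>i j. i \<in> S \<Longrightarrow> j \<in> S \<Longrightarrow> i \<noteq> j \<Longrightarrow> set (L i) \<inter> set (L j) = {}"
    using sys by (auto simp: rotation_system_def cyclic_along_def)
  define f where "f = (\<lambda>h. L (fst h) ! snd h)"
  have "bij_betw f (half_edges_of S d) H"
    unfolding bij_betw_def
  proof
    show "inj_on f (half_edges_of S d)"
    proof (rule inj_onI)
      fix a b assume a: "a \<in> half_edges_of S d" and b: "b \<in> half_edges_of S d" and eq: "f a = f b"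
      obtain i m where a': "a = (i, m)" "i \<in> S" "m < length (L i)"
        using a d by (auto simp: half_edges_of_def)
      obtain j n where b': "b = (j, n)" "j \<in> S" "n < length (L j)"
        using b d by (auto simp: half_edges_of_def)
      have "L i ! m \<in> set (L i)" "L j ! n \<in> set (L j)" using a' b' by simp_all
      moreover have "L i ! m = L j ! n" using eq a' b' by (simp add: f_def)
      ultimately have "i = j" using disj[OF a'(2) b'(2)] by auto
      then show "a = b" using eq a' b' L(1)[OF b'(2)] by (simp add: f_def nth_eq_iff_index_eq)
    qed
    show "f ` half_edges_of S d = H"
      unfolding H using d by (force simp: half_edges_of_def f_def in_set_conv_nth image_iff)
  qed
  moreover have "f (rotation_of S d h) = \<sigma> (f h)" if h: "h \<in> half_edges_of S d" for h
  proof -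
    obtain i m where a': "h = (i, m)" "i \<in> S" "m < length (L i)" using h d by (auto simp: half_edges_of_def)
    have "\<sigma> (L i ! m) = rotate1 (L i) ! m" using L(2)[OF a'(2)] a'(3) by (metis nth_map)
    then show ?thesis using h a' d[OF a'(2)] by (simp add: f_def rotation_of_def nth_rotate1)
  qed
  ultimately have "face_poly (half_edges_of S d) (rotation_of S d) = face_poly H \<sigma>"
    using S by (intro face_poly_conj[where f = f] rotation_of_permutes) auto
  moreover have "{i\<in>S. L i = []} = {i\<in>S. d i = 0}" by (rule Collect_cong) (metis d length_0_conv)
  ultimately show ?thesis by (simp add: maps_poly_def)
qed

lemma maps_poly_cong:
  assumes "finite S" "\<And>i. i \<in> S \<Longrightarrow> d i = d' i" shows "maps_poly S d = maps_poly S d'"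
  using face_poly_rotation_system[OF rotation_system_of[OF assms(1), of d], of d]
    face_poly_rotation_system[OF rotation_system_of[OF assms(1), of d], of d'] assms(2) by simp

lemma maps_poly_relabel:
  assumes S: "finite S" and bij: "bij_betw \<pi> S S'" and d: "\<And>i. i \<in> S \<Longrightarrow> d i = d' (\<pi> i)"
  shows "maps_poly S d = maps_poly S' d'"
proof -
  let ?L = "\<lambda>i. map (Pair i) [0..<d' i]"
  have S': "finite S'" using S bij by (simp add: bij_betw_finite)
  have img: "\<pi> ` S = S'" and inj: "inj_on \<pi> S" using bij by (auto simp: bij_betw_def)
  have sys: "rotation_system S' ?L (half_edges_of S' d') (rotation_of S' d')"
    using S' by (rule rotation_system_of)
  have "rotation_system S (\<lambda>i. ?L (\<pi> i)) (half_edges_of S' d') (rotation_of S' d')"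
    using sys S inj unfolding rotation_system_def img[symmetric]
    by (auto simp: inj_on_def simp del: map_map)
  from face_poly_rotation_system[OF this, of d] d
  have "maps_poly S d = monom 1 (card {i\<in>S. d' (\<pi> i) = 0})
      * face_poly (half_edges_of S' d') (rotation_of S' d')"
    by simp
  moreover have "card {i\<in>S. d' (\<pi> i) = 0} = card {i\<in>S'. d' i = 0}"
  proof -
    have "{i\<in>S'. d' i = 0} = \<pi> ` {i\<in>S. d' (\<pi> i) = 0}" using img by auto
    moreover have "inj_on \<pi> {i\<in>S. d' (\<pi> i) = 0}" using inj by (auto simp: inj_on_def)
    ultimately show ?thesis by (simp add: card_image)
  qed
  ultimately show ?thesis by (simp add: maps_poly_def)
qed

text \<open>
  The root is the half-edge \<open>(r, 0)\<close>. If it is glued to \<open>(r, a + 1)\<close>, the vertex splits into pieces of degrees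
  \<open>a\<close> and \<open>k - 1 - a\<close>; if it is glued to one of the \<open>d i\<close> half-edges of another vertex \<open>i\<close>, the two
  vertices fuse into one of degree \<open>k + (d i - 1)\<close>.
\<close>

theorem maps_poly_root_edge:
  assumes S: "finite S" and r: "r \<in> S" and k: "d r = Suc k" and s: "s \<notin> S"
  shows "maps_poly S d = (\<Sum>a<k. maps_poly (insert s S) (d(r := k - 1 - a, s := a)))
     + (\<Sum>i\<in>S - {r}. of_nat (d i) * maps_poly (S - {i}) (d(r := k + d i - 1)))"
proof -
  define H where "H = half_edges_of S d"
  define \<sigma> where "\<sigma> = rotation_of S d"
  define L where "L = (\<lambda>i. map (Pair i) [0..<d i])"
  define h where "h = (r, 0::nat)"
  define z where "z = card {i\<in>S. d i = 0}"
  define F where "F h' = monom (1::real) ((if \<sigma> h' = h then 1 else 0)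
        + (if delete_point h (\<sigma> \<circ> transpose h h') h' = h' then 1 else 0))
      * face_poly (H - {h, h'}) (merge_delete h h' \<sigma>)" for h'
  have sys: "rotation_system S L H \<sigma>" unfolding L_def H_def \<sigma>_def using S by (rule rotation_system_of)
  have hH: "h \<in> H" using r k by (simp add: h_def H_def half_edges_of_def)
  have finH: "finite H" using S by (simp add: H_def half_edges_of_def)
  have rs: "r \<noteq> s" using r s by auto
  have same: "monom 1 z * F (r, Suc a) = maps_poly (insert s S) (d(r := k - 1 - a, s := a))"
    if a: "a < k" for a
  proof -
    define xs where "xs = map (Pair r) [Suc 0..<Suc a]"
    define ys where "ys = map (Pair r) [Suc (Suc a)..<Suc k]"
    have "[0..<Suc k] = 0 # [Suc 0..<Suc a] @ Suc a # [Suc (Suc a)..<Suc k]"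
      using a by (metis Suc_leI le_SucI less_Suc_eq_le upt_conv_Cons upt_add_eq_append zero_less_Suc
          le_add_diff_inverse Suc_le_mono)
    then have Lr: "L r = h # xs @ (r, Suc a) # ys"
      by (simp only: L_def k h_def xs_def ys_def list.map map_append)
    note split = rotation_system_split[OF sys r Lr s]
    let ?L = "L(r := ys, s := xs)" let ?e = "(if ys = [] then 1 else 0) + (if xs = [] then 1 else (0::nat))"
    have zero: "{i\<in>insert s S. ?L i = []} = {i\<in>S. d i = 0} \<union> ({i\<in>{r}. ys = []} \<union> {i\<in>{s}. xs = []})"
      using r s rs k by (auto simp: L_def)
    have "card {i\<in>insert s S. ?L i = []} = z + ?e"
      unfolding zero z_def using r s rs k S by (subst card_Un_disjoint) auto
    moreover have "F (r, Suc a)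
        = monom 1 ?e * face_poly (H - {h, (r, Suc a)}) (merge_delete h (r, Suc a) \<sigma>)"
      unfolding F_def using split(2,3) by simp
    ultimately have "monom 1 z * F (r, Suc a) = monom 1 (card {i\<in>insert s S. ?L i = []}) *
        face_poly (H - {h, (r, Suc a)}) (merge_delete h (r, Suc a) \<sigma>)"
      by (simp add: mult_monom mult.assoc[symmetric])
    also have "\<dots> = maps_poly (insert s S) (d(r := k - 1 - a, s := a))"
      by (rule face_poly_rotation_system[OF split(1)]) (auto simp: xs_def ys_def L_def)
    finally show ?thesis .
  qed
  have other: "monom 1 z * F (i, n) = maps_poly (S - {i}) (d(r := k + d i - 1))"
    if i: "i \<in> S" "i \<noteq> r" and n: "n < d i" for i n
  proof -
    define xs where "xs = map (Pair i) [0..<n]"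
    define ys where "ys = map (Pair i) [Suc n..<d i]"
    define as where "as = map (Pair r) [Suc 0..<Suc k]"
    have "[0..<d i] = [0..<n] @ n # [Suc n..<d i]"
      using n by (metis less_imp_le_nat upt_conv_Cons upt_add_eq_append zero_le le_add_diff_inverse)
    then have Li: "L i = xs @ (i, n) # ys" by (simp only: L_def xs_def ys_def list.map map_append)
    have "[0..<Suc k] = 0 # [Suc 0..<Suc k]" by (simp add: upt_conv_Cons del: upt_Suc)
    then have Lr: "L r = h # as" by (simp only: L_def k h_def as_def list.map)
    note merge = rotation_system_merge[OF sys r i Lr Li]
    let ?L = "L(r := as @ ys @ xs)" let ?e = "if as @ ys @ xs = [] then 1 else (0::nat)"
    have zero: "{j\<in>S - {i}. ?L j = []} = {j\<in>S. d j = 0} \<union> {j\<in>{r}. as @ ys @ xs = []}"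
      using r i k n by (auto simp: L_def)
    have "card {j\<in>S - {i}. ?L j = []} = z + ?e"
      unfolding zero z_def using r i k S by (subst card_Un_disjoint) auto
    moreover have "F (i, n) = monom 1 ?e * face_poly (H - {h, (i, n)}) (merge_delete h (i, n) \<sigma>)"
      unfolding F_def using merge(2,3) by simp
    ultimately have "monom 1 z * F (i, n) = monom 1 (card {j\<in>S - {i}. ?L j = []}) *
        face_poly (H - {h, (i, n)}) (merge_delete h (i, n) \<sigma>)"
      by (simp add: mult_monom mult.assoc[symmetric])
    also have "\<dots> = maps_poly (S - {i}) (d(r := k + d i - 1))"
      by (rule face_poly_rotation_system[OF merge(1)]) (use n in \<open>auto simp: xs_def ys_def as_def L_def\<close>)
    finally show ?thesis .
  qed
  have decomp: "H - {h} = Pair r ` Suc ` {..<k} \<union> Sigma (S - {r}) (\<lambda>i. {..<d i})"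
  proof -
    have "{0..<Suc k} = insert 0 (Suc ` {..<k})" by (simp add: atLeast0LessThan lessThan_Suc_eq_insert_0)
    moreover have "H = Pair r ` {0..<Suc k} \<union> Sigma (S - {r}) (\<lambda>i. {..<d i})"
      using r k by (auto simp: H_def half_edges_of_def)
    ultimately show ?thesis by (auto simp: h_def)
  qed
  have "maps_poly S d = monom 1 z * (\<Sum>h'\<in>H - {h}. F h')"
    unfolding maps_poly_def z_def[symmetric] H_def[symmetric] \<sigma>_def[symmetric] F_def
    using face_poly_root[OF finH _ hH, of \<sigma>] rotation_of_permutes[OF S, of d] by (simp add: H_def \<sigma>_def)
  also have "(\<Sum>h'\<in>H - {h}. F h')
      = (\<Sum>h'\<in>Pair r ` Suc ` {..<k}. F h') + (\<Sum>h'\<in>Sigma (S - {r}) (\<lambda>i. {..<d i}). F h')"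
    unfolding decomp using S by (intro sum.union_disjoint) auto
  also have "(\<Sum>h'\<in>Pair r ` Suc ` {..<k}. F h') = (\<Sum>a<k. F (r, Suc a))"
    by (simp add: sum.reindex inj_on_def)
  also have "(\<Sum>h'\<in>Sigma (S - {r}) (\<lambda>i. {..<d i}). F h') = (\<Sum>i\<in>S - {r}. \<Sum>n<d i. F (i, n))"
    using S by (simp add: sum.Sigma)
  finally have "maps_poly S d
      = (\<Sum>a<k. monom 1 z * F (r, Suc a)) + (\<Sum>i\<in>S - {r}. \<Sum>n<d i. monom 1 z * F (i, n))"
    by (simp add: distrib_left sum_distrib_left)
  also have "(\<Sum>a<k. monom 1 z * F (r, Suc a)) = (\<Sum>a<k. maps_poly (insert s S) (d(r := k - 1 - a, s := a)))"
    by (rule sum.cong) (simp_all add: same)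
  also have "(\<Sum>i\<in>S - {r}. \<Sum>n<d i. monom 1 z * F (i, n)) =
      (\<Sum>i\<in>S - {r}. of_nat (d i) * maps_poly (S - {i}) (d(r := k + d i - 1)))"
    by (rule sum.cong) (simp_all add: other)
  finally show ?thesis .
qed

section \<open>Connected components\<close>

definition adjacency :: "nat set \<Rightarrow> (nat \<Rightarrow> nat) \<Rightarrow> (nat \<times> nat \<Rightarrow> nat \<times> nat) \<Rightarrow> nat rel" where
  "adjacency S d \<tau> = (\<lambda>h. (fst h, fst (\<tau> h))) ` half_edges_of S d"

definition connects :: "nat set \<Rightarrow> (nat \<Rightarrow> nat) \<Rightarrow> (nat \<times> nat \<Rightarrow> nat \<times> nat) \<Rightarrow> bool" where
  "connects S d \<tau> \<longleftrightarrow> (\<forall>i\<in>S. \<forall>j\<in>S. (i, j) \<in> (adjacency S d \<tau>)\<^sup>*)"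

definition connected_poly :: "nat set \<Rightarrow> (nat \<Rightarrow> nat) \<Rightarrow> real poly" where
  "connected_poly S d = monom 1 (card {i\<in>S. d i = 0}) *
     (\<Sum>\<tau>\<in>{\<tau> \<in> gluings (half_edges_of S d). connects S d \<tau>}.
        monom 1 (num_cycles_on (half_edges_of S d) (rotation_of S d \<circ> \<tau>)))"

lemma num_cycles_on_Un:
  assumes fin: "finite H1" "finite H2" and disj: "H1 \<inter> H2 = {}"
    and p: "p permutes (H1 \<union> H2)" and p1: "\<And>x. x \<in> H1 \<Longrightarrow> p x \<in> H1"
    and p2: "\<And>x. x \<in> H2 \<Longrightarrow> p x \<in> H2"
  shows "num_cycles_on (H1 \<union> H2) p = num_cycles_on H1 p + num_cycles_on H2 p"
proof -
  have perm: "permutation p" by (rule permutes_imp_permutation[OF _ p]) (use fin in auto)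
  have self: "x \<in> orbit p x" for x using perm by (rule permutation_self_in_orbit)
  have o1: "z \<in> H1" if "z \<in> orbit p x" "x \<in> H1" for x z
    using that by induction (use p1 in metis)+
  have o2: "z \<in> H2" if "z \<in> orbit p x" "x \<in> H2" for x z
    using that by induction (use p2 in metis)+
  have "orbit p ` H1 \<inter> orbit p ` H2 = {}"
  proof (rule ccontr)
    assume "orbit p ` H1 \<inter> orbit p ` H2 \<noteq> {}"
    then obtain C where C: "C \<in> orbit p ` H1" "C \<in> orbit p ` H2" by blast
    from C(1) obtain x where x: "x \<in> H1" "C = orbit p x" by (rule imageE)
    from C(2) obtain y where y: "y \<in> H2" "C = orbit p y" by (rule imageE)
    have "x \<in> H2" using o2[OF _ y(1), of x] self[of x] x(2) y(2) by simp
    then show False using x(1) disj by (simp add: disjoint_iff)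
  qed
  then show ?thesis
    using fin by (simp add: num_cycles_on_def image_Un card_Un_disjoint)
qed

lemma num_cycles_on_cong:
  assumes "\<And>x. x \<in> H \<Longrightarrow> p x \<in> H" "\<And>x. x \<in> H \<Longrightarrow> q x = p x"
  shows "num_cycles_on H q = num_cycles_on H p"
proof -
  have "num_cycles_on ((\<lambda>x. x) ` H) q = num_cycles_on H p"
    by (rule num_cycles_on_semiconj[OF assms(1)]) (simp_all add: assms(2))
  then show ?thesis by simp
qed

lemma gluingsD:
  assumes "\<tau> \<in> gluings H"
  shows "\<tau> permutes H" "\<And>h. h \<in> H \<Longrightarrow> \<tau> h \<noteq> h" "\<And>h. \<tau> (\<tau> h) = h" "\<And>h. h \<in> H \<Longrightarrow> \<tau> h \<in> H"
    "\<And>h. h \<notin> H \<Longrightarrow> \<tau> h = h"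
proof -
  show p: "\<tau> permutes H" and "\<And>h. h \<in> H \<Longrightarrow> \<tau> h \<noteq> h"
    using assms by (auto simp: gluings_def fixed_point_free_involution_on_def)
  show "\<tau> (\<tau> h) = h" for h
    using assms
      by (cases "h \<in> H") (auto simp: gluings_def fixed_point_free_involution_on_def permutes_not_in)
  show "\<And>h. h \<in> H \<Longrightarrow> \<tau> h \<in> H" "\<And>h. h \<notin> H \<Longrightarrow> \<tau> h = h"
    using p by (simp_all add: permutes_in_image permutes_not_in)
qed

lemma gluingsI:
  assumes "\<And>h. h \<in> H \<Longrightarrow> \<tau> h \<in> H \<and> \<tau> h \<noteq> h \<and> \<tau> (\<tau> h) = h" "\<And>h. h \<notin> H \<Longrightarrow> \<tau> h = h"
  shows "\<tau> \<in> gluings H"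
proof -
  have "\<tau> (\<tau> h) = h" for h using assms by (cases "h \<in> H") auto
  then have "\<tau> permutes H" unfolding permutes_def using assms(2) by metis
  then show ?thesis using assms(1) by (simp add: gluings_def fixed_point_free_involution_on_def)
qed

lemma gluings_union:
  assumes t1: "\<tau>1 \<in> gluings H1" and t2: "\<tau>2 \<in> gluings H2" and disj: "H1 \<inter> H2 = {}"
  shows "\<tau>1 \<circ> \<tau>2 \<in> gluings (H1 \<union> H2)"
    "\<And>h. h \<in> H1 \<Longrightarrow> (\<tau>1 \<circ> \<tau>2) h = \<tau>1 h" "\<And>h. h \<in> H2 \<Longrightarrow> (\<tau>1 \<circ> \<tau>2) h = \<tau>2 h"
    "perm_restrict (\<tau>1 \<circ> \<tau>2) H1 = \<tau>1" "perm_restrict (\<tau>1 \<circ> \<tau>2) H2 = \<tau>2"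
proof -
  note 1 = gluingsD[OF t1] and 2 = gluingsD[OF t2]
  have d: "h \<in> H1 \<Longrightarrow> h \<notin> H2" for h using disj by auto
  show e1: "h \<in> H1 \<Longrightarrow> (\<tau>1 \<circ> \<tau>2) h = \<tau>1 h" for h using 2(5) d by simp
  show e2: "h \<in> H2 \<Longrightarrow> (\<tau>1 \<circ> \<tau>2) h = \<tau>2 h" for h using 1(5) 2(4)[of h] d by auto
  show "\<tau>1 \<circ> \<tau>2 \<in> gluings (H1 \<union> H2)"
  proof (rule gluingsI)
    fix h assume "h \<in> H1 \<union> H2"
    then show "(\<tau>1 \<circ> \<tau>2) h \<in> H1 \<union> H2 \<and> (\<tau>1 \<circ> \<tau>2) h \<noteq> h \<and> (\<tau>1 \<circ> \<tau>2) ((\<tau>1 \<circ> \<tau>2) h) = h"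
      using e1 e2 1(2-4) 2(2-4) by (metis Un_iff)
  qed (use 1(5) 2(5) in simp)
  show "perm_restrict (\<tau>1 \<circ> \<tau>2) H1 = \<tau>1" "perm_restrict (\<tau>1 \<circ> \<tau>2) H2 = \<tau>2"
    using e1 e2 1(5) 2(5) by (auto simp: perm_restrict_def fun_eq_iff)
qed

lemma gluings_perm_restrict:
  assumes t: "\<tau> \<in> gluings H" and sub: "H1 \<subseteq> H" and inv: "\<And>h. h \<in> H1 \<Longrightarrow> \<tau> h \<in> H1"
  shows "perm_restrict \<tau> H1 \<in> gluings H1" "perm_restrict \<tau> (H - H1) \<in> gluings (H - H1)"
    "perm_restrict \<tau> H1 \<circ> perm_restrict \<tau> (H - H1) = \<tau>"
proof -
  note T = gluingsD[OF t]
  have inv2: "\<tau> h \<in> H - H1" if "h \<in> H - H1" for h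
    using T(3)[of h] T(4)[of h] inv[of "\<tau> h"] that by auto
  show "perm_restrict \<tau> H1 \<in> gluings H1"
    using T(2,3) inv sub by (intro gluingsI) (auto simp: perm_restrict_def)
  show "perm_restrict \<tau> (H - H1) \<in> gluings (H - H1)"
    using T(2,3) inv2 by (intro gluingsI) (auto simp: perm_restrict_def)
  show "perm_restrict \<tau> H1 \<circ> perm_restrict \<tau> (H - H1) = \<tau>"
    using inv2 T(5) sub by (auto simp: perm_restrict_def fun_eq_iff)
qed

definition component :: "nat set \<Rightarrow> (nat \<Rightarrow> nat) \<Rightarrow> (nat \<times> nat \<Rightarrow> nat \<times> nat) \<Rightarrow> nat \<Rightarrow> nat set" where
  "component S d \<tau> r = (adjacency S d \<tau>)\<^sup>* `` {r}"

lemma half_edges_of_mono: "B \<subseteq> S \<Longrightarrow> half_edges_of B d \<subseteq> half_edges_of S d"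
  by (auto simp: half_edges_of_def)

lemma half_edges_of_Diff: "half_edges_of (S - B) d = half_edges_of S d - half_edges_of B d"
  by (auto simp: half_edges_of_def)

lemma fst_half_edge: "h \<in> half_edges_of S d \<Longrightarrow> fst h \<in> S"
  by (auto simp: half_edges_of_def)

lemma half_edges_of_subset_iff:
  "h \<in> half_edges_of S d \<Longrightarrow> B \<subseteq> S \<Longrightarrow> h \<in> half_edges_of B d \<longleftrightarrow> fst h \<in> B"
  by (auto simp: half_edges_of_def)

lemma component_subset:
  assumes t: "\<tau> \<in> gluings (half_edges_of S d)" and r: "r \<in> S"
  shows "component S d \<tau> r \<subseteq> S" "r \<in> component S d \<tau> r"
proof -
  have "j \<in> S" if "(r, j) \<in> (adjacency S d \<tau>)\<^sup>*" for j
    using that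
  proof induction
    case (step y z)
    then obtain h where "h \<in> half_edges_of S d" "z = fst (\<tau> h)" by (auto simp: adjacency_def)
    then show ?case using fst_half_edge[OF gluingsD(4)[OF t]] by simp
  qed (rule r)
  then show "component S d \<tau> r \<subseteq> S" by (auto simp: component_def)
qed (simp add: component_def)

text \<open>
  A set of vertices is a component if and only if no edge leaves it and its own edges connect it. Reversing an
  edge is possible as \<open>\<tau>\<close> is an involution, so it suffices to connect every vertex to \<open>r\<close>.
\<close>

lemma component_eq_iff:
  assumes t: "\<tau> \<in> gluings (half_edges_of S d)" and B: "B \<subseteq> S" "r \<in> B"
  shows "component S d \<tau> r = B \<longleftrightarrow>
    (\<forall>h\<in>half_edges_of B d. \<tau> h \<in> half_edges_of B d) \<and>
    connects B d (perm_restrict \<tau> (half_edges_of B d))"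
proof
  note T = gluingsD[OF t]
  let ?A = "adjacency S d \<tau>" and ?\<tau> = "perm_restrict \<tau> (half_edges_of B d)"
  let ?A1 = "adjacency B d ?\<tau>"
  {
    assume comp: "component S d \<tau> r = B"
    have inv: "\<forall>h\<in>half_edges_of B d. \<tau> h \<in> half_edges_of B d"
    proof
      fix h assume h: "h \<in> half_edges_of B d"
      then have hS: "h \<in> half_edges_of S d" using half_edges_of_mono[OF B(1)] by blast
      have "(r, fst h) \<in> ?A\<^sup>*" using fst_half_edge[OF h] comp by (auto simp: component_def)
      moreover have "(fst h, fst (\<tau> h)) \<in> ?A" using hS by (auto simp: adjacency_def)
      ultimately have "fst (\<tau> h) \<in> B" using comp by (auto simp: component_def)
      then show "\<tau> h \<in> half_edges_of B d" using half_edges_of_subset_iff[OF T(4)[OF hS] B(1)] by simp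
    qed
    have "(r, i) \<in> ?A1\<^sup>*" if "(r, i) \<in> ?A\<^sup>*" for i
      using that
    proof induction
      case (step y z)
      obtain h where h: "h \<in> half_edges_of S d" "y = fst h" "z = fst (\<tau> h)"
        using step(2) by (auto simp: adjacency_def)
      have "y \<in> B" using step(1) comp by (auto simp: component_def)
      then have "h \<in> half_edges_of B d" using h half_edges_of_subset_iff[OF h(1) B(1)] by simp
      then have "(y, z) \<in> ?A1" using h by (force simp: adjacency_def perm_restrict_def)
      then show ?case using step(3) by simp
    qed simp
    then have path: "(r, i) \<in> ?A1\<^sup>*" if "i \<in> B" for i using that comp by (auto simp: component_def)
    have "sym ?A1"
    proof (rule symI)
      fix a b assume "(a, b) \<in> ?A1"
      then obtain h where h: "h \<in> half_edges_of B d" "a = fst h" "b = fst (\<tau> h)"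
        by (auto simp: adjacency_def perm_restrict_def)
      have "\<tau> h \<in> half_edges_of B d" using inv h by blast
      then show "(b, a) \<in> ?A1" unfolding adjacency_def
        by (rule rev_image_eqI) (use h T(3) \<open>\<tau> h \<in> half_edges_of B d\<close> in \<open>simp add: perm_restrict_def\<close>)
    qed
    then have "sym (?A1\<^sup>*)" by (rule sym_rtrancl)
    then have "connects B d ?\<tau>" unfolding connects_def using path by (meson rtrancl_trans symD)
    with inv show "(\<forall>h\<in>half_edges_of B d. \<tau> h \<in> half_edges_of B d) \<and> connects B d ?\<tau>" by blast
  }
  {
    assume *: "(\<forall>h\<in>half_edges_of B d. \<tau> h \<in> half_edges_of B d) \<and> connects B d ?\<tau>"
    have "?A1 \<subseteq> ?A"
      using half_edges_of_mono[OF B(1), of d] by (auto simp: adjacency_def perm_restrict_def)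
    then have "?A1\<^sup>* \<subseteq> ?A\<^sup>*" by (rule rtrancl_mono)
    then have 1: "B \<subseteq> component S d \<tau> r" using * B(2) by (auto simp: connects_def component_def)
    have "i \<in> B" if "(r, i) \<in> ?A\<^sup>*" for i
      using that
    proof induction
      case (step y z)
      obtain h where h: "h \<in> half_edges_of S d" "y = fst h" "z = fst (\<tau> h)"
        using step(2) by (auto simp: adjacency_def)
      then have "h \<in> half_edges_of B d" using step(3) half_edges_of_subset_iff[OF h(1) B(1)] by simp
      then show ?case using * h(3) fst_half_edge by blast
    qed (rule B(2))
    then show "component S d \<tau> r = B" using 1 by (auto simp: component_def)
  }
qed

lemma rotation_of_in: "h \<in> half_edges_of S d \<Longrightarrow> rotation_of S d h \<in> half_edges_of S d"
  by (auto simp: rotation_of_def half_edges_of_def)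

text \<open>
  Classify the gluings by the component \<open>B\<close> of \<open>r\<close>. A gluing with this component is a connected gluing of \<open>B\<close>
  together with an arbitrary gluing of the rest, and the numbers of faces add up.
\<close>

lemma maps_poly_components:
  assumes S: "finite S" and r: "r \<in> S"
  shows "maps_poly S d = (\<Sum>B | B \<subseteq> S \<and> r \<in> B. connected_poly B d * maps_poly (S - B) d)"
proof -
  let ?H = "\<lambda>B. half_edges_of B d" and ?R = "\<lambda>B. rotation_of B d"
  let ?w = "\<lambda>B \<tau>. monom (1::real) (num_cycles_on (?H B) (?R B \<circ> \<tau>))"
  let ?z = "\<lambda>B. card {i\<in>B. d i = 0}"
  have fin: "finite (?H B)" if "B \<subseteq> S" for B
    using finite_subset[OF that S] by (simp add: half_edges_of_def)
  have eq: "(\<Sum>\<tau> | \<tau> \<in> gluings (?H S) \<and> component S d \<tau> r = B. ?w S \<tau>) =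
     (\<Sum>\<tau>1\<in>{\<tau> \<in> gluings (?H B). connects B d \<tau>}. ?w B \<tau>1) * (\<Sum>\<tau>2\<in>gluings (?H (S - B)). ?w (S - B) \<tau>2)"
    if B: "B \<subseteq> S" "r \<in> B" for B
  proof -
    have HS: "?H B \<union> ?H (S - B) = ?H S" using half_edges_of_mono[OF B(1), of d]
      by (auto simp: half_edges_of_Diff)
    have disj: "?H B \<inter> ?H (S - B) = {}" by (auto simp: half_edges_of_Diff)
    have "(\<Sum>(\<tau>1, \<tau>2)\<in>{\<tau> \<in> gluings (?H B). connects B d \<tau>} \<times> gluings (?H (S - B)). ?w B \<tau>1 * ?w (S - B) \<tau>2)
      = (\<Sum>\<tau> | \<tau> \<in> gluings (?H S) \<and> component S d \<tau> r = B. ?w S \<tau>)"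
    proof (rule sum.reindex_bij_witness[where
          j = "\<lambda>(\<tau>1, \<tau>2). \<tau>1 \<circ> \<tau>2" and i = "\<lambda>\<tau>. (perm_restrict \<tau> (?H B), perm_restrict \<tau> (?H (S - B)))"])
      fix \<tau> assume "\<tau> \<in> {\<tau> \<in> gluings (?H S). component S d \<tau> r = B}"
      then have t: "\<tau> \<in> gluings (?H S)" and c: "component S d \<tau> r = B" by auto
      from c have c: "\<forall>h\<in>?H B. \<tau> h \<in> ?H B" "connects B d (perm_restrict \<tau> (?H B))"
        using component_eq_iff[OF t B] by auto
      note g = gluings_perm_restrict[OF t half_edges_of_mono[OF B(1)] bspec[OF c(1)], folded
          half_edges_of_Diff]
      show "(case (perm_restrict \<tau> (?H B), perm_restrict \<tau> (?H (S - B))) of (\<tau>1, \<tau>2) \<Rightarrow> \<tau>1 \<circ> \<tau>2) = \<tau>"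
        using g(3) by simp
      show "(perm_restrict \<tau> (?H B), perm_restrict \<tau> (?H (S - B)))
          \<in> {\<tau> \<in> gluings (?H B). connects B d \<tau>} \<times> gluings (?H (S - B))"
        using g(1,2) c(2) by simp
    next
      fix p assume "p \<in> {\<tau> \<in> gluings (?H B). connects B d \<tau>} \<times> gluings (?H (S - B))"
      then obtain \<tau>1 \<tau>2 where p: "p = (\<tau>1, \<tau>2)" and t1: "\<tau>1 \<in> gluings (?H B)" "connects B d \<tau>1"
        and t2: "\<tau>2 \<in> gluings (?H (S - B))" by auto
      note u = gluings_union[OF t1(1) t2 disj, unfolded HS]
      note D1 = gluingsD[OF t1(1)] and D2 = gluingsD[OF t2] and D = gluingsD[OF u(1)]
      show "(\<lambda>\<tau>. (perm_restrict \<tau> (?H B), perm_restrict \<tau> (?H (S - B)))) (case p of (\<tau>1, \<tau>2) \<Rightarrow> \<tau>1 \<circ> \<tau>2) = p"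
        using u(4,5) p by simp
      show "(case p of (\<tau>1, \<tau>2) \<Rightarrow> \<tau>1 \<circ> \<tau>2) \<in> {\<tau> \<in> gluings (?H S). component S d \<tau> r = B}"
        using u(1,2,4) component_eq_iff[OF u(1) B] t1(2) D1(4) by (simp add: p del: comp_apply)
      have inB: "(?R S \<circ> (\<tau>1 \<circ> \<tau>2)) x = (?R B \<circ> \<tau>1) x" "(?R B \<circ> \<tau>1) x \<in> ?H B" if "x \<in> ?H B" for x
      proof -
        have "\<tau>1 x \<in> ?H B" using D1(4)[OF that] .
        then show "(?R S \<circ> (\<tau>1 \<circ> \<tau>2)) x = (?R B \<circ> \<tau>1) x" "(?R B \<circ> \<tau>1) x \<in> ?H B"
          using u(2)[OF that] half_edges_of_mono[OF B(1), of d] rotation_of_in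
            by (auto simp: rotation_of_def)
      qed
      have inC: "(?R S \<circ> (\<tau>1 \<circ> \<tau>2)) x = (?R (S - B) \<circ> \<tau>2) x" "(?R (S - B) \<circ> \<tau>2) x \<in> ?H (S - B)"
        if "x \<in> ?H (S - B)" for x
      proof -
        have "\<tau>2 x \<in> ?H (S - B)" using D2(4)[OF that] .
        then show "(?R S \<circ> (\<tau>1 \<circ> \<tau>2)) x = (?R (S - B) \<circ> \<tau>2) x" "(?R (S - B) \<circ> \<tau>2) x \<in> ?H (S - B)"
          using u(3)[OF that] half_edges_of_mono[of "S - B" S d] rotation_of_in
            by (auto simp: rotation_of_def)
      qed
      have "num_cycles_on (?H S) (?R S \<circ> (\<tau>1 \<circ> \<tau>2)) =
          num_cycles_on (?H B) (?R S \<circ> (\<tau>1 \<circ> \<tau>2)) + num_cycles_on (?H (S - B)) (?R S \<circ> (\<tau>1 \<circ> \<tau>2))"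
        unfolding HS[symmetric]
      proof (rule num_cycles_on_Un)
        show "?R S \<circ> (\<tau>1 \<circ> \<tau>2) permutes ?H B \<union> ?H (S - B)"
          unfolding HS by (rule permutes_compose[OF D(1) rotation_of_permutes[OF S]])
        show "(?R S \<circ> (\<tau>1 \<circ> \<tau>2)) x \<in> ?H B" if "x \<in> ?H B" for x
          unfolding inB(1)[OF that] by (rule inB(2)[OF that])
        show "(?R S \<circ> (\<tau>1 \<circ> \<tau>2)) x \<in> ?H (S - B)" if "x \<in> ?H (S - B)" for x
          unfolding inC(1)[OF that] by (rule inC(2)[OF that])
      qed (use fin B disj in auto)
      also have "num_cycles_on (?H B) (?R S \<circ> (\<tau>1 \<circ> \<tau>2)) = num_cycles_on (?H B) (?R B \<circ> \<tau>1)"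
        by (rule num_cycles_on_cong[OF inB(2) inB(1)])
      also have "num_cycles_on (?H (S - B)) (?R S \<circ> (\<tau>1 \<circ> \<tau>2))
          = num_cycles_on (?H (S - B)) (?R (S - B) \<circ> \<tau>2)"
        by (rule num_cycles_on_cong[OF inC(2) inC(1)])
      finally show "?w S (case p of (\<tau>1, \<tau>2) \<Rightarrow> \<tau>1 \<circ> \<tau>2) = (case p of (\<tau>1, \<tau>2) \<Rightarrow> ?w B \<tau>1 * ?w (S - B) \<tau>2)"
        by (simp only: p prod.case mult_monom mult_1_left)
    qed
    then show ?thesis by (simp only: sum_product sum.cartesian_product)
  qed
  have z: "?z S = ?z B + ?z (S - B)" if "B \<subseteq> S" for B
  proof -
    have "{i\<in>S. d i = 0} = {i\<in>B. d i = 0} \<union> {i\<in>S - B. d i = 0}" using that by auto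
    then show ?thesis using S finite_subset[OF that S] by (simp add: card_Un_disjoint disjoint_iff)
  qed
  have "face_poly (?H S) (?R S)
      = (\<Sum>B | B \<subseteq> S \<and> r \<in> B. \<Sum>\<tau> | \<tau> \<in> gluings (?H S) \<and> component S d \<tau> r = B. ?w S \<tau>)"
    unfolding face_poly_def
  proof (rule sum.group[symmetric])
    show "finite (gluings (?H S))" using fin by (intro finite_gluings) simp
    show "finite {B. B \<subseteq> S \<and> r \<in> B}" using S by simp
    show "(\<lambda>\<tau>. component S d \<tau> r) ` gluings (?H S) \<subseteq> {B. B \<subseteq> S \<and> r \<in> B}"
      using component_subset[OF _ r] by blast
  qed
  then have "maps_poly S d = (\<Sum>B | B \<subseteq> S \<and> r \<in> B. monom 1 (?z S) *
     (\<Sum>\<tau> | \<tau> \<in> gluings (?H S) \<and> component S d \<tau> r = B. ?w S \<tau>))"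
    by (simp add: maps_poly_def sum_distrib_left)
  also have "\<dots> = (\<Sum>B | B \<subseteq> S \<and> r \<in> B. connected_poly B d * maps_poly (S - B) d)"
  proof (rule sum.cong[OF refl])
    fix B assume "B \<in> {B. B \<subseteq> S \<and> r \<in> B}"
    then have B: "B \<subseteq> S" "r \<in> B" by auto
    have "monom (1::real) (?z S) = monom 1 (?z B) * monom 1 (?z (S - B))"
      by (simp add: z[OF B(1)] mult_monom)
    then show "monom 1 (?z S) * (\<Sum>\<tau> | \<tau> \<in> gluings (?H S) \<and> component S d \<tau> r = B. ?w S \<tau>) =
      connected_poly B d * maps_poly (S - B) d"
      unfolding eq[OF B] connected_poly_def maps_poly_def face_poly_def by (simp only: mult_ac)
  qed
  finally show ?thesis .
qed

section \<open>The root-edge recursion for connected gluings\<close>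

lemma face_poly_empty: "face_poly {} \<sigma> = 1"
proof -
  have "gluings ({} :: 'a set) = {id}"
    by (auto simp: gluings_def fixed_point_free_involution_on_def)
  then show ?thesis by (simp add: face_poly_def num_cycles_on_def)
qed

lemma maps_poly_empty: "maps_poly {} d = 1"
  by (simp add: maps_poly_def half_edges_of_def face_poly_empty)

lemma maps_poly_components':
  assumes R: "finite R" and r: "r \<notin> R"
  shows "maps_poly (insert r R) d = (\<Sum>J\<in>Pow R. connected_poly (insert r J) d * maps_poly (R - J) d)"
proof -
  have "(\<Sum>B | B \<subseteq> insert r R \<and> r \<in> B. connected_poly B d * maps_poly (insert r R - B) d)
    = (\<Sum>J\<in>Pow R. connected_poly (insert r J) d * maps_poly (R - J) d)"
  proof (rule sum.reindex_bij_witness[where i = "insert r" and j = "\<lambda>B. B - {r}"])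
    fix B assume B: "B \<in> {B. B \<subseteq> insert r R \<and> r \<in> B}"
    then have "insert r R - B = R - (B - {r})" using r by auto
    then show "connected_poly (insert r (B - {r})) d * maps_poly (R - (B - {r})) d =
      connected_poly B d * maps_poly (insert r R - B) d" using B by (simp add: insert_absorb)
  qed (use r in auto)
  then show ?thesis using maps_poly_components[of "insert r R" r d] R by simp
qed

text \<open>
  Solved for the summand \<open>J = R\<close>, the decomposition into components determines the connected polynomials
  from all others. This is the induction scheme for statements about connected gluings.
\<close>

lemma connected_poly_recursion:
  assumes R: "finite R" and r: "r \<notin> R"
  shows "connected_poly (insert r R) d = maps_poly (insert r R) d -
    (\<Sum>J\<in>Pow R - {R}. connected_poly (insert r J) d * maps_poly (R - J) d)"
  using maps_poly_components'[OF R r, of d] R sum.remove[of "Pow R" R "\<lambda>J. connected_poly (insert r J) d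
      * maps_poly (R - J) d"]
  by (simp add: maps_poly_empty)

lemma connected_poly_relabel:
  assumes "finite S" "S \<noteq> {}" "inj_on \<pi> S" "\<And>i. i \<in> S \<Longrightarrow> d i = d' (\<pi> i)"
  shows "connected_poly S d = connected_poly (\<pi> ` S) d'"
  using assms
proof (induction "card S" arbitrary: S rule: less_induct)
  case less
  obtain r R where S: "S = insert r R" and r: "r \<notin> R" using less.prems(2)
    by (metis all_not_in_conv mk_disjoint_insert)
  have R: "finite R" using less.prems(1) S by simp
  have r': "\<pi> r \<notin> \<pi> ` R" using less.prems(3) r unfolding S by auto
  have injR: "inj_on \<pi> R" using less.prems(3) unfolding S by simp
  have m: "maps_poly A d = maps_poly (\<pi> ` A) d'" if "A \<subseteq> S" for A
  proof (rule maps_poly_relabel)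
    show "finite A" using that less.prems(1) by (rule finite_subset)
    show "bij_betw \<pi> A (\<pi> ` A)" using less.prems(3) that by (meson bij_betw_imageI inj_on_subset)
  qed (use that less.prems(4) in auto)
  have inj: "inj_on ((`) \<pi>) (Pow R)" using injR by (rule inj_on_image_Pow)
  have img: "(`) \<pi> ` (Pow R - {R}) = Pow (\<pi> ` R) - {\<pi> ` R}"
    using inj_on_image_set_diff[OF inj, of "Pow R" "{R}"] image_Pow_surj[of \<pi> R "\<pi> ` R"] by auto
  have "(\<Sum>J\<in>Pow (\<pi> ` R) - {\<pi> ` R}. connected_poly (insert (\<pi> r) J) d' * maps_poly (\<pi> ` R - J) d')
      = (\<Sum>J\<in>Pow R - {R}. connected_poly (insert (\<pi> r) (\<pi> ` J)) d' * maps_poly (\<pi> ` R - \<pi> ` J) d')"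
    unfolding img[symmetric] by (subst sum.reindex) (auto intro: inj_on_subset[OF inj])
  also have "\<dots> = (\<Sum>J\<in>Pow R - {R}. connected_poly (insert r J) d * maps_poly (R - J) d)"
  proof (rule sum.cong[OF refl])
    fix J assume J: "J \<in> Pow R - {R}"
    then have sub: "insert r J \<subseteq> S" "insert r J \<noteq> S" using r unfolding S by auto
    then have "card (insert r J) < card S" using less.prems(1) by (intro psubset_card_mono) auto
    then have "connected_poly (insert r J) d = connected_poly (\<pi> ` insert r J) d'"
      by (rule less.hyps) (use sub less.prems finite_subset[OF sub(1)] inj_on_subset[OF _ sub(1)] in auto)
    moreover have "\<pi> ` R - \<pi> ` J = \<pi> ` (R - J)" using J
      by (intro inj_on_image_set_diff[OF injR, symmetric]) auto
    moreover have "maps_poly (R - J) d = maps_poly (\<pi> ` (R - J)) d'" by (rule m) (auto simp: S)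
    ultimately show "connected_poly (insert (\<pi> r) (\<pi> ` J)) d' * maps_poly (\<pi> ` R - \<pi> ` J) d' =
      connected_poly (insert r J) d * maps_poly (R - J) d" by simp
  qed
  finally show ?case
    using connected_poly_recursion[OF R r, of d] connected_poly_recursion[OF finite_imageI[OF R] r', of d']
      m[OF subset_refl] unfolding S by simp
qed

lemma connected_poly_cong:
  assumes "finite S" "S \<noteq> {}" "\<And>i. i \<in> S \<Longrightarrow> d i = d' i"
  shows "connected_poly S d = connected_poly S d'"
  using connected_poly_relabel[of S "\<lambda>i. i" d d'] assms by simp

text \<open>
  Disjoint pairs \<open>(I, K)\<close> of subsets are listed by \<open>I\<close> first, or by their union \<open>J\<close> first.
\<close>

lemma sum_Pow_Pow:
  assumes "finite R"
  shows "(\<Sum>J\<in>Pow R. \<Sum>K\<in>Pow (R - J). f J K) = (\<Sum>J\<in>Pow R. \<Sum>I\<in>Pow J. f I (J - I))"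
proof -
  have fin: "finite J" if "J \<subseteq> R" for J using that assms by (rule finite_subset)
  have "(\<Sum>(J, K)\<in>Sigma (Pow R) (\<lambda>J. Pow (R - J)). f J K) = (\<Sum>(J, I)\<in>Sigma (Pow R) Pow. f I (J - I))"
    by (rule sum.reindex_bij_witness[where i = "\<lambda>(J, I). (I, J - I)" and j = "\<lambda>(J, K). (J \<union> K, J)"])
       (auto intro!: arg_cong[of _ _ "f _"])
  then show ?thesis using assms fin by (subst (1 2) sum.Sigma) auto
qed

lemma sum_Pow_remove:
  assumes "finite R"
  shows "(\<Sum>i\<in>R. \<Sum>J\<in>Pow (R - {i}). f i J) = (\<Sum>J\<in>Pow R. \<Sum>i\<in>J. f i (J - {i}))"
proof -
  have fin: "finite J" if "J \<subseteq> R" for J using that assms by (rule finite_subset)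
  have "(\<Sum>(i, J)\<in>Sigma R (\<lambda>i. Pow (R - {i})). f i J) = (\<Sum>(J, i)\<in>Sigma (Pow R) (\<lambda>J. J). f i (J - {i}))"
    by (rule sum.reindex_bij_witness[where i = "\<lambda>(J, i). (i, J - {i})" and j = "\<lambda>(i, J). (insert i J, i)"])
       (auto simp: insert_absorb intro!: arg_cong[of _ _ "f _"])
  then show ?thesis using assms fin by (subst (1 2) sum.Sigma) auto
qed

lemma sum_Pow_insert:
  assumes "finite R" "s \<notin> R"
  shows "(\<Sum>J\<in>Pow (insert s R). f J) = (\<Sum>J\<in>Pow R. f (insert s J)) + (\<Sum>J\<in>Pow R. f J)"
proof -
  have "inj_on (insert s) (Pow R)" using assms by (auto simp: inj_on_def insert_eq_iff)
  moreover have "Pow R \<inter> insert s ` Pow R = {}" using assms by auto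
  ultimately show ?thesis using assms unfolding Pow_insert
    by (subst sum.union_disjoint) (auto simp: sum.reindex add.commute)
qed

text \<open>
  Let \<open>X J\<close> be the right-hand side for the vertex set \<open>insert r J\<close>. If the root edge is removed from an
  arbitrary gluing and the result is decomposed into components, then the component of \<open>r\<close> either contains
  \<open>s\<close>, or it does not and the component of \<open>s\<close> is split off as well. Collecting the terms by the union of
  these components gives \<open>\<Sum>J. X J * maps_poly (R - J) d\<close>. The connected polynomials satisfy the same
  triangular relation, so \<open>X R\<close> is the connected polynomial by induction on \<open>R\<close>.
\<close>

theorem connected_poly_root_edge:
  assumes R: "finite R" and r: "r \<notin> R" and s: "s \<notin> insert r R" and k: "d r = Suc k"
  shows "connected_poly (insert r R) d =
    (\<Sum>a<k. connected_poly (insert s (insert r R)) (d(r := k - 1 - a, s := a))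
       + (\<Sum>I\<in>Pow R. connected_poly (insert r I) (d(r := k - 1 - a)) *
           connected_poly (insert s (R - I)) (d(s := a))))
    + (\<Sum>i\<in>R. of_nat (d i) * connected_poly (insert r (R - {i})) (d(r := k + d i - 1)))"
proof -
  define X where "X J =
    (\<Sum>a<k. connected_poly (insert s (insert r J)) (d(r := k - 1 - a, s := a))
       + (\<Sum>I\<in>Pow J. connected_poly (insert r I) (d(r := k - 1 - a)) *
           connected_poly (insert s (J - I)) (d(s := a))))
    + (\<Sum>i\<in>J. of_nat (d i) * connected_poly (insert r (J - {i})) (d(r := k + d i - 1)))" for J
  \<comment> \<open>Generalized over \<open>R\<close>, because the induction applies it to subsets.\<close>
  have main: "maps_poly (insert r R) d = (\<Sum>J\<in>Pow R. X J * maps_poly (R - J) d)"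
    if R: "finite R" and r: "r \<notin> R" and s: "s \<notin> insert r R" for R
  proof -
    have mc: "maps_poly J (d(r := x)) = maps_poly J d" if "J \<subseteq> R" for J x
      using that r finite_subset[OF that R] by (intro maps_poly_cong) auto
    have mc2: "maps_poly J (d(r := x, s := y)) = maps_poly J d" if "J \<subseteq> R" for J x y
      using that r s finite_subset[OF that R] by (intro maps_poly_cong) auto
    have 1: "maps_poly (insert s (insert r R)) (d(r := x, s := y)) =
       (\<Sum>J\<in>Pow R. (connected_poly (insert s (insert r J)) (d(r := x, s := y))
       + (\<Sum>I\<in>Pow J. connected_poly (insert r I) (d(r := x)) *
           connected_poly (insert s (J - I)) (d(s := y)))) * maps_poly (R - J) d)" for x y
    proof -
      let ?d = "d(r := x, s := y)"
      have "maps_poly (insert s (insert r R)) ?d = maps_poly (insert r (insert s R)) ?d"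
        by (simp add: insert_commute)
      also have "\<dots> = (\<Sum>J\<in>Pow (insert s R). connected_poly (insert r J) ?d * maps_poly (insert s R - J) ?d)"
        using R r s by (intro maps_poly_components') auto
      also have "\<dots> = (\<Sum>J\<in>Pow R. connected_poly (insert r (insert s J)) ?d
          * maps_poly (insert s R - insert s J) ?d)
          + (\<Sum>J\<in>Pow R. connected_poly (insert r J) ?d * maps_poly (insert s R - J) ?d)"
        using R s by (intro sum_Pow_insert) auto
      also have "(\<Sum>J\<in>Pow R. connected_poly (insert r (insert s J)) ?d
          * maps_poly (insert s R - insert s J) ?d)
          = (\<Sum>J\<in>Pow R. connected_poly (insert s (insert r J)) ?d * maps_poly (R - J) d)"
      proof (rule sum.cong[OF refl])
        fix J assume "J \<in> Pow R"
        have "insert s R - insert s J = R - J" using s by auto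
        then show "connected_poly (insert r (insert s J)) ?d * maps_poly (insert s R - insert s J) ?d
          = connected_poly (insert s (insert r J)) ?d * maps_poly (R - J) d"
          using mc2[of "R - J" x y] by (simp add: insert_commute)
      qed
      also have "(\<Sum>J\<in>Pow R. connected_poly (insert r J) ?d * maps_poly (insert s R - J) ?d)
          = (\<Sum>J\<in>Pow R. \<Sum>K\<in>Pow (R - J). connected_poly (insert r J) (d(r := x)) *
               connected_poly (insert s K) (d(s := y)) * maps_poly (R - J - K) d)"
      proof (rule sum.cong[OF refl])
        fix J assume J: "J \<in> Pow R"
        have fJ: "finite J" using J R by (auto intro: finite_subset)
        have "insert s R - J = insert s (R - J)" using J s by auto
        then have "maps_poly (insert s R - J) ?d
            = (\<Sum>K\<in>Pow (R - J). connected_poly (insert s K) ?d * maps_poly (R - J - K) ?d)"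
          using maps_poly_components'[of "R - J" s ?d] R s by simp
        also have "\<dots> = (\<Sum>K\<in>Pow (R - J). connected_poly (insert s K) (d(s := y)) * maps_poly (R - J - K) d)"
        proof (rule sum.cong[OF refl])
          fix K assume K: "K \<in> Pow (R - J)"
          then have "finite K" using R by (auto intro: finite_subset)
          then have "connected_poly (insert s K) ?d = connected_poly (insert s K) (d(s := y))"
            using K r s by (intro connected_poly_cong) auto
          then show "connected_poly (insert s K) ?d * maps_poly (R - J - K) ?d =
              connected_poly (insert s K) (d(s := y)) * maps_poly (R - J - K) d"
            using mc2[of "R - J - K" x y] by auto
        qed
        moreover have "connected_poly (insert r J) ?d = connected_poly (insert r J) (d(r := x))"
          using fJ J s by (intro connected_poly_cong) auto
        ultimately show "connected_poly (insert r J) ?d * maps_poly (insert s R - J) ?d =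
          (\<Sum>K\<in>Pow (R - J). connected_poly (insert r J) (d(r := x)) *
               connected_poly (insert s K) (d(s := y)) * maps_poly (R - J - K) d)"
          by (simp add: sum_distrib_left mult.assoc)
      qed
      also have "\<dots> = (\<Sum>J\<in>Pow R. \<Sum>I\<in>Pow J. connected_poly (insert r I) (d(r := x)) *
           connected_poly (insert s (J - I)) (d(s := y)) * maps_poly (R - I - (J - I)) d)"
        by (rule sum_Pow_Pow[OF R])
      also have "\<dots> = (\<Sum>J\<in>Pow R. \<Sum>I\<in>Pow J. connected_poly (insert r I) (d(r := x)) *
           connected_poly (insert s (J - I)) (d(s := y)) * maps_poly (R - J) d)"
      proof (intro sum.cong refl)
        fix J I assume "J \<in> Pow R" "I \<in> Pow J"
        then have "R - I - (J - I) = R - J" by auto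
        then show "connected_poly (insert r I) (d(r := x)) *
           connected_poly (insert s (J - I)) (d(s := y)) * maps_poly (R - I - (J - I)) d =
           connected_poly (insert r I) (d(r := x)) *
           connected_poly (insert s (J - I)) (d(s := y)) * maps_poly (R - J) d" by simp
      qed
      finally show ?thesis by (simp only: sum.distrib distrib_right sum_distrib_right)
    qed
    have 2: "(\<Sum>i\<in>R. of_nat (d i) * maps_poly (insert r R - {i}) (d(r := k + d i - 1))) =
       (\<Sum>J\<in>Pow R. (\<Sum>i\<in>J. of_nat (d i) * connected_poly (insert r (J - {i})) (d(r := k + d i - 1)))
           * maps_poly (R - J) d)"
    proof -
      have "(\<Sum>i\<in>R. of_nat (d i) * maps_poly (insert r R - {i}) (d(r := k + d i - 1))) =
        (\<Sum>i\<in>R. \<Sum>J\<in>Pow (R - {i}). of_nat (d i) * connected_poly (insert r J) (d(r := k + d i - 1))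
            * maps_poly (R - {i} - J) d)"
      proof (rule sum.cong[OF refl])
        fix i assume i: "i \<in> R"
        have "insert r R - {i} = insert r (R - {i})" using i r by auto
        then have "maps_poly (insert r R - {i}) (d(r := k + d i - 1)) =
          (\<Sum>J\<in>Pow (R - {i}). connected_poly (insert r J) (d(r := k + d i - 1))
              * maps_poly (R - {i} - J) (d(r := k + d i - 1)))"
          using maps_poly_components'[of "R - {i}" r "d(r := k + d i - 1)"] R r by simp
        also have "\<dots> = (\<Sum>J\<in>Pow (R - {i}). connected_poly (insert r J) (d(r := k + d i - 1))
            * maps_poly (R - {i} - J) d)"
          by (intro sum.cong refl arg_cong2[of _ _ _ _ "(*)"] mc) auto
        finally show "of_nat (d i) * maps_poly (insert r R - {i}) (d(r := k + d i - 1)) =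
          (\<Sum>J\<in>Pow (R - {i}). of_nat (d i) * connected_poly (insert r J) (d(r := k + d i - 1))
              * maps_poly (R - {i} - J) d)"
          by (simp add: sum_distrib_left mult.assoc)
      qed
      also have "\<dots> = (\<Sum>J\<in>Pow R. \<Sum>i\<in>J. of_nat (d i)
          * connected_poly (insert r (J - {i})) (d(r := k + d i - 1)) * maps_poly (R - {i} - (J - {i})) d)"
        by (rule sum_Pow_remove[OF R])
      also have "\<dots> = (\<Sum>J\<in>Pow R. \<Sum>i\<in>J. of_nat (d i)
          * connected_poly (insert r (J - {i})) (d(r := k + d i - 1)) * maps_poly (R - J) d)"
      proof (intro sum.cong refl)
        fix J i assume "J \<in> Pow R" "i \<in> J"
        then have "R - {i} - (J - {i}) = R - J" by auto
        then show "of_nat (d i) * connected_poly (insert r (J - {i})) (d(r := k + d i - 1))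
            * maps_poly (R - {i} - (J - {i})) d =
          of_nat (d i) * connected_poly (insert r (J - {i})) (d(r := k + d i - 1)) * maps_poly (R - J) d"
            by simp
      qed
      finally show ?thesis by (simp add: sum_distrib_right)
    qed
    have "maps_poly (insert r R) d =
      (\<Sum>a<k. maps_poly (insert s (insert r R)) (d(r := k - 1 - a, s := a))) +
      (\<Sum>i\<in>R. of_nat (d i) * maps_poly (insert r R - {i}) (d(r := k + d i - 1)))"
      using maps_poly_root_edge[of "insert r R" r d k s] R r s k by simp
    also have "\<dots> = (\<Sum>J\<in>Pow R. X J * maps_poly (R - J) d)"
      unfolding 1 2 X_def distrib_right sum.distrib sum_distrib_right
      by (simp add: sum.distrib sum.swap[of _ "{..<k}" "Pow R"])
    finally show ?thesis .
  qed
  have "connected_poly (insert r R) d = X R"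
    using R r s
  proof (induction "card R" arbitrary: R rule: less_induct)
    case less
    note R = less.prems
    have "(\<Sum>J\<in>Pow R - {R}. connected_poly (insert r J) d * maps_poly (R - J) d) =
      (\<Sum>J\<in>Pow R - {R}. X J * maps_poly (R - J) d)"
    proof (rule sum.cong[OF refl])
      fix J assume J: "J \<in> Pow R - {R}"
      then have "card J < card R" using R by (intro psubset_card_mono) auto
      then have "connected_poly (insert r J) d = X J"
        by (rule less.hyps) (use J R finite_subset[of J R] in auto)
      then show "connected_poly (insert r J) d * maps_poly (R - J) d = X J * maps_poly (R - J) d" by simp
    qed
    then show ?case
      using connected_poly_recursion[OF R(1,2), of d] main[OF R] R(1)
        sum.remove[of "Pow R" R "\<lambda>J. X J * maps_poly (R - J) d"] by (simp add: maps_poly_empty)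
  qed
  then show ?thesis by (simp only: X_def)
qed

lemma connected_poly_isolated: "d r = 0 \<Longrightarrow> connected_poly {r} d = monom 1 1"
proof -
  assume d: "d r = 0"
  then have "half_edges_of {r} d = {}" "{i\<in>{r}. d i = 0} = {r}" by (auto simp: half_edges_of_def)
  then have "maps_poly {r} d = monom 1 1" by (simp add: maps_poly_def face_poly_empty)
  then show ?thesis using maps_poly_components'[of "{}" r d] by (simp add: maps_poly_empty)
qed

lemma connected_poly_isolated_0:
  assumes "r \<in> S" "j \<in> S" "j \<noteq> r" "d r = 0"
  shows "connected_poly S d = 0"
proof -
  have "\<not> connects S d \<tau>" for \<tau>
  proof
    assume "connects S d \<tau>"
    then have "(r, j) \<in> (adjacency S d \<tau>)\<^sup>*" using assms by (auto simp: connects_def)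
    then obtain y where "(r, y) \<in> adjacency S d \<tau>" using assms(3) by (metis converse_rtranclE)
    then show False using assms(4) by (auto simp: adjacency_def half_edges_of_def)
  qed
  then show ?thesis by (simp add: connected_poly_def)
qed

section \<open>Grading by the genus\<close>

text \<open>
  The coefficient of \<open>X ^ (m / 2)\<close>, extended by zero to odd and to negative \<open>m\<close>. Euler's formula can then be
  used without subtraction or division of natural numbers, also for sums of degrees that are odd.
\<close>

definition half_coeff :: "real poly \<Rightarrow> int \<Rightarrow> real" where
  "half_coeff p m = (if 0 \<le> m \<and> even m then coeff p (nat (m div 2)) else 0)"

lemma half_coeff_double: "half_coeff p (2 * int n) = coeff p n"
  by (simp add: half_coeff_def)

lemma half_coeff_cases:
  obtains n where "m = 2 * int n" | "\<And>p. half_coeff p m = 0"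
proof (cases "0 \<le> m \<and> even m")
  case True
  then have "m = 2 * int (nat (m div 2))" by auto
  then show ?thesis using that by metis
qed (use that in \<open>auto simp: half_coeff_def\<close>)

lemma half_coeff_add: "half_coeff (p + q) m = half_coeff p m + half_coeff q m"
  by (simp add: half_coeff_def)

lemma half_coeff_sum: "half_coeff (\<Sum>x\<in>A. f x) m = (\<Sum>x\<in>A. half_coeff (f x) m)"
proof (cases "0 \<le> m \<and> even m")
  case True then show ?thesis by (simp add: half_coeff_def coeff_sum)
next
  case False
  then have "half_coeff p m = 0" for p unfolding half_coeff_def by (rule if_not_P)
  then show ?thesis by simp
qed

lemma half_coeff_of_nat_mult: "half_coeff (of_nat n * p) m = of_nat n * half_coeff p m"
  by (simp add: half_coeff_def of_nat_poly)

text \<open>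
  With \<open>A = 4 + (sum of the degrees) - 2 * (number of vertices)\<close>, the equation is twice Euler's formula for
  a map with \<open>F\<close> faces and genus \<open>g\<close>.
\<close>

definition genus_graded :: "real poly \<Rightarrow> int \<Rightarrow> bool" where
  "genus_graded p A \<longleftrightarrow> (\<forall>F. coeff p F \<noteq> 0 \<longrightarrow> (\<exists>g. 2 * int F = A - 4 * int g))"

lemma genus_graded_add: "genus_graded p A \<Longrightarrow> genus_graded q A \<Longrightarrow> genus_graded (p + q) A"
  unfolding genus_graded_def by (metis add.right_neutral coeff_add)

lemma genus_graded_sum:
  "(\<And>x. x \<in> I \<Longrightarrow> genus_graded (f x) A) \<Longrightarrow> genus_graded (\<Sum>x\<in>I. f x) A"
proof (induction I rule: infinite_finite_induct)
  case (insert x I)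
  then show ?case by (simp add: genus_graded_add)
qed (simp_all add: genus_graded_def)

lemma genus_graded_of_nat_mult: "genus_graded p A \<Longrightarrow> genus_graded (of_nat n * p) A"
  by (auto simp: genus_graded_def of_nat_poly)

lemma genus_graded_mono: "genus_graded p A \<Longrightarrow> genus_graded p (A + 4)"
  unfolding genus_graded_def
proof (intro allI impI)
  fix F assume *: "\<forall>F. coeff p F \<noteq> 0 \<longrightarrow> (\<exists>g. 2 * int F = A - 4 * int g)" "coeff p F \<noteq> 0"
  then obtain g where "2 * int F = A - 4 * int g" by blast
  then have "2 * int F = A + 4 - 4 * int (Suc g)" by simp
  then show "\<exists>g. 2 * int F = A + 4 - 4 * int g" by blast
qed

lemma genus_graded_mult:
  assumes "genus_graded p A" "genus_graded q B" shows "genus_graded (p * q) (A + B)"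
  unfolding genus_graded_def
proof (intro allI impI)
  fix F assume "coeff (p * q) F \<noteq> 0"
  then obtain i where i: "i \<le> F" "coeff p i \<noteq> 0" "coeff q (F - i) \<noteq> 0"
    unfolding coeff_mult by (metis (no_types, lifting) atMost_iff mult_eq_0_iff sum.neutral)
  then obtain g h where "2 * int i = A - 4 * int g" "2 * int (F - i) = B - 4 * int h"
    using assms unfolding genus_graded_def by blast
  then have "2 * int F = A + B - 4 * int (g + h)" using i(1) by (simp add: of_nat_diff)
  then show "\<exists>g. 2 * int F = A + B - 4 * int g" by blast
qed

text \<open>
  The Cauchy product runs over all exponents, but by gradedness only those contribute that belong to a natural
  number as genus; the genera of the two factors add up to \<open>g\<close>.
\<close>

lemma half_coeff_mult:
  assumes p: "genus_graded p A" and q: "genus_graded q B"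
  shows "half_coeff (p * q) (A + B - 4 * int g) =
    (\<Sum>h\<le>g. half_coeff p (A - 4 * int h) * half_coeff q (B - 4 * int (g - h)))"
proof (rule half_coeff_cases[of "A + B - 4 * int g"])
  fix F assume F: "A + B - 4 * int g = 2 * int F"
  let ?S' = "{i\<in>{..F}. coeff p i * coeff q (F - i) = 0}"
  let ?T' = "{h\<in>{..g}. half_coeff p (A - 4 * int h) * half_coeff q (B - 4 * int (g - h)) = 0}"
  have "(\<Sum>i\<in>{..F} - ?S'. coeff p i * coeff q (F - i)) =
    (\<Sum>h\<in>{..g} - ?T'. half_coeff p (A - 4 * int h) * half_coeff q (B - 4 * int (g - h)))"
  proof (rule sum.reindex_bij_witness[where
        j = "\<lambda>i. nat ((A - 2 * int i) div 4)" and i = "\<lambda>h. nat ((A - 4 * int h) div 2)"])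
    fix i assume "i \<in> {..F} - {i\<in>{..F}. coeff p i * coeff q (F - i) = 0}"
    then have i: "i \<le> F" "coeff p i \<noteq> 0" "coeff q (F - i) \<noteq> 0" by auto
    obtain h1 where h1: "2 * int i = A - 4 * int h1" using p i unfolding genus_graded_def by blast
    obtain h2 where h2: "2 * int (F - i) = B - 4 * int h2" using q i unfolding genus_graded_def by blast
    have j: "nat ((A - 2 * int i) div 4) = h1" using h1 by simp
    have "int g = int h1 + int h2" using h1 h2 F i(1) by (simp add: of_nat_diff)
    then have gg: "g = h1 + h2" by linarith
    have val: "half_coeff p (A - 4 * int h1) = coeff p i" "half_coeff q (B - 4 * int (g - h1))
        = coeff q (F - i)"
      using h1 h2 gg half_coeff_double[of p i] half_coeff_double[of q "F - i"] by auto
    show "nat ((A - 4 * int (nat ((A - 2 * int i) div 4))) div 2) = i" using h1 j by simp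
    show "nat ((A - 2 * int i) div 4) \<in> {..g}
        - {h\<in>{..g}. half_coeff p (A - 4 * int h) * half_coeff q (B - 4 * int (g - h)) = 0}"
      unfolding j using val i gg by simp
    show "half_coeff p (A - 4 * int (nat ((A - 2 * int i) div 4))) *
        half_coeff q (B - 4 * int (g - nat ((A - 2 * int i) div 4))) = coeff p i * coeff q (F - i)"
      unfolding j using val by simp
  next
    fix h assume "h \<in> {..g} - {h\<in>{..g}. half_coeff p (A - 4 * int h) * half_coeff q (B - 4 * int (g - h))
        = 0}"
    then have h: "h \<le> g" "half_coeff p (A - 4 * int h) \<noteq> 0" "half_coeff q (B - 4 * int (g - h)) \<noteq> 0" by auto
    obtain i where i: "A - 4 * int h = 2 * int i" using half_coeff_cases[of "A - 4 * int h"] h(2) by metis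
    obtain l where l: "B - 4 * int (g - h) = 2 * int l"
      using half_coeff_cases[of "B - 4 * int (g - h)"] h(3) by metis
    have "int F = int i + int l" using F i l h(1) by (simp add: of_nat_diff)
    then have Fl: "F = i + l" by linarith
    have ii: "nat ((A - 4 * int h) div 2) = i" using i by simp
    have "coeff p i \<noteq> 0" "coeff q l \<noteq> 0" using h i l by (simp_all add: half_coeff_double)
    then show "nat ((A - 4 * int h) div 2) \<in> {..F} - {i\<in>{..F}. coeff p i * coeff q (F - i) = 0}"
      unfolding ii using Fl by simp
    show "nat ((A - 2 * int (nat ((A - 4 * int h) div 2))) div 4) = h" unfolding ii using i by simp
  qed
  moreover have "(\<Sum>i\<in>{..F} - ?S'. coeff p i * coeff q (F - i)) = (\<Sum>i\<le>F. coeff p i * coeff q (F - i))"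
    by (rule sum.mono_neutral_left) auto
  moreover have "(\<Sum>h\<in>{..g} - ?T'. half_coeff p (A - 4 * int h) * half_coeff q (B - 4 * int (g - h))) =
      (\<Sum>h\<le>g. half_coeff p (A - 4 * int h) * half_coeff q (B - 4 * int (g - h)))"
    by (rule sum.mono_neutral_left) auto
  ultimately show ?thesis unfolding F half_coeff_double coeff_mult by simp
next
  assume 0: "\<And>p. half_coeff p (A + B - 4 * int g) = 0"
  have "half_coeff p (A - 4 * int h) * half_coeff q (B - 4 * int (g - h)) = 0" if h: "h \<le> g" for h
  proof (rule ccontr)
    assume "half_coeff p (A - 4 * int h) * half_coeff q (B - 4 * int (g - h)) \<noteq> 0"
    then have n: "half_coeff p (A - 4 * int h) \<noteq> 0" "half_coeff q (B - 4 * int (g - h)) \<noteq> 0" by auto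
    obtain i where i: "A - 4 * int h = 2 * int i" using half_coeff_cases[of "A - 4 * int h"] n(1) by metis
    obtain l where l: "B - 4 * int (g - h) = 2 * int l"
      using half_coeff_cases[of "B - 4 * int (g - h)"] n(2) by metis
    have "A + B - 4 * int g = 2 * int (i + l)" using i l h by (simp add: of_nat_diff)
    then have "half_coeff (monom 1 (i + l)) (A + B - 4 * int g) = 1" by (simp only: half_coeff_double) simp
    then show False using 0 by simp
  qed
  then have "(\<Sum>h\<le>g. half_coeff p (A - 4 * int h) * half_coeff q (B - 4 * int (g - h))) = 0"
    by (intro sum.neutral) auto
  then show ?thesis using 0 by simp
qed

definition euler_weight :: "nat set \<Rightarrow> (nat \<Rightarrow> nat) \<Rightarrow> int" where
  "euler_weight S d = 4 + int (\<Sum>i\<in>S. d i) - 2 * int (card S)"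

text \<open>
  Cutting a loop without disconnecting the map lowers the Euler weight by 4, and hence the genus by 1. In the
  two lemmas that follow, the weights balance exactly: the genus is distributed over the two pieces, or kept
  when an edge is contracted.
\<close>

lemma euler_weight_split:
  assumes "finite R" "r \<notin> R" "s \<notin> insert r R" "d r = Suc k" "a < k"
  shows "euler_weight (insert s (insert r R)) (d(r := k - 1 - a, s := a)) = euler_weight (insert r R) d - 4"
proof -
  have "(\<Sum>i\<in>R. (d(r := k - 1 - a, s := a)) i) = (\<Sum>i\<in>R. d i)" using assms by (intro sum.cong) auto
  then show ?thesis using assms by (auto simp: euler_weight_def of_nat_diff)
qed

lemma euler_weight_cut:
  assumes "finite R" "r \<notin> R" "s \<notin> insert r R" "d r = Suc k" "a < k" "I \<subseteq> R"
  shows "euler_weight (insert r I) (d(r := k - 1 - a)) + euler_weight (insert s (R - I)) (d(s := a))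
    = euler_weight (insert r R) d"
proof -
  have fI: "finite I" using assms by (auto intro: finite_subset)
  have "(\<Sum>i\<in>I. (d(r := k - 1 - a)) i) = (\<Sum>i\<in>I. d i)" using assms by (intro sum.cong) auto
  moreover have "(\<Sum>i\<in>R - I. (d(s := a)) i) = (\<Sum>i\<in>R - I. d i)" using assms by (intro sum.cong) auto
  moreover have "(\<Sum>i\<in>R. d i) = (\<Sum>i\<in>R - I. d i) + (\<Sum>i\<in>I. d i)" using assms by (intro sum.subset_diff) auto
  moreover have "card R = card (R - I) + card I" using assms fI by (simp add: card_Diff_subset card_mono)
  moreover have "r \<notin> I" "s \<notin> R - I" using assms by auto
  ultimately show ?thesis using assms fI by (simp add: euler_weight_def of_nat_diff)
qed

lemma euler_weight_merge:
  assumes "finite R" "r \<notin> R" "d r = Suc k" "i \<in> R" "d i \<noteq> 0"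
  shows "euler_weight (insert r (R - {i})) (d(r := k + d i - 1)) = euler_weight (insert r R) d"
proof -
  have "(\<Sum>j\<in>R - {i}. (d(r := k + d i - 1)) j) = (\<Sum>j\<in>R - {i}. d j)" using assms by (intro sum.cong) auto
  moreover have "(\<Sum>j\<in>R. d j) = d i + (\<Sum>j\<in>R - {i}. d j)" using assms by (intro sum.remove) auto
  moreover have "card R = Suc (card (R - {i}))" by (rule card.remove) (use assms in auto)
  moreover have "int (k + d i - 1) = int k + int (d i) - 1" using assms(5) by simp
  ultimately show ?thesis using assms(1-3) by (simp add: euler_weight_def)
qed

text \<open>
  The genus of a connected map is a natural number. Every term of the recursion is graded by the weight of the
  original map, possibly lowered by 4, and the recursion ends with a single vertex of degree 0 (a map on
  the sphere with one face) or with several vertices of degree 0, which no gluing connects.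
\<close>

theorem connected_poly_genus_graded:
  assumes "finite S" "S \<noteq> {}"
  shows "genus_graded (connected_poly S d) (euler_weight S d)"
  using assms
proof (induction "\<Sum>i\<in>S. d i" arbitrary: S d rule: less_induct)
  case less
  note S = less.prems
  show ?case
  proof (cases "\<exists>r\<in>S. d r \<noteq> 0")
    case False
    obtain r where r: "r \<in> S" using S by auto
    show ?thesis
    proof (cases "S = {r}")
      case True
      have "d r = 0" using False r by auto
      then have "connected_poly S d = monom 1 1" "euler_weight S d = 2"
        using True by (simp_all add: connected_poly_isolated euler_weight_def)
      then show ?thesis by (auto simp: genus_graded_def)
    next
      case ne: False
      then obtain j where "j \<in> S" "j \<noteq> r" using r by auto
      then have "connected_poly S d = 0" using connected_poly_isolated_0[of r S j d] r False by auto
      then show ?thesis by (simp add: genus_graded_def)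
    qed
  next
    case True
    then obtain r k where r: "r \<in> S" "d r = Suc k" by (metis not0_implies_Suc)
    define R where "R = S - {r}"
    have SR: "S = insert r R" and rR: "r \<notin> R" and R: "finite R" using r S by (auto simp: R_def)
    obtain s where s: "s \<notin> insert r R" using R by (meson ex_new_if_finite finite_insert infinite_UNIV_nat)
    let ?A = "euler_weight S d"
    have small: "genus_graded (connected_poly T e) (euler_weight T e)"
      if "(\<Sum>i\<in>T. e i) < (\<Sum>i\<in>S. d i)" "finite T" "T \<noteq> {}" for T e
      using less.hyps[OF that] .
    have total: "(\<Sum>i\<in>S. d i) = Suc k + (\<Sum>i\<in>R. d i)" using R rR r by (simp add: SR)
    show ?thesis
      unfolding SR connected_poly_root_edge[of R r s d k, OF R rR s r(2)]
    proof (intro genus_graded_add genus_graded_sum)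
      fix a assume "a \<in> {..<k}" then have a: "a < k" by simp
      have "(\<Sum>i\<in>R. (d(r := k - 1 - a, s := a)) i) = (\<Sum>i\<in>R. d i)" using rR s by (intro sum.cong) auto
      then have "genus_graded (connected_poly (insert s (insert r R)) (d(r := k - 1 - a, s := a)))
         (euler_weight (insert s (insert r R)) (d(r := k - 1 - a, s := a)))"
        using a R rR s by (intro small) (auto simp: total)
      then show "genus_graded (connected_poly (insert s (insert r R)) (d(r := k - 1 - a, s := a)))
         (euler_weight (insert r R) d)"
        unfolding euler_weight_split[of R r s d k a, OF R rR s r(2) a] using genus_graded_mono by fastforce
    next
      fix a I assume "a \<in> {..<k}" "I \<in> Pow R" then have a: "a < k" and I: "I \<subseteq> R" by auto
      have fI: "finite I" using I R by (rule finite_subset)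
      have 1: "(\<Sum>i\<in>I. (d(r := k - 1 - a)) i) = (\<Sum>i\<in>I. d i)" using I rR by (intro sum.cong) auto
      have 2: "(\<Sum>i\<in>R - I. (d(s := a)) i) = (\<Sum>i\<in>R - I. d i)" using s by (intro sum.cong) auto
      have 3: "(\<Sum>i\<in>I. d i) \<le> (\<Sum>i\<in>R. d i)" "(\<Sum>i\<in>R - I. d i) \<le> (\<Sum>i\<in>R. d i)"
        using R I by (auto intro: sum_mono2)
      have "r \<notin> I" "s \<notin> R - I" using I rR s by auto
      then have "genus_graded (connected_poly (insert r I) (d(r := k - 1
          - a))) (euler_weight (insert r I) (d(r := k - 1 - a)))"
         "genus_graded (connected_poly (insert s (R - I)) (d(s := a)))
           (euler_weight (insert s (R - I)) (d(s := a)))"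
        using 1 2 3 a R fI total by (auto intro!: small)
      from genus_graded_mult[OF this]
      show "genus_graded (connected_poly (insert r I) (d(r := k - 1 - a))
          * connected_poly (insert s (R - I)) (d(s := a)))
         (euler_weight (insert r R) d)"
        unfolding euler_weight_cut[of R r s d k a I, OF R rR s r(2) a I] .
    next
      fix i assume i: "i \<in> R"
      show "genus_graded (of_nat (d i) * connected_poly (insert r (R - {i})) (d(r := k + d i
          - 1))) (euler_weight (insert r R) d)"
      proof (cases "d i = 0")
        case True then show ?thesis by (simp add: genus_graded_def)
      next
        case False
        have 1: "(\<Sum>j\<in>R - {i}. (d(r := k + d i - 1)) j) = (\<Sum>j\<in>R - {i}. d j)" using rR
          by (intro sum.cong) auto
        have 2: "(\<Sum>j\<in>R. d j) = d i + (\<Sum>j\<in>R - {i}. d j)" using R i by (intro sum.remove) auto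
        have "genus_graded (connected_poly (insert r (R - {i})) (d(r := k + d i - 1)))
           (euler_weight (insert r (R - {i})) (d(r := k + d i - 1)))"
          using False R rR 1 2 total by (intro small) auto
        then show ?thesis
          unfolding euler_weight_merge[of R r d k i, OF R rR r(2) i False]
            by (rule genus_graded_of_nat_mult)
      qed
    qed
  qed
qed

definition genus_count :: "nat \<Rightarrow> nat set \<Rightarrow> (nat \<Rightarrow> nat) \<Rightarrow> real" where
  "genus_count g S d = half_coeff (connected_poly S d) (euler_weight S d - 4 * int g)"

text \<open>
  In the first summand the genus drops by one, as the map stays connected when the loop is cut; for \<open>g = 0\<close>
  no such map exists, since its genus would be negative.
\<close>

theorem genus_count_root_edge:
  assumes R: "finite R" and r: "r \<notin> R" and s: "s \<notin> insert r R" and k: "d r = Suc k"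
  shows "genus_count g (insert r R) d =
    (\<Sum>a<k. (case g of 0 \<Rightarrow> 0 | Suc g' \<Rightarrow> genus_count g' (insert s (insert r R)) (d(r := k - 1 - a, s := a)))
       + (\<Sum>I\<in>Pow R. \<Sum>h\<le>g. genus_count h (insert r I) (d(r := k - 1 - a)) *
           genus_count (g - h) (insert s (R - I)) (d(s := a))))
    + (\<Sum>i\<in>R. of_nat (d i) * genus_count g (insert r (R - {i})) (d(r := k + d i - 1)))"
proof -
  let ?m = "euler_weight (insert r R) d - 4 * int g"
  have 1: "half_coeff (connected_poly (insert s (insert r R)) (d(r := k - 1 - a, s := a))) ?m =
     (case g of 0 \<Rightarrow> 0 | Suc g' \<Rightarrow> genus_count g' (insert s (insert r R)) (d(r := k - 1 - a, s := a)))"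
    if a: "a < k" for a
  proof -
    let ?S = "insert s (insert r R)" and ?d = "d(r := k - 1 - a, s := a)"
    note e = euler_weight_split[of R r s d k a, OF R r s k a]
    show ?thesis
    proof (cases g)
      case (Suc g')
      have "euler_weight (insert r R) d - 4 - 4 * int g' = euler_weight (insert r R) d - 4 * int (Suc g')"
        by simp
      then show ?thesis by (simp only: genus_count_def e Suc nat.case)
    next
      case 0
      have gr: "genus_graded (connected_poly ?S ?d) (euler_weight (insert r R) d - 4)"
        unfolding e[symmetric] using R by (intro connected_poly_genus_graded) auto
      have "half_coeff (connected_poly ?S ?d) (euler_weight (insert r R) d) = 0"
      proof (rule half_coeff_cases[of "euler_weight (insert r R) d"])
        fix F assume F: "euler_weight (insert r R) d = 2 * int F"
        have "coeff (connected_poly ?S ?d) F = 0"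
          using gr F unfolding genus_graded_def by (smt (verit) of_nat_0_le_iff)
        then show ?thesis unfolding F half_coeff_double .
      qed
      then show ?thesis using 0 by simp
    qed
  qed
  have 2: "half_coeff (connected_poly (insert r I) (d(r := k - 1 - a))
      * connected_poly (insert s (R - I)) (d(s := a))) ?m =
      (\<Sum>h\<le>g. genus_count h (insert r I) (d(r := k - 1 - a))
          * genus_count (g - h) (insert s (R - I)) (d(s := a)))"
    if a: "a < k" and I: "I \<subseteq> R" for a I
  proof -
    have fI: "finite I" using I R by (rule finite_subset)
    show ?thesis
      unfolding euler_weight_cut[of R r s d k a I, OF R r s k a I, symmetric] genus_count_def
      using R fI by (intro half_coeff_mult connected_poly_genus_graded) auto
  qed
  have 3: "of_nat (d i) * half_coeff (connected_poly (insert r (R - {i})) (d(r := k + d i - 1))) ?m =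
     of_nat (d i) * genus_count g (insert r (R - {i})) (d(r := k + d i - 1))" if i: "i \<in> R" for i
    using euler_weight_merge[of R r d k i, OF R r k i] by (cases "d i = 0") (simp_all add: genus_count_def)
  have "genus_count g (insert r R) d = half_coeff (connected_poly (insert r R) d) ?m"
    by (simp add: genus_count_def)
  also have "\<dots> = (\<Sum>a<k. (case g of 0 \<Rightarrow> 0 | Suc g' \<Rightarrow> genus_count g' (insert s (insert r R)) (d(r := k - 1
      - a, s := a)))
       + (\<Sum>I\<in>Pow R. \<Sum>h\<le>g. genus_count h (insert r I) (d(r := k - 1 - a)) *
           genus_count (g - h) (insert s (R - I)) (d(s := a))))
    + (\<Sum>i\<in>R. of_nat (d i) * genus_count g (insert r (R - {i})) (d(r := k + d i - 1)))"
    unfolding connected_poly_root_edge[of R r s d k, OF R r s k] half_coeff_add half_coeff_sum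
        half_coeff_of_nat_mult
    using 1 2 3 by (intro arg_cong2[of _ _ _ _ "(+)"] sum.cong refl) auto
  finally show ?thesis .
qed

section \<open>Marked vertices and exponential generating functions\<close>

text \<open>
  The vertex set \<open>{0..<size M}\<close> with sorted degrees is a representative; by
  \<open>genus_count_eq_degree_count\<close> every vertex set with the degrees \<open>M\<close> gives the same number.
\<close>

definition degree_count :: "nat \<Rightarrow> nat multiset \<Rightarrow> real" where
  "degree_count g M = genus_count g {0..<size M} (\<lambda>i. sorted_list_of_multiset M ! i)"

lemma genus_count_relabel:
  assumes "finite S" "S \<noteq> {}" "inj_on \<pi> S" "\<And>i. i \<in> S \<Longrightarrow> d i = d' (\<pi> i)"
  shows "genus_count g S d = genus_count g (\<pi> ` S) d'"
proof -
  have "euler_weight S d = euler_weight (\<pi> ` S) d'"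
    using assms by (simp add: euler_weight_def sum.reindex card_image)
  then show ?thesis using connected_poly_relabel[of S \<pi> d d', OF assms] by (simp add: genus_count_def)
qed

lemma genus_count_eq_degree_count:
  assumes S: "finite S" "S \<noteq> {}"
  shows "genus_count g S d = degree_count g (image_mset d (mset_set S))"
proof -
  define M where "M = image_mset d (mset_set S)"
  define xs where "xs = sorted_list_of_multiset M"
  let ?N = "{0..<card S}"
  have len: "length xs = card S" by (simp add: xs_def M_def flip: size_mset)
  obtain e where e: "bij_betw e ?N S" using ex_bij_betw_nat_finite[OF S(1)] by blast
  have "image_mset (\<lambda>i. d (e i)) (mset_set ?N) = image_mset d (image_mset e (mset_set ?N))"
    by (simp add: image_mset.compositionality comp_def)
  also have "image_mset e (mset_set ?N) = mset_set S"
    using e by (metis bij_betw_def image_mset_mset_set)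
  also have "image_mset d (mset_set S) = mset xs" by (simp add: xs_def M_def)
  also have "mset xs = image_mset ((!) xs) (mset_set ?N)"
    using len by (metis map_nth mset_map mset_upt)
  finally obtain p where p: "p permutes ?N" "\<forall>i\<in>?N. d (e i) = xs ! (p i)"
    by (rule image_mset_eq_implies_permutes[rotated]) auto
  have ne: "?N \<noteq> {}" using S by auto
  have "genus_count g ?N (\<lambda>i. d (e i)) = genus_count g (e ` ?N) d"
    using e ne by (intro genus_count_relabel) (auto simp: bij_betw_def)
  also have "e ` ?N = S" using e by (simp add: bij_betw_def)
  moreover have "genus_count g ?N (\<lambda>i. d (e i)) = genus_count g (p ` ?N) (\<lambda>i. xs ! i)"
    using p ne by (intro genus_count_relabel) (auto intro: permutes_inj_on)
  moreover have "p ` ?N = ?N" using p(1) by (rule permutes_image)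
  ultimately show ?thesis
    by (simp add: degree_count_def M_def[symmetric] xs_def[symmetric] flip: len) (simp add: M_def len)
qed

theorem degree_count_root_edge:
  fixes R :: "nat set"
  assumes R: "finite R"
  shows "degree_count g (add_mset (Suc k) (image_mset d (mset_set R))) =
    (\<Sum>a<k. (case g of 0 \<Rightarrow> 0
         | Suc g' \<Rightarrow> degree_count g' (add_mset (k - 1 - a) (add_mset a (image_mset d (mset_set R)))))
       + (\<Sum>I\<in>Pow R. \<Sum>h\<le>g. degree_count h (add_mset (k - 1 - a) (image_mset d (mset_set I))) *
           degree_count (g - h) (add_mset a (image_mset d (mset_set (R - I))))))
    + (\<Sum>i\<in>R. of_nat (d i) * degree_count g (add_mset (k + d i - 1) (image_mset d (mset_set (R - {i})))))"
proof -
  obtain r where r: "r \<notin> R" using R by (meson ex_new_if_finite infinite_UNIV_nat)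
  obtain s where s: "s \<notin> insert r R" using R by (meson ex_new_if_finite finite_insert infinite_UNIV_nat)
  define e where "e = d(r := Suc k)"
  have e: "e r = Suc k" by (simp add: e_def)
  have single: "genus_count h (insert q I) (e(q := x))
      = degree_count h (add_mset x (image_mset d (mset_set I)))"
    if "I \<subseteq> R" "q \<notin> R" for h q I x
  proof -
    have fI: "finite I" using that(1) R by (rule finite_subset)
    have "image_mset (e(q := x)) (mset_set I) = image_mset d (mset_set I)"
      using fI that r by (intro image_mset_cong) (auto simp: e_def)
    moreover have "q \<notin> I" using that by auto
    ultimately show ?thesis using genus_count_eq_degree_count[of "insert q I" h "e(q := x)"] fI by simp
  qed
  have double: "genus_count h (insert s (insert r R)) (e(r := x, s := y)) =
      degree_count h (add_mset x (add_mset y (image_mset d (mset_set R))))" for h x y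
  proof -
    have "image_mset (e(r := x, s := y)) (mset_set R) = image_mset d (mset_set R)"
      using R s r by (intro image_mset_cong) (auto simp: e_def)
    then show ?thesis
      using genus_count_eq_degree_count[of "insert s (insert r R)" h "e(r := x, s := y)"] R r s
      by (simp add: add_mset_commute)
  qed
  have sR: "s \<notin> R" and rR: "r \<notin> R" using s r by auto
  have er: "e(r := Suc k) = e" by (simp add: e_def)
  have ei: "e i = d i" if "i \<in> R" for i using that r by (auto simp: e_def)
  note rec = genus_count_root_edge[of R r s e k, OF R r s e, of g]
  have "degree_count g (add_mset (Suc k) (image_mset d (mset_set R))) = genus_count g (insert r R) e"
    using single[OF subset_refl rR, of g "Suc k"] er by simp
  also have "\<dots> = (\<Sum>a<k. (case g of 0 \<Rightarrow> 0
         | Suc g' \<Rightarrow> degree_count g' (add_mset (k - 1 - a) (add_mset a (image_mset d (mset_set R)))))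
       + (\<Sum>I\<in>Pow R. \<Sum>h\<le>g. degree_count h (add_mset (k - 1 - a) (image_mset d (mset_set I))) *
           degree_count (g - h) (add_mset a (image_mset d (mset_set (R - I))))))
    + (\<Sum>i\<in>R. of_nat (d i) * degree_count g (add_mset (k + d i - 1) (image_mset d (mset_set (R - {i})))))"
    unfolding rec double
  proof (intro arg_cong2[of _ _ _ _ "(+)"] sum.cong refl)
    fix a I h assume I: "I \<in> Pow R"
    show "genus_count h (insert r I) (e(r := k - 1 - a))
        * genus_count (g - h) (insert s (R - I)) (e(s := a)) =
      degree_count h (add_mset (k - 1 - a) (image_mset d (mset_set I))) *
           degree_count (g - h) (add_mset a (image_mset d (mset_set (R - I))))"
      using single[of I r] single[of "R - I" s] I rR sR by auto
  next
    fix i assume i: "i \<in> R"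
    show "of_nat (e i) * genus_count g (insert r (R - {i})) (e(r := k + e i - 1)) =
      of_nat (d i) * degree_count g (add_mset (k + d i - 1) (image_mset d (mset_set (R - {i}))))"
      using single[of "R - {i}" r] rR ei[OF i] by auto
  qed
  finally show ?thesis .
qed

lemma degree_count_isolated: "degree_count g {#0#} = (if g = 0 then 1 else 0)"
proof -
  have "degree_count g {#0#} = genus_count g {0} (\<lambda>_. 0)"
    using genus_count_eq_degree_count[of "{0}" g "\<lambda>_. 0"] by simp
  also have "\<dots> = half_coeff (monom 1 1) (2 - 4 * int g)"
    by (simp add: genus_count_def connected_poly_isolated euler_weight_def)
  also have "\<dots> = (if g = 0 then 1 else 0)" by (auto simp: half_coeff_def)
  finally show ?thesis .
qed

lemma degree_count_mset:
  fixes M :: "nat multiset"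
  obtains S :: "nat set" and d where "finite S" "M = image_mset d (mset_set S)"
proof -
  have "M = image_mset ((!) (sorted_list_of_multiset M)) (mset_set {0..<size M})"
    by (metis map_nth mset_map mset_upt mset_sorted_list_of_multiset size_mset)
  then show ?thesis using that by blast
qed

lemma degree_count_isolated_0:
  assumes "M \<noteq> {#}" shows "degree_count g (add_mset 0 M) = 0"
proof -
  obtain S :: "nat set" and d where S: "finite S" and M: "M = image_mset d (mset_set S)"
    by (rule degree_count_mset[of M])
  obtain r where r: "r \<notin> S" using S by (meson ex_new_if_finite infinite_UNIV_nat)
  obtain j where j: "j \<in> S" using assms M by (cases "S = {}") auto
  have "image_mset (d(r := 0)) (mset_set S) = image_mset d (mset_set S)"
    using S r by (intro image_mset_cong) auto
  then have "genus_count g (insert r S) (d(r := 0)) = degree_count g (add_mset 0 M)"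
    using genus_count_eq_degree_count[of "insert r S" g "d(r := 0)"] S r M by simp
  moreover have "connected_poly (insert r S) (d(r := 0)) = 0"
    by (rule connected_poly_isolated_0[of r _ j]) (use j r in auto)
  moreover have "half_coeff 0 m = 0" for m by (cases "0 \<le> m \<and> even m") (simp_all add: half_coeff_def)
  ultimately show ?thesis by (simp add: genus_count_def)
qed

lemma degree_count_odd:
  assumes "odd (\<Sum>\<^sub># M)" "M \<noteq> {#}" shows "degree_count g M = 0"
proof -
  obtain S :: "nat set" and d where S: "finite S" and M: "M = image_mset d (mset_set S)"
    by (rule degree_count_mset[of M])
  have "S \<noteq> {}" using assms M by auto
  then have "degree_count g M = genus_count g S d" using genus_count_eq_degree_count[OF S] M by simp
  moreover have "odd (euler_weight S d - 4 * int g)"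
  proof -
    have "(\<Sum>i\<in>S. d i) = \<Sum>\<^sub># M" by (simp add: M sum_unfold_sum_mset)
    then have "odd (int (\<Sum>i\<in>S. d i))" using assms(1) even_of_nat by metis
    then show ?thesis unfolding euler_weight_def
      by (simp only: even_add even_diff even_mult_iff even_numeral) simp
  qed
  ultimately show ?thesis by (simp add: genus_count_def half_coeff_def)
qed

text \<open>
  Besides \<open>j\<close> ordinary vertices of degree \<open>2 * \<nu>\<close> there is a marked vertex of arbitrary degree \<open>k\<close>, or two
  marked vertices of degrees \<open>k\<close> and \<open>l\<close> on the sphere.
\<close>

definition one_count :: "nat \<Rightarrow> nat \<Rightarrow> nat \<Rightarrow> nat \<Rightarrow> real" where
  "one_count \<nu> g k j = degree_count g (add_mset k (replicate_mset j (2 * \<nu>)))"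

definition two_count :: "nat \<Rightarrow> nat \<Rightarrow> nat \<Rightarrow> nat \<Rightarrow> real" where
  "two_count \<nu> k l j = degree_count 0 (add_mset k (add_mset l (replicate_mset j (2 * \<nu>))))"

definition egf :: "(nat \<Rightarrow> real) \<Rightarrow> real fps" where
  "egf f = Abs_fps (\<lambda>j. f j / fact j)"

lemma sum_Pow_card:
  fixes f :: "nat \<Rightarrow> real"
  assumes "finite A"
  shows "(\<Sum>I\<in>Pow A. f (card I)) = (\<Sum>i\<le>card A. of_nat (card A choose i) * f i)"
proof -
  have "(\<Sum>I\<in>Pow A. f (card I)) = (\<Sum>i\<in>{..card A}. \<Sum>I\<in>{I \<in> Pow A. card I = i}. f (card I))"
    using assms by (intro sum.group[symmetric]) (auto simp: card_mono)
  also have "\<dots> = (\<Sum>i\<in>{..card A}. of_nat (card A choose i) * f i)"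
    using n_subsets[OF assms] by (intro sum.cong) (auto simp: Pow_def)
  finally show ?thesis .
qed

text \<open>
  The product distributes the ordinary vertices over two components.
\<close>

lemma egf_mult:
  "(egf f * egf g) $ j = (\<Sum>I\<in>Pow {0..<j}. f (card I) * g (j - card I)) / fact j"
proof -
  have "(\<Sum>I\<in>Pow {0..<j}. f (card I) * g (j - card I)) = (\<Sum>i\<le>j. of_nat (j choose i) * (f i * g (j - i)))"
    using sum_Pow_card[of "{0..<j}" "\<lambda>i. f i * g (j - i)"] by simp
  also have "\<dots> / fact j = (\<Sum>i\<le>j. f i / fact i * (g (j - i) / fact (j - i)))"
    unfolding sum_divide_distrib by (intro sum.cong refl) (simp add: binomial_fact field_simps)
  finally show ?thesis by (simp add: egf_def fps_mult_nth atLeast0AtMost)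
qed

lemma egf_shift: "(fps_X * egf f) $ j = of_nat j * f (j - 1) / fact j"
  by (cases j) (simp_all add: egf_def fact_Suc del: of_nat_Suc)

lemma egf_cshift: "(fps_const c * (fps_X * egf f)) $ j = c * (of_nat j * f (j - 1)) / fact j"
  by (simp only: fps_mult_left_const_nth egf_shift times_divide_eq_right)

lemma egf_nth: "egf f $ j = f j / fact j"
  by (simp add: egf_def)

lemma egf_cmult: "(fps_const c * egf f) $ j = c * f j / fact j"
  by (simp add: egf_def)

lemma sum_mset_set_const: "image_mset (\<lambda>_. c) (mset_set I) = replicate_mset (card I) c"
  by (simp add: image_mset_const_eq)

lemma sum_subsets_of_interval:
  "(\<Sum>I\<in>Pow {0..<j}. f (card I) (card ({0..<j} - I))) = (\<Sum>I\<in>Pow {0..<j}. f (card I) (j - card I))"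
  by (intro sum.cong refl) (auto simp: card_Diff_subset finite_subset[OF _ finite_atLeastLessThan])

lemma sum_interval_remove:
  fixes f :: "nat \<Rightarrow> real"
  shows "(\<Sum>i\<in>{0..<j}. c * f (card ({0..<j} - {i}))) = c * (of_nat j * f (j - 1))"
proof -
  have "(\<Sum>i\<in>{0..<j}. c * f (card ({0..<j} - {i}))) = (\<Sum>i\<in>{0..<j}. c * f (j - 1))"
    by (rule sum.cong) simp_all
  then show ?thesis by simp
qed

text \<open>
  On the sphere every loop separates, so only products remain; the last term contracts an edge to an ordinary
  vertex.
\<close>

theorem planar_one_count_recursion:
  "egf (one_count \<nu> 0 (Suc k)) = (\<Sum>a<k. egf (one_count \<nu> 0 (k - 1 - a)) * egf (one_count \<nu> 0 a))
     + fps_const (2 * real \<nu>) * (fps_X * egf (one_count \<nu> 0 (k + 2 * \<nu> - 1)))"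
proof (rule fps_ext)
  fix j
  have "one_count \<nu> 0 (Suc k) j =
    (\<Sum>a<k. \<Sum>I\<in>Pow {0..<j}. one_count \<nu> 0 (k - 1 - a) (card I) * one_count \<nu> 0 a (card ({0..<j} - I)))
    + (\<Sum>i\<in>{0..<j}. 2 * real \<nu> * one_count \<nu> 0 (k + 2 * \<nu> - 1) (card ({0..<j} - {i})))"
    using degree_count_root_edge[of "{0..<j}" 0 k "\<lambda>_. 2 * \<nu>"]
    by (simp only: one_count_def sum_mset_set_const finite_atLeastLessThan card_atLeastLessThan
         nat.case add_0_left atMost_0 diff_0_eq_0 diff_zero of_nat_mult of_nat_numeral) simp
  also have "\<dots> = (\<Sum>a<k. \<Sum>I\<in>Pow {0..<j}. one_count \<nu> 0 (k - 1 - a) (card I) * one_count \<nu> 0 a (j - card I))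
    + 2 * real \<nu> * (of_nat j * one_count \<nu> 0 (k + 2 * \<nu> - 1) (j - 1))"
    by (simp only: sum_interval_remove sum_subsets_of_interval[of "\<lambda>x y. one_count \<nu> 0 (k - 1 - _) x
        * one_count \<nu> 0 _ y"])
  finally show "egf (one_count \<nu> 0 (Suc k)) $ j
      = ((\<Sum>a<k. egf (one_count \<nu> 0 (k - 1 - a)) * egf (one_count \<nu> 0 a))
     + fps_const (2 * real \<nu>) * (fps_X * egf (one_count \<nu> 0 (k + 2 * \<nu> - 1)))) $ j"
    unfolding fps_add_nth fps_sum_nth egf_mult egf_cshift egf_cmult egf_nth
    by (simp add: add_divide_distrib sum_divide_distrib sum.distrib)
qed

text \<open>
  A loop that does not separate the torus is cut open, which leaves a sphere with two marked vertices; a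
  separating loop leaves the handle on one of its two sides.
\<close>

theorem torus_one_count_recursion:
  "egf (one_count \<nu> 1 (Suc k)) = (\<Sum>a<k. egf (two_count \<nu> (k - 1 - a) a)
       + egf (one_count \<nu> 0 (k - 1 - a)) * egf (one_count \<nu> 1 a)
       + egf (one_count \<nu> 1 (k - 1 - a)) * egf (one_count \<nu> 0 a))
     + fps_const (2 * real \<nu>) * (fps_X * egf (one_count \<nu> 1 (k + 2 * \<nu> - 1)))"
proof (rule fps_ext)
  fix j
  have at1: "{..1::nat} = {0, 1}" by auto
  have "one_count \<nu> 1 (Suc k) j =
    (\<Sum>a<k. two_count \<nu> (k - 1 - a) a j
     + ((\<Sum>I\<in>Pow {0..<j}. one_count \<nu> 0 (k - 1 - a) (card I) * one_count \<nu> 1 a (card ({0..<j} - I)))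
     + (\<Sum>I\<in>Pow {0..<j}. one_count \<nu> 1 (k - 1 - a) (card I) * one_count \<nu> 0 a (card ({0..<j} - I)))))
    + (\<Sum>i\<in>{0..<j}. 2 * real \<nu> * one_count \<nu> 1 (k + 2 * \<nu> - 1) (card ({0..<j} - {i})))"
    using degree_count_root_edge[of "{0..<j}" 1 k "\<lambda>_. 2 * \<nu>"]
    by (simp only: one_count_def two_count_def sum_mset_set_const finite_atLeastLessThan
        card_atLeastLessThan
         One_nat_def nat.case at1[unfolded One_nat_def] of_nat_mult of_nat_numeral) (simp add: sum.distrib)
  also have "\<dots> = (\<Sum>a<k. two_count \<nu> (k - 1 - a) a j
     + ((\<Sum>I\<in>Pow {0..<j}. one_count \<nu> 0 (k - 1 - a) (card I) * one_count \<nu> 1 a (j - card I))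
     + (\<Sum>I\<in>Pow {0..<j}. one_count \<nu> 1 (k - 1 - a) (card I) * one_count \<nu> 0 a (j - card I))))
    + 2 * real \<nu> * (of_nat j * one_count \<nu> 1 (k + 2 * \<nu> - 1) (j - 1))"
    by (simp only: sum_interval_remove sum_subsets_of_interval[of "\<lambda>x y. one_count \<nu> _ (k - 1 - _) x
        * one_count \<nu> _ _ y"])
  finally show "egf (one_count \<nu> 1 (Suc k)) $ j = ((\<Sum>a<k. egf (two_count \<nu> (k - 1 - a) a)
       + egf (one_count \<nu> 0 (k - 1 - a)) * egf (one_count \<nu> 1 a)
       + egf (one_count \<nu> 1 (k - 1 - a)) * egf (one_count \<nu> 0 a))
     + fps_const (2 * real \<nu>) * (fps_X * egf (one_count \<nu> 1 (k + 2 * \<nu> - 1)))) $ j"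
    unfolding fps_add_nth fps_sum_nth egf_mult egf_cshift egf_cmult egf_nth
    by (simp add: add_divide_distrib sum_divide_distrib sum.distrib)
qed

text \<open>
  The second marked vertex lies on one of the two sides of a loop at the first one, or is joined to it by the
  root edge in one of \<open>l\<close> ways.
\<close>

theorem planar_two_count_recursion:
  "egf (two_count \<nu> (Suc k) l) = (\<Sum>a<k. egf (two_count \<nu> (k - 1 - a) l) * egf (one_count \<nu> 0 a)
       + egf (one_count \<nu> 0 (k - 1 - a)) * egf (two_count \<nu> a l))
     + fps_const (real l) * egf (one_count \<nu> 0 (k + l - 1))
     + fps_const (2 * real \<nu>) * (fps_X * egf (two_count \<nu> (k + 2 * \<nu> - 1) l))"
proof (rule fps_ext)
  fix j
  define d where "d = (\<lambda>_::nat. 2 * \<nu>)(j := l)"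
  have dJ: "image_mset d (mset_set J) = replicate_mset (card J) (2 * \<nu>)" if "J \<subseteq> {0..<j}" for J
  proof -
    have "image_mset d (mset_set J) = image_mset (\<lambda>_. 2 * \<nu>) (mset_set J)"
      using that by (intro image_mset_cong) (auto simp: d_def finite_subset)
    then show ?thesis by (simp add: sum_mset_set_const)
  qed
  have dJj: "image_mset d (mset_set (insert j J)) = add_mset l (replicate_mset (card J) (2 * \<nu>))"
    if "J \<subseteq> {0..<j}" for J
  proof -
    have "finite J" using that by (rule finite_subset) simp
    moreover have "j \<notin> J" using that by auto
    ultimately show ?thesis using dJ[OF that] by (simp add: d_def)
  qed
  have 1: "two_count \<nu> (Suc k) l j
      = degree_count 0 (add_mset (Suc k) (image_mset d (mset_set (insert j {0..<j}))))"
    by (simp only: dJj[OF subset_refl] two_count_def card_atLeastLessThan diff_zero)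
  have 2: "(\<Sum>I\<in>Pow (insert j {0..<j}). degree_count 0 (add_mset (k - 1 - a) (image_mset d (mset_set I))) *
           degree_count 0 (add_mset a (image_mset d (mset_set (insert j {0..<j} - I))))) =
      (\<Sum>I\<in>Pow {0..<j}. two_count \<nu> (k - 1 - a) l (card I) * one_count \<nu> 0 a (j - card I))
      + (\<Sum>I\<in>Pow {0..<j}. one_count \<nu> 0 (k - 1 - a) (card I) * two_count \<nu> a l (j - card I))" for a
  proof -
    have card: "card ({0..<j} - I) = j - card I" if "I \<subseteq> {0..<j}" for I
      using card_Diff_subset[of I "{0..<j}"] that finite_subset[OF that] by simp
    have "insert j {0..<j} - insert j I = {0..<j} - I" "insert j {0..<j} - I = insert j ({0..<j} - I)"
      if "I \<subseteq> {0..<j}" for I using that by auto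
    then show ?thesis
      by (subst sum_Pow_insert)
         (auto intro!: arg_cong2[of _ _ _ _ "(+)"] sum.cong simp: dJ dJj card one_count_def two_count_def
             simp del: mset_set.insert)
  qed
  have 3: "(\<Sum>i\<in>insert j {0..<j}. of_nat (d i)
      * degree_count 0 (add_mset (k + d i - 1) (image_mset d (mset_set (insert j {0..<j} - {i}))))) =
      real l * one_count \<nu> 0 (k + l - 1) j + 2 * real \<nu>
          * (of_nat j * two_count \<nu> (k + 2 * \<nu> - 1) l (j - 1))"
  proof -
    have "(\<Sum>i\<in>{0..<j}. of_nat (d i) * degree_count 0 (add_mset (k + d i
        - 1) (image_mset d (mset_set (insert j {0..<j} - {i})))))
      = (\<Sum>i\<in>{0..<j}. 2 * real \<nu> * two_count \<nu> (k + 2 * \<nu> - 1) l (card ({0..<j} - {i})))"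
    proof (rule sum.cong[OF refl])
      fix i assume i: "i \<in> {0..<j}"
      have "insert j {0..<j} - {i} = insert j ({0..<j} - {i})" using i by auto
      moreover have "d i = 2 * \<nu>" using i by (simp add: d_def)
      ultimately show "of_nat (d i) * degree_count 0 (add_mset (k + d i
          - 1) (image_mset d (mset_set (insert j {0..<j} - {i})))) =
        2 * real \<nu> * two_count \<nu> (k + 2 * \<nu> - 1) l (card ({0..<j} - {i}))"
        using dJj[of "{0..<j} - {i}"] by (simp only: two_count_def) auto
    qed
    moreover have "insert j {0..<j} - {j} = {0..<j}" "d j = l" by (auto simp: d_def)
    ultimately show ?thesis using dJ[OF subset_refl]
      by (simp only: sum.insert[OF finite_atLeastLessThan, of j] sum_interval_remove atLeastLessThan_iff
          one_count_def card_atLeastLessThan diff_zero) simp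
  qed
  have "two_count \<nu> (Suc k) l j
      = (\<Sum>a<k. (\<Sum>I\<in>Pow {0..<j}. two_count \<nu> (k - 1 - a) l (card I) * one_count \<nu> 0 a (j - card I))
      + (\<Sum>I\<in>Pow {0..<j}. one_count \<nu> 0 (k - 1 - a) (card I) * two_count \<nu> a l (j - card I)))
      + (real l * one_count \<nu> 0 (k + l - 1) j + 2 * real \<nu>
          * (of_nat j * two_count \<nu> (k + 2 * \<nu> - 1) l (j - 1)))"
    unfolding 1 degree_count_root_edge[of "insert j {0..<j}" 0 k d, OF finite.insertI[OF
        finite_atLeastLessThan]]
    by (simp only: nat.case add_0_left atMost_0 diff_zero sum.insert[OF finite.emptyI] empty_iff
        not_False_eq_True
        sum.empty add_0_right 2 3)
  then show "egf (two_count \<nu> (Suc k) l) $ j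
      = ((\<Sum>a<k. egf (two_count \<nu> (k - 1 - a) l) * egf (one_count \<nu> 0 a)
       + egf (one_count \<nu> 0 (k - 1 - a)) * egf (two_count \<nu> a l))
     + fps_const (real l) * egf (one_count \<nu> 0 (k + l - 1))
     + fps_const (2 * real \<nu>) * (fps_X * egf (two_count \<nu> (k + 2 * \<nu> - 1) l))) $ j"
    unfolding fps_add_nth fps_sum_nth egf_mult egf_cshift egf_cmult egf_nth
    by (simp add: add_divide_distrib sum_divide_distrib sum.distrib)
qed

lemma one_count_0: "egf (one_count \<nu> g 0) = (if g = 0 then 1 else 0)"
  by (rule fps_ext) (simp add: egf_def one_count_def degree_count_isolated degree_count_isolated_0
      replicate_mset_eq_empty_iff split: nat.split)

lemma two_count_0: "egf (two_count \<nu> 0 l) = 0" "egf (two_count \<nu> k 0) = 0"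
  by (rule fps_ext; simp add: egf_def two_count_def degree_count_isolated_0 add_mset_commute[of k 0])+

lemma one_count_odd: "odd k \<Longrightarrow> egf (one_count \<nu> g k) = 0"
  by (rule fps_ext) (simp add: egf_def one_count_def degree_count_odd)

lemma two_count_odd: "odd (k + l) \<Longrightarrow> egf (two_count \<nu> k l) = 0"
  by (rule fps_ext) (simp add: egf_def two_count_def degree_count_odd)

section \<open>Labeled maps as connected gluings\<close>

lemma perm_group_inv:
  assumes p: "p permutes H"
  shows "inv\<^bsub>perm_group H\<^esub> p = Hilbert_Choice.inv p"
proof -
  have 1: "Hilbert_Choice.inv p permutes H" using p by (rule permutes_inv)
  have 2: "p \<circ> Hilbert_Choice.inv p = id" "Hilbert_Choice.inv p \<circ> p = id"
    using permutes_inv_o[OF p] by auto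
  show ?thesis
    unfolding m_inv_def perm_group_def
  proof (rule the_equality)
    show "Hilbert_Choice.inv p \<in> carrier \<lparr>carrier = {p. p permutes H}, mult = (\<circ>), one = id\<rparr> \<and>
      p \<otimes>\<^bsub>\<lparr>carrier = {p. p permutes H}, mult = (\<circ>), one = id\<rparr>\<^esub> Hilbert_Choice.inv p = \<one>\<^bsub>\<lparr>carrier
          = {p. p permutes H}, mult = (\<circ>), one = id\<rparr>\<^esub> \<and>
      Hilbert_Choice.inv p \<otimes>\<^bsub>\<lparr>carrier = {p. p permutes H}, mult = (\<circ>), one = id\<rparr>\<^esub> p = \<one>\<^bsub>\<lparr>carrier
          = {p. p permutes H}, mult = (\<circ>), one = id\<rparr>\<^esub>"
      using 1 2 by simp
  next
    fix y assume "y \<in> carrier \<lparr>carrier = {p. p permutes H}, mult = (\<circ>), one = id\<rparr> \<and>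
      p \<otimes>\<^bsub>\<lparr>carrier = {p. p permutes H}, mult = (\<circ>), one = id\<rparr>\<^esub> y = \<one>\<^bsub>\<lparr>carrier = {p. p permutes H}, mult
          = (\<circ>), one = id\<rparr>\<^esub> \<and>
      y \<otimes>\<^bsub>\<lparr>carrier = {p. p permutes H}, mult = (\<circ>), one = id\<rparr>\<^esub> p = \<one>\<^bsub>\<lparr>carrier = {p. p permutes H}, mult
          = (\<circ>), one = id\<rparr>\<^esub>"
    then have "p \<circ> y = id" "y \<circ> p = id" by simp_all
    then show "y = Hilbert_Choice.inv p" by (metis inv_unique_comp)
  qed
qed

text \<open>
  The rotation moves freely within a vertex, so the orbits of the group are the unions of the vertices in a
  component. Inverses of the generators are handled explicitly because \<open>generate\<close> contains them.
\<close>

lemma generates_transitively_iff_connects: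
  assumes t: "\<tau> \<in> gluings (half_edges_of S d)" and S: "finite S" and d: "\<And>i. i \<in> S \<Longrightarrow> d i > 0"
  shows "generates_transitively_on (half_edges_of S d) {rotation_of S d, \<tau>} \<longleftrightarrow> connects S d \<tau>"
proof
  let ?H = "half_edges_of S d" and ?\<sigma> = "rotation_of S d" and ?A = "adjacency S d \<tau>"
  let ?G = "perm_group ?H"
  note T = gluingsD[OF t]
  have \<sigma>p: "?\<sigma> permutes ?H" using S by (rule rotation_of_permutes)
  {
    assume tr: "generates_transitively_on ?H {?\<sigma>, \<tau>}"
    have gen: "p permutes ?H \<and> (\<forall>h\<in>?H. (fst h, fst (p h)) \<in> ?A\<^sup>*)" if "p \<in> generate ?G {?\<sigma>, \<tau>}" for p
      using that
    proof induction
      case one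
      show ?case using permutes_id[of ?H] by (simp add: perm_group_def id_def)
    next
      case (incl p)
      then show ?case
      proof (elim insertE emptyE)
        assume p: "p = ?\<sigma>"
        have "fst (?\<sigma> h) = fst h" for h by (simp add: rotation_of_def)
        then show ?thesis using \<sigma>p by (simp add: p)
      next
        assume "p = \<tau>" then show ?thesis using T(1) by (auto simp: adjacency_def)
      qed
    next
      case (inv p)
      then show ?case
      proof (elim insertE emptyE)
        assume p: "p = ?\<sigma>"
        have fs: "fst (?\<sigma> h) = fst h" for h by (simp add: rotation_of_def)
        have "fst (Hilbert_Choice.inv ?\<sigma> h) = fst h" for h
          using fs[of "Hilbert_Choice.inv ?\<sigma> h"] permutes_inverses(1)[OF \<sigma>p, of h] by simp
        then show ?thesis using permutes_inv[OF \<sigma>p] by (simp add: p perm_group_inv[OF \<sigma>p])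
      next
        assume p: "p = \<tau>"
        have "Hilbert_Choice.inv \<tau> = \<tau>" by (rule inv_unique_comp) (simp_all add: fun_eq_iff T(3))
        then show ?thesis using T(1) by (auto simp: p perm_group_inv[OF T(1)] adjacency_def)
      qed
    next
      case (eng p q)
      then have pq: "p permutes ?H" "q permutes ?H" by auto
      have "p \<otimes>\<^bsub>?G\<^esub> q = p \<circ> q" by (simp add: perm_group_def)
      moreover have "(fst h, fst (p (q h))) \<in> ?A\<^sup>*" if h: "h \<in> ?H" for h
      proof -
        have "q h \<in> ?H" using h pq(2) by (simp add: permutes_in_image)
        then have "(fst (q h), fst (p (q h))) \<in> ?A\<^sup>*" using eng by blast
        moreover have "(fst h, fst (q h)) \<in> ?A\<^sup>*" using eng h by blast
        ultimately show ?thesis by (meson rtrancl_trans)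
      qed
      ultimately show ?case using permutes_compose[OF pq(2,1)] by (simp add: comp_def)
    qed
    show "connects S d \<tau>"
      unfolding connects_def
    proof (intro ballI)
      fix i j assume "i \<in> S" "j \<in> S"
      then have ij: "(i, 0) \<in> ?H" "(j, 0) \<in> ?H" using d by (auto simp: half_edges_of_def)
      then obtain p where p: "p \<in> generate ?G {?\<sigma>, \<tau>}" "p (i, 0) = (j, 0)"
        using tr unfolding generates_transitively_on_def by blast
      have "(fst (i, 0::nat), fst (p (i, 0))) \<in> ?A\<^sup>*" using gen[OF p(1)] ij(1) by blast
      then show "(i, j) \<in> ?A\<^sup>*" using p(2) by simp
    qed
  }
  {
    assume con: "connects S d \<tau>"
    define reach where "reach x y \<longleftrightarrow> (\<exists>p\<in>generate ?G {?\<sigma>, \<tau>}. p x = y)" for x y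
    have refl: "reach x x" for x
      unfolding reach_def
        by (rule bexI[of _ id]) (use generate.one[of ?G] in \<open>simp_all add: perm_group_def\<close>)
    have trans: "reach x z" if "reach x y" "reach y z" for x y z
    proof -
      from that obtain p q where "p \<in> generate ?G {?\<sigma>, \<tau>}" "q \<in> generate ?G {?\<sigma>, \<tau>}" "q (p x) = z"
        unfolding reach_def by blast
      then show ?thesis unfolding reach_def
        by (intro bexI[of _ "q \<otimes>\<^bsub>?G\<^esub> p"] generate.eng) (simp_all add: perm_group_def)
    qed
    have step\<sigma>: "reach x (?\<sigma> x)" and step\<tau>: "reach x (\<tau> x)" for x
      unfolding reach_def by (auto intro: generate.incl)
    have up: "reach (i, a) (i, (a + k) mod d i)" if "i \<in> S" "a < d i" for i a k
    proof (induction k)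
      case 0 then show ?case using that refl by simp
    next
      case (Suc k)
      have "(i, (a + k) mod d i) \<in> ?H" using that by (simp add: half_edges_of_def)
      then have "?\<sigma> (i, (a + k) mod d i) = (i, (a + Suc k) mod d i)"
        by (simp add: rotation_of_def mod_Suc_eq)
      then show ?case using trans[OF Suc step\<sigma>[of "(i, (a + k) mod d i)"]] by simp
    qed
    have same: "reach (i, a) (i, b)" if "i \<in> S" "a < d i" "b < d i" for i a b
    proof -
      have "(a + (d i - a + b)) mod d i = b" using that by (simp add: add.assoc[symmetric])
      then show ?thesis using up[OF that(1,2), of "d i - a + b"] by simp
    qed
    have path: "\<forall>a<d i. \<forall>b<d j. reach (i, a) (j, b)" if "(i, j) \<in> ?A\<^sup>*" "i \<in> S" for i j
      using that(1)
    proof induction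
      case base then show ?case using same that(2) by blast
    next
      case (step j k)
      obtain h where h: "h \<in> ?H" "j = fst h" "k = fst (\<tau> h)" using step(2) by (auto simp: adjacency_def)
      have h2: "snd h < d j" using h by (auto simp: half_edges_of_def)
      have t2: "\<tau> h \<in> ?H" using T(4)[OF h(1)] .
      then have k: "k \<in> S" "snd (\<tau> h) < d k" using h(3) by (auto simp: half_edges_of_def)
      show ?case
      proof (intro allI impI)
        fix a b assume a: "a < d i" and b: "b < d k"
        have "reach (i, a) h" using step(3) a h2 h(2) by (metis prod.collapse)
        moreover have "reach h (\<tau> h)" by (rule step\<tau>)
        moreover have "reach (\<tau> h) (k, b)" using same[OF k(1,2) b] h(3) by simp
        ultimately show "reach (i, a) (k, b)" using trans by blast
      qed
    qed
    show "generates_transitively_on ?H {?\<sigma>, \<tau>}"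
      unfolding generates_transitively_on_def reach_def[symmetric]
    proof (intro ballI)
      fix x y assume "x \<in> ?H" "y \<in> ?H"
      then obtain i a j b where x: "x = (i, a)" "i \<in> S" "a < d i" and y: "y = (j, b)" "j \<in> S" "b < d j"
        by (auto simp: half_edges_of_def)
      have "(i, j) \<in> ?A\<^sup>*" using con x y by (auto simp: connects_def)
      then show "reach x y" using path x y by blast
    qed
  }
qed

theorem map_count_eq_degree_count:
  assumes \<nu>: "\<nu> \<ge> 1" and j: "j \<ge> 1"
  shows "real (\<kappa> g \<nu> j) = degree_count g (replicate_mset j (2 * \<nu>))"
proof -
  let ?S = "{1..j}" and ?d = "\<lambda>_::nat. 2 * \<nu>"
  let ?H = "half_edges_of ?S ?d" and ?m = "euler_weight {1..j} (\<lambda>_. 2 * \<nu>) - 4 * int g"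
  let ?C = "{\<tau> \<in> gluings ?H. connects ?S ?d \<tau>}"
  have H: "half_edges \<nu> j = ?H" by (simp add: half_edges_def half_edges_of_def)
  have R: "vertex_rotation \<nu> j = rotation_of ?S ?d"
    by (rule ext) (simp add: vertex_rotation_def rotation_of_def H)
  have fin: "finite ?C" by (rule finite_subset[OF _ finite_gluings[of ?H]]) (auto simp: half_edges_of_def)
  have m: "?m = 4 + 2 * int \<nu> * int j - 2 * int j - 4 * int g" by (simp add: euler_weight_def)
  have maps: "labeled_maps g \<nu> j = {\<tau> \<in> ?C. ?m = 2 * int (num_cycles_on ?H (rotation_of ?S ?d \<circ> \<tau>))}"
  proof -
    have "generates_transitively_on ?H {rotation_of ?S ?d, \<tau>} \<longleftrightarrow> connects ?S ?d \<tau>" if "\<tau> \<in> gluings ?H" for \<tau>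
      using \<nu> by (intro generates_transitively_iff_connects[OF that]) auto
    moreover have "int j - int (\<nu> * j) + int F = 2 - 2 * int g \<longleftrightarrow> ?m = 2 * int F" for F
      unfolding m of_nat_mult by linarith
    ultimately show ?thesis
      unfolding labeled_maps_def H R by (auto simp: gluings_def)
  qed
  have "half_coeff (monom 1 F) ?m = (if ?m = 2 * int F then 1 else 0)" for F
    by (rule half_coeff_cases[of ?m]) (auto simp: half_coeff_double, metis coeff_monom half_coeff_double
        zero_neq_one)
  moreover have "connected_poly ?S ?d = (\<Sum>\<tau>\<in>?C. monom 1 (num_cycles_on ?H (rotation_of ?S ?d \<circ> \<tau>)))"
    using \<nu> by (simp add: connected_poly_def)
  ultimately have "genus_count g ?S ?d
      = (\<Sum>\<tau>\<in>?C. if ?m = 2 * int (num_cycles_on ?H (rotation_of ?S ?d \<circ> \<tau>)) then 1 else 0)"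
    by (simp only: genus_count_def half_coeff_sum)
  also have "\<dots> = real (card (labeled_maps g \<nu> j))"
    unfolding maps using fin by (simp add: sum.If_cases Int_def)
  finally have "real (\<kappa> g \<nu> j) = genus_count g ?S ?d" by (simp add: map_count_def)
  also have "\<dots> = degree_count g (image_mset ?d (mset_set ?S))"
    using j by (intro genus_count_eq_degree_count) auto
  finally show ?thesis by (simp add: sum_mset_set_const)
qed

section \<open>Uniqueness, Lagrange inversion and the central binomial series\<close>

text \<open>
  Although \<open>f k\<close> may exceed \<open>k\<close>, the factor \<open>T\<close> lowers the coefficient index. The coefficients vanish by
  induction on the index, and for a fixed index by induction on \<open>k\<close>.
\<close>

lemma fps_recursion_zero:
  fixes \<delta> :: "nat \<Rightarrow> real fps"
  assumes T: "T $ 0 = 0"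
    and rec: "\<And>k. \<delta> k = (\<Sum>a<k. A k a * \<delta> a) + B k * (T * \<delta> (f k))"
  shows "\<delta> k = 0"
proof -
  have "\<forall>k. \<forall>m<n. \<delta> k $ m = 0" for n
  proof (induction n)
    case 0 show ?case by simp
  next
    case (Suc n)
    have "\<delta> k $ n = 0" for k
    proof (induction k rule: less_induct)
      case (less k)
      have "(A k a * \<delta> a) $ n = 0" if "a < k" for a
        unfolding fps_mult_nth
      proof (rule sum.neutral, rule ballI)
        fix i assume "i \<in> {0..n}"
        then have "\<delta> a $ (n - i) = 0" using Suc.IH less[OF that] by (cases "i = 0") auto
        then show "A k a $ i * \<delta> a $ (n - i) = 0" by simp
      qed
      moreover have "(B k * T * \<delta> (f k)) $ n = 0"
        unfolding fps_mult_nth[of "B k * T"]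
      proof (rule sum.neutral, rule ballI)
        fix i assume i: "i \<in> {0..n}"
        show "(B k * T) $ i * \<delta> (f k) $ (n - i) = 0"
        proof (cases "i = 0")
          case True then show ?thesis using T by simp
        next
          case False then show ?thesis using Suc.IH i by simp
        qed
      qed
      ultimately show ?case by (subst rec) (simp add: fps_sum_nth mult.assoc)
    qed
    then show ?case using Suc.IH less_Suc_eq by auto
  qed
  then show ?thesis by (intro fps_ext) auto
qed

lemma fps_const_mult_left: "fps_const c * (fps_const d * f) = fps_const (c * d) * f"
  for f :: "'a::comm_ring_1 fps"
  by (simp add: mult.assoc[symmetric])

lemma fps_const_2_mult: "fps_const 2 * f = f + f" for f :: "real fps"
  by (rule fps_ext) (simp only: fps_mult_left_const_nth fps_add_nth mult_2)

lemma fps_compose_mult_nth: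
  fixes f T G :: "real fps"
  assumes "T $ 0 = 0"
  shows "((f oo T) * G) $ n = (\<Sum>i\<le>n. f $ i * (T ^ i * G) $ n)"
proof -
  have "((f oo T) * G) $ n = (\<Sum>k\<le>n. (\<Sum>i\<le>n. f $ i * (T ^ i) $ k) * G $ (n - k))"
    unfolding fps_mult_nth atLeast0AtMost
  proof (rule sum.cong[OF refl])
    fix k assume k: "k \<in> {..n}"
    have "(f oo T) $ k = (\<Sum>i\<le>k. f $ i * (T ^ i) $ k)" by (simp add: fps_compose_nth atLeast0AtMost)
    also have "\<dots> = (\<Sum>i\<le>n. f $ i * (T ^ i) $ k)"
      by (rule sum.mono_neutral_left) (use k startsby_zero_power_prefix[OF assms] in auto)
    finally show "(f oo T) $ k * G $ (n - k) = (\<Sum>i\<le>n. f $ i * (T ^ i) $ k) * G $ (n - k)" by simp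
  qed
  also have "\<dots> = (\<Sum>i\<le>n. f $ i * (\<Sum>k\<le>n. (T ^ i) $ k * G $ (n - k)))"
    unfolding sum_distrib_left sum_distrib_right by (subst sum.swap) (simp add: mult.assoc)
  finally show ?thesis by (simp add: fps_mult_nth atLeast0AtMost)
qed

text \<open>
  Both sides are linear in \<open>f\<close>, so \<open>f = X ^ i\<close> is the only case. Then the coefficient is that of
  \<open>u ^ p\<close> in \<open>T' * \<phi> ^ (p + 1)\<close> with \<open>p = n - i\<close>, which is \<open>\<phi> ^ p - X * (\<phi> ^ p)' / p\<close> for \<open>p > 0\<close> and has
  no such term, as the Euler operator multiplies the coefficient of \<open>u ^ p\<close> by \<open>p\<close>.
\<close>

theorem fps_Lagrange_inversion:
  fixes f T \<phi> :: "real fps"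
  assumes T: "T * \<phi> = fps_X" and T0: "T $ 0 = 0"
  shows "f $ n = ((f oo T) * (fps_deriv T * \<phi> ^ Suc n)) $ n"
proof -
  have d: "fps_deriv T * \<phi> = 1 - T * fps_deriv \<phi>"
    using arg_cong[OF T, of fps_deriv] by (simp add: algebra_simps)
  have res: "(fps_deriv T * \<phi> ^ Suc p) $ p = (if p = 0 then 1 else 0)" for p
  proof (cases p)
    case 0 then show ?thesis using d T0 by simp
  next
    case (Suc m)
    have "fps_deriv T * \<phi> ^ Suc p = (fps_deriv T * \<phi>) * \<phi> ^ p" by (simp only: power_Suc mult.assoc)
    also have "\<dots> = \<phi> ^ p - (T * \<phi>) * (fps_deriv \<phi> * \<phi> ^ m)" unfolding d Suc by (simp add: algebra_simps)
    finally have "fps_deriv T * \<phi> ^ Suc p = \<phi> ^ p - fps_X * (fps_deriv \<phi> * \<phi> ^ m)" by (simp only: T)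
    moreover have "fps_deriv (\<phi> ^ p) = fps_const (real p) * (fps_deriv \<phi> * \<phi> ^ m)"
      by (simp only: fps_deriv_power Suc diff_Suc_1 mult.assoc)
    ultimately have "fps_const (real p) * (fps_deriv T * \<phi> ^ Suc p) =
        fps_const (real p) * \<phi> ^ p - fps_X * fps_deriv (\<phi> ^ p)"
      by (simp only: right_diff_distrib mult.left_commute)
    then have "real p * (fps_deriv T * \<phi> ^ Suc p) $ p
        = (fps_const (real p) * \<phi> ^ p - fps_X * fps_deriv (\<phi> ^ p)) $ p"
      by (metis fps_mult_left_const_nth)
    also have "\<dots> = 0" using Suc by (simp del: power_Suc)
    finally show ?thesis using Suc by simp
  qed
  have "(T ^ i * (fps_deriv T * \<phi> ^ Suc n)) $ n = (if i = n then 1 else 0)" if "i \<le> n" for i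
  proof -
    have "\<phi> ^ Suc n = \<phi> ^ i * \<phi> ^ Suc (n - i)" using that by (simp flip: power_add del: power_Suc)
    then have "T ^ i * (fps_deriv T * \<phi> ^ Suc n) = fps_X ^ i * (fps_deriv T * \<phi> ^ Suc (n - i))"
      unfolding T[symmetric] power_mult_distrib by (simp only: mult_ac)
    then have "(T ^ i * (fps_deriv T * \<phi> ^ Suc n)) $ n = (fps_X ^ i * (fps_deriv T * \<phi> ^ Suc (n - i))) $ n"
      by (rule arg_cong)
    also have "\<dots> = (if i = n then 1 else 0)"
      using res[of "n - i"] that by (simp add: fps_X_power_mult_nth del: power_Suc)
    finally show ?thesis .
  qed
  then have "((f oo T) * (fps_deriv T * \<phi> ^ Suc n)) $ n = (\<Sum>i\<le>n. if i = n then f $ i else 0)"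
    unfolding fps_compose_mult_nth[OF T0] by (intro sum.cong) auto
  then show ?thesis by simp
qed

text \<open>
  This is the inverse square root of \<open>1 - 4 * X\<close>, by the differential equation \<open>central_binomial_deriv\<close>.
\<close>

definition central_binomial_fps :: "real fps" (\<open>\<B>\<close>) where
  "\<B> = Abs_fps (\<lambda>n. of_nat (2 * n choose n))"

lemma central_binomial_Suc:
  "real (Suc n) * of_nat (2 * Suc n choose Suc n) = 2 * (2 * real n + 1) * of_nat (2 * n choose n)"
proof -
  have "Suc n * (2 * Suc n choose Suc n) = Suc n * (2 * (Suc (2 * n) choose n))"
    using Suc_times_binomial[of n "Suc (2 * n)"] by simp
  then have 1: "(2 * Suc n choose Suc n) = 2 * (Suc (2 * n) choose n)" by (simp only: mult_cancel1) simp
  have "Suc (2 * n) choose n = Suc (2 * n) choose Suc n"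
    using binomial_symmetric[of n "Suc (2 * n)"] by simp
  then have 2: "Suc n * (Suc (2 * n) choose n) = Suc (2 * n) * (2 * n choose n)"
    using Suc_times_binomial[of n "2 * n"] by simp
  have "Suc n * (2 * Suc n choose Suc n) = 2 * (Suc n * (Suc (2 * n) choose n))" unfolding 1 by simp
  then have "Suc n * (2 * Suc n choose Suc n) = 2 * (Suc (2 * n) * (2 * n choose n))" unfolding 2 .
  then have "real (Suc n * (2 * Suc n choose Suc n)) = real (2 * (Suc (2 * n) * (2 * n choose n)))"
    by (rule arg_cong)
  then show ?thesis by (simp only: of_nat_mult of_nat_Suc of_nat_numeral) (simp add: algebra_simps)
qed

abbreviation (input) one_minus_4X :: "real fps" (\<open>\<D>\<close>) where
  "\<D> \<equiv> 1 - fps_const 4 * fps_X"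

lemma central_binomial_deriv: "\<D> * fps_deriv \<B> = fps_const 2 * \<B>"
proof (rule fps_ext)
  fix n
  show "(\<D> * fps_deriv \<B>) $ n = (fps_const 2 * \<B>) $ n"
  proof (cases n)
    case 0 then show ?thesis by (simp add: central_binomial_fps_def algebra_simps)
  next
    case (Suc m)
    have "(\<D> * fps_deriv \<B>) $ n = fps_deriv \<B> $ n - 4 * (fps_X * fps_deriv \<B>) $ n"
      by (simp add: left_diff_distrib mult.assoc)
    also have "\<dots> = real (Suc n) * of_nat (2 * Suc n choose Suc n) - 4 * (real n * of_nat (2 * n choose n))"
      using Suc by (simp add: central_binomial_fps_def)
    also have "\<dots> = 2 * of_nat (2 * n choose n)"
      unfolding central_binomial_Suc by (simp add: algebra_simps)
    finally show ?thesis by (simp add: central_binomial_fps_def)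
  qed
qed

lemma central_binomial_square: "\<D> * \<B>\<^sup>2 = 1"
proof -
  have "fps_deriv (\<D> * \<B>\<^sup>2) = \<D> * fps_deriv (\<B>\<^sup>2) + fps_deriv \<D> * \<B>\<^sup>2" by (rule fps_deriv_mult)
  also have "fps_deriv (\<B>\<^sup>2) = fps_const 2 * (\<B> * fps_deriv \<B>)"
    by (simp add: power2_eq_square fps_const_2_mult mult.commute)
  also have "\<D> * (fps_const 2 * (\<B> * fps_deriv \<B>)) = fps_const 2 * (\<B> * (\<D> * fps_deriv \<B>))"
    by (simp only: mult_ac)
  also have "\<dots> = fps_const 4 * \<B>\<^sup>2"
    unfolding central_binomial_deriv
      by (simp add: power2_eq_square mult.left_commute[of \<B>] fps_const_mult_left)
  also have "fps_const 4 * \<B>\<^sup>2 + fps_deriv \<D> * \<B>\<^sup>2 = 0" by (intro fps_ext) simp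
  finally have "\<D> * \<B>\<^sup>2 = fps_const ((\<D> * \<B>\<^sup>2) $ 0)" by (simp only: fps_deriv_eq_0_iff)
  moreover have "\<B> $ 0 = 1" by (simp add: central_binomial_fps_def)
  ultimately show ?thesis by (simp add: power2_eq_square)
qed

lemma central_binomial_deriv': "fps_deriv \<B> = fps_const 2 * \<B> ^ 3"
proof -
  have "fps_deriv \<B> = (\<D> * \<B>\<^sup>2) * fps_deriv \<B>" by (simp only: central_binomial_square mult_1)
  also have "\<dots> = \<B>\<^sup>2 * (\<D> * fps_deriv \<B>)" by (simp only: mult_ac)
  also have "\<dots> = fps_const 2 * \<B> ^ 3" unfolding central_binomial_deriv
    by (simp add: power2_eq_square power3_eq_cube mult_ac)
  finally show ?thesis .
qed

lemma central_binomial_nth_0: "\<B> $ 0 = 1"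
  by (simp add: central_binomial_fps_def)

lemma central_binomial_cube_nth: "(\<B> ^ 3) $ n = (2 * real n + 1) * of_nat (2 * n choose n)"
proof -
  have "2 * (\<B> ^ 3) $ n = fps_deriv \<B> $ n" unfolding central_binomial_deriv' by simp
  also have "\<dots> = real (Suc n) * of_nat (2 * Suc n choose Suc n)" by (simp add: central_binomial_fps_def)
  finally show ?thesis unfolding central_binomial_Suc by (simp add: algebra_simps)
qed

lemma central_binomial_fifth_nth: "6 * (fps_X * \<B> ^ 5) $ n = real n * (\<B> ^ 3) $ n"
proof -
  have "fps_deriv (\<B> ^ 3) = fps_const 6 * \<B> ^ 5"
  proof -
    have "\<B> ^ 5 = \<B> ^ 3 * \<B> ^ 2" by (simp flip: power_add)
    then show ?thesis
      by (simp add: fps_deriv_power central_binomial_deriv' mult.assoc fps_const_mult_left)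
  qed
  then have "real n * (\<B> ^ 3) $ n = (fps_X * (fps_const 6 * \<B> ^ 5)) $ n"
    by (cases n) (simp_all flip: \<open>fps_deriv (\<B> ^ 3) = fps_const 6 * \<B> ^ 5\<close>)
  then show ?thesis by (simp add: mult.left_commute)
qed

definition sqrt_fps :: "real fps" (\<open>\<S>\<close>) where "\<S> = \<D> * \<B>"

lemma sqrt_fps_inverse: "\<S> * \<B> = 1"
  using central_binomial_square by (simp add: sqrt_fps_def power2_eq_square mult.assoc)

lemma sqrt_fps_square: "\<S>\<^sup>2 = \<D>"
proof -
  have "\<S>\<^sup>2 = \<D> * (\<D> * \<B>\<^sup>2)" by (simp add: sqrt_fps_def power2_eq_square mult_ac)
  then show ?thesis by (simp only: central_binomial_square mult_1_right)
qed

lemma sqrt_fps_deriv: "fps_deriv \<S> = - fps_const 2 * \<B>"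
proof -
  have "fps_deriv \<S> = \<D> * fps_deriv \<B> + fps_deriv \<D> * \<B>"
    unfolding sqrt_fps_def by (rule fps_deriv_mult)
  then show ?thesis unfolding central_binomial_deriv by (intro fps_ext) simp
qed

definition degree_le :: "nat \<Rightarrow> 'a::zero fps \<Rightarrow> bool" where
  "degree_le N f \<longleftrightarrow> (\<forall>i>N. f $ i = 0)"

lemma degree_le_mult:
  fixes f g :: "'a::comm_semiring_1 fps"
  assumes "degree_le N f" "degree_le M g" shows "degree_le (N + M) (f * g)"
  unfolding degree_le_def fps_mult_nth
proof (intro allI impI sum.neutral ballI)
  fix i k assume "N + M < i" "k \<in> {0..i}"
  then show "f $ k * g $ (i - k) = 0"
    using assms by (cases "k > N") (auto simp: degree_le_def)
qed

lemma degree_le_add: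
  fixes f g :: "'a::comm_semiring_1 fps"
  shows "degree_le N f \<Longrightarrow> degree_le N g \<Longrightarrow> degree_le N (f + g)"
  by (simp add: degree_le_def)

lemma degree_le_diff:
  fixes f g :: "'a::comm_ring_1 fps"
  shows "degree_le N f \<Longrightarrow> degree_le N g \<Longrightarrow> degree_le N (f - g)"
  by (simp add: degree_le_def)

lemma degree_le_mono: "degree_le N f \<Longrightarrow> N \<le> M \<Longrightarrow> degree_le M f"
  by (simp add: degree_le_def)

text \<open>
  The product \<open>F\<close> satisfies a first-order differential equation with the inhomogeneous term \<open>q * X ^ e\<close>. Its
  coefficients agree with those of \<open>f * \<S>\<close> up to the index \<open>e\<close>, where the value of \<open>q\<close> makes the next
  coefficient zero; from then on the recursion is homogeneous. This polynomiality is the reason why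
  the planar two-point function depends on the ordinary vertices only through \<open>R\<close>.
\<close>

lemma sqrt_fps_mult_polynomial:
  fixes E :: "real fps"
  assumes E0: "E $ 0 = f" and E': "fps_deriv E
      = fps_const (2 * f * of_nat (2 * e choose e)) * fps_X ^ e * \<B> ^ 3"
  shows "degree_le e (\<S> * E)"
proof -
  define F where "F = \<S> * E"
  define q where "q = 2 * f * of_nat (2 * e choose e)"
  have DSB: "\<D> * \<S> * \<B> ^ 3 = 1"
  proof -
    have "\<D> * \<S> * \<B> ^ 3 = (\<S> * \<B>) * (\<D> * \<B>\<^sup>2)" by (simp add: power2_eq_square power3_eq_cube mult_ac)
    then show ?thesis by (simp only: central_binomial_square sqrt_fps_inverse mult_1)
  qed
  have "\<D> * fps_deriv F = fps_const q * fps_X ^ e * (\<D> * \<S> * \<B> ^ 3) - fps_const 2 * (\<D> * \<B> * E)"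
  proof -
    have "d * (s * (k * x * b) + (- c * b') * E') = k * x * (d * s * b) - c * (d * b' * E')"
      for d s k x b c b' E' :: "real fps" by (simp add: algebra_simps)
    then show ?thesis by (simp only: F_def fps_deriv_mult sqrt_fps_deriv E' q_def)
  qed
  then have "\<D> * fps_deriv F = fps_const q * fps_X ^ e - fps_const 2 * F"
    unfolding DSB by (simp add: F_def sqrt_fps_def)
  then have "fps_deriv F = fps_const q * fps_X ^ e - fps_const 2 * F + fps_const 4 * (fps_X * fps_deriv F)"
    by (simp add: algebra_simps)
  then have "fps_deriv F $ n = q * (fps_X ^ e) $ n - 2 * F $ n + 4 * (fps_X * fps_deriv F) $ n" for n
    by (metis fps_add_nth fps_sub_nth fps_mult_left_const_nth)
  moreover have "(fps_X * fps_deriv F) $ n = real n * F $ n" for n by (cases n) simp_all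
  moreover have "fps_deriv F $ n = real (Suc n) * F $ Suc n" for n by simp
  ultimately have rec: "real (Suc n) * F $ Suc n = (if n = e then q else 0) + (4 * real n - 2) * F $ n"
    for n
    by (simp only: fps_X_power_nth) (simp add: algebra_simps)
  have F0: "F $ 0 = f" using E0 by (simp add: F_def sqrt_fps_def central_binomial_nth_0)
  have low: "(2 * real n - 1) * F $ n = - f * of_nat (2 * n choose n)" if "n \<le> e" for n
    using that
  proof (induction n)
    case 0 then show ?case using F0 by simp
  next
    case (Suc n)
    have "real (Suc n) * ((2 * real (Suc n) - 1) * F $ Suc n)
        = (2 * real (Suc n) - 1) * ((4 * real n - 2) * F $ n)"
      using rec[of n] Suc.prems by simp
    also have "\<dots> = 2 * (2 * real n + 1) * ((2 * real n - 1) * F $ n)" by (simp add: algebra_simps)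
    also have "\<dots> = - f * (2 * (2 * real n + 1) * of_nat (2 * n choose n))" using Suc by simp
    also have "\<dots> = real (Suc n) * (- f * of_nat (2 * Suc n choose Suc n))"
      unfolding central_binomial_Suc[symmetric] by simp
    finally show ?case by (simp only: mult_cancel_left of_nat_eq_0_iff) simp
  qed
  have high: "F $ (Suc (e + n)) = 0" for n
  proof (induction n)
    case 0
    have "real (Suc e) * F $ Suc e = q + 2 * ((2 * real e - 1) * F $ e)" using rec[of e]
      by (simp add: algebra_simps)
    then show ?case unfolding low[OF order_refl] by (simp add: q_def)
  next
    case (Suc n)
    then show ?case using rec[of "Suc (e + n)"] by simp
  qed
  show ?thesis unfolding degree_le_def F_def[symmetric]
  proof (intro allI impI)
    fix i assume "e < i"
    then obtain n where "i = Suc (e + n)" using less_imp_Suc_add by blast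
    then show "F $ i = 0" using high by simp
  qed
qed

text \<open>
  The right-hand side collects, up to the factor of the total degree, the two-point functions of a fixed total
  degree: \<open>\<B> ^ 6\<close> comes from a pair of odd degrees and \<open>4 * X * \<B> ^ 6\<close> from a pair of even degrees.
\<close>

lemma weighted_sum_identity: "fps_deriv (fps_X * \<B> ^ 4) = (1 + fps_const 4 * fps_X) * \<B> ^ 6"
proof -
  have "fps_deriv (fps_X * \<B> ^ 4) = \<B> ^ 4 + fps_const 8 * fps_X * \<B> ^ 6"
  proof -
    have "\<B> ^ 6 = \<B> ^ 3 * \<B> ^ 3" by (simp flip: power_add)
    then show ?thesis
      by (simp add: fps_deriv_power central_binomial_deriv' mult.assoc mult.left_commute[of fps_X]
          fps_const_mult_left)
  qed
  moreover have "\<B> ^ 4 = \<D> * \<B> ^ 6"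
  proof -
    have "\<B> ^ 4 = (\<D> * \<B>\<^sup>2) * \<B> ^ 4" by (simp only: central_binomial_square mult_1)
    also have "\<dots> = \<D> * \<B> ^ 6" by (simp only: mult.assoc flip: power_add) simp
    finally show ?thesis .
  qed
  ultimately have "fps_deriv (fps_X * \<B> ^ 4) = (\<D> + fps_const 8 * fps_X) * \<B> ^ 6"
    by (simp only: distrib_right)
  also have "\<D> + fps_const 8 * fps_X = 1 + fps_const 4 * fps_X" by (simp add: fps_eq_iff)
  finally show ?thesis .
qed

text \<open>
  Division of a truncated series by \<open>1 - 4 * X\<close> with remainder.
\<close>

lemma fps_cutoff_geometric:
  "fps_cutoff (Suc N) (\<D> * F) = fps_const (F $ N) * fps_X ^ N + \<D> * fps_cutoff N F"
proof (rule fps_ext)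
  fix i
  have D: "(\<D> * G) $ i = (if i = 0 then G $ 0 else G $ i - 4 * G $ (i - 1))" for G :: "real fps"
    by (simp add: left_diff_distrib mult.assoc)
  show "fps_cutoff (Suc N) (\<D> * F) $ i = (fps_const (F $ N) * fps_X ^ N + \<D> * fps_cutoff N F) $ i"
    unfolding fps_add_nth fps_cutoff_nth D by (cases "i = N") (auto simp: fps_X_power_nth less_Suc_eq)
qed

section \<open>Explicit solutions of the recursions\<close>

text \<open>
  All series are expressed in \<open>u = R - 1\<close>, which is the variable \<open>fps_X\<close> of the coefficient ring.
\<close>

definition \<R> :: "real fps" where "\<R> = 1 + fps_X"

text \<open>
  Substitution of \<open>R * z\<close> for the variable, where \<open>z = 1 / x\<^sup>2\<close> is the variable of the outer series.
\<close>

definition scale :: "real fps \<Rightarrow> real fps fps" where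
  "scale f = Abs_fps (\<lambda>k. fps_const (f $ k) * \<R> ^ k)"

lemma scale_nth: "scale f $ k = fps_const (f $ k) * \<R> ^ k"
  by (simp add: scale_def)

lemma scale_add: "scale (f + g) = scale f + scale g"
  by (rule fps_ext) (simp add: scale_nth distrib_right flip: fps_const_add)

lemma fps_const_setsum: "fps_const (\<Sum>x\<in>A. f x) = (\<Sum>x\<in>A. fps_const (f x))"
  for f :: "'b \<Rightarrow> 'a::comm_ring_1"
  by (induction A rule: infinite_finite_induct) (simp_all flip: fps_const_add)

lemma scale_mult: "scale (f * g) = scale f * scale g"
proof (rule fps_ext)
  fix k
  have "scale (f * g) $ k = (\<Sum>i=0..k. fps_const (f $ i * g $ (k - i)) * \<R> ^ k)"
    by (simp only: scale_nth fps_mult_nth fps_const_setsum sum_distrib_right)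
  also have "\<dots> = (\<Sum>i=0..k. (fps_const (f $ i) * \<R> ^ i) * (fps_const (g $ (k - i)) * \<R> ^ (k - i)))"
  proof (rule sum.cong[OF refl])
    fix i assume "i \<in> {0..k}"
    then have "\<R> ^ k = \<R> ^ i * \<R> ^ (k - i)" by (simp flip: power_add)
    then show "fps_const (f $ i * g $ (k - i)) * \<R> ^ k =
       (fps_const (f $ i) * \<R> ^ i) * (fps_const (g $ (k - i)) * \<R> ^ (k - i))"
      by (simp only: fps_const_mult[symmetric] mult_ac)
  qed
  finally show "scale (f * g) $ k = (scale f * scale g) $ k" by (simp add: scale_nth fps_mult_nth)
qed

lemma scale_one: "scale 1 = 1"
  by (rule fps_ext) (simp add: scale_nth)

lemma scale_X: "scale fps_X = fps_const \<R> * fps_X"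
  by (rule fps_ext) (simp add: scale_nth le_Suc_eq)

lemma degree_le_scale: "degree_le N f \<Longrightarrow> degree_le N (scale f)"
  by (simp add: degree_le_def scale_nth)

lemma R_nz: "\<R> \<noteq> 0"
proof
  assume "\<R> = 0" then have "\<R> $ 0 = 0" by simp
  then show False by (simp add: \<R>_def)
qed

lemma mult_X_power_nth: "(fps_X ^ a * f) $ (a + b) = f $ b"
  for f :: "'a::comm_ring_1 fps"
  by (simp add: fps_X_power_mult_nth)

lemma degree_le_X_power: "degree_le a (fps_X ^ a :: 'a::comm_ring_1 fps)"
  by (simp add: degree_le_def fps_X_power_nth)

lemma degree_le_const: "degree_le 0 (fps_const a)"
  by (simp add: degree_le_def)

lemma degree_le_const_mult: "degree_le N f \<Longrightarrow> degree_le N (fps_const a * f)"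
  for f :: "'a::comm_ring_1 fps"
  by (simp add: degree_le_def)

lemma degree_le_cutoff: "degree_le N (fps_cutoff (Suc N) f)"
  by (simp add: degree_le_def)

context
  fixes n :: nat
begin

text \<open>
  The constant \<open>c\<close> of the theorem for \<open>\<nu> = n + 1\<close>, see \<open>gamma_eq_c_const\<close>.
\<close>

definition \<gamma> :: real where "\<gamma> = real (Suc n) * of_nat (2 * Suc n choose Suc n)"

text \<open>
  The weight \<open>t\<close> of an ordinary vertex as a series in \<open>u\<close>, obtained from \<open>R = 1 + c * t * R ^ \<nu>\<close>.
\<close>

definition \<T> :: "real fps" where "\<T> = fps_const (1 / \<gamma>) * (fps_X * inverse (\<R> ^ Suc n))"

text \<open>
  The weight of the contraction of an edge to an ordinary vertex, which has \<open>2 * \<nu>\<close> half-edges to choose from.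
\<close>

definition \<theta> :: "real fps" where "\<theta> = fps_const (2 * real (Suc n)) * \<T>"

lemma gamma_pos: "\<gamma> > 0"
proof -
  have "2 * Suc n choose Suc n > 0" by (simp only: zero_less_binomial_iff) simp
  then have "real (2 * Suc n choose Suc n) > 0" by (simp only: of_nat_0_less_iff)
  then show ?thesis unfolding \<gamma>_def by (intro mult_pos_pos) simp_all
qed

lemma gamma_cube: "2 * (\<B> ^ 3) $ n = \<gamma>"
  unfolding central_binomial_cube_nth \<gamma>_def central_binomial_Suc by simp

lemma T_inverse: "\<T> * (fps_const \<gamma> * \<R> ^ Suc n) = fps_X"
proof -
  have "inverse (\<R> ^ Suc n) * \<R> ^ Suc n = 1"
    by (rule inverse_mult_eq_1) (simp add: \<R>_def fps_power_zeroth del: power_Suc)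
  moreover have "\<T> * (fps_const \<gamma> * \<R> ^ Suc n) =
      (fps_const (1 / \<gamma>) * fps_const \<gamma>) * (fps_X * (inverse (\<R> ^ Suc n) * \<R> ^ Suc n))"
    unfolding \<T>_def by (simp only: mult_ac)
  ultimately show ?thesis using gamma_pos by (simp del: power_Suc)
qed

lemma T_nth_0: "\<T> $ 0 = 0"
  by (simp add: \<T>_def del: power_Suc)

text \<open>
  The derivative \<open>V'(x) = x - 2 * \<nu> * t * x ^ (2 * \<nu> - 1)\<close>, divided by \<open>x ^ (2 * \<nu> - 1)\<close>.
\<close>

definition pot :: "real fps fps" where "pot = fps_X ^ n - fps_const \<theta>"

text \<open>
  The polynomial part of the quotient of \<open>V'(x)\<close> by the square root of \<open>x\<^sup>2 - 4 * R\<close>, divided by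
  \<open>x ^ (2 * \<nu> - 2)\<close>.
\<close>

definition mom :: "real fps fps" where
  "mom = fps_X ^ n - fps_const \<theta> * scale (fps_cutoff (Suc n) \<B>)"

text \<open>
  Twice the planar one-point function: what has to be subtracted from \<open>V'\<close> to leave the polynomial part
  \<open>mom\<close> times the square root (\<open>spectral_curve\<close>).
\<close>

definition disc2 :: "real fps fps" where
  "disc2 = scale \<S> * fps_shift (Suc n) (pot * scale \<B> - mom)"

definition disc :: "real fps fps" where "disc = fps_const (fps_const (1/2)) * disc2"

lemma disc2_eq: "disc2 = disc + disc"
proof -
  have "disc + disc = (fps_const (fps_const (1/2)) + fps_const (fps_const (1/2))) * disc2"
    by (simp only: disc_def distrib_right)
  also have "fps_const (fps_const (1/2)) + fps_const (fps_const (1/2)) = (1 :: real fps fps)"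
    by (simp only: fps_const_add) simp
  finally show ?thesis by simp
qed

lemma pot_mult_nth: "(pot * f) $ (n + d) = f $ d - \<theta> * f $ (n + d)"
  by (simp add: pot_def left_diff_distrib mult_X_power_nth)

lemma degree_pot: "degree_le n pot" and degree_mom: "degree_le n mom"
proof -
  show "degree_le n pot" unfolding pot_def
    by (intro degree_le_diff degree_le_X_power degree_le_mono[OF degree_le_const]) simp
  show "degree_le n mom" unfolding mom_def
    by (intro degree_le_diff degree_le_X_power degree_le_const_mult degree_le_scale degree_le_cutoff)
qed

lemma pot_mom_low: "i < Suc n \<Longrightarrow> (pot * scale \<B> - mom) $ i = 0"
proof -
  assume i: "i < Suc n"
  have "(pot * scale \<B> - mom) $ i = (fps_X ^ n * scale \<B>) $ i - (fps_X ^ n) $ i"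
    using i by (simp add: pot_def mom_def left_diff_distrib scale_nth)
  then show ?thesis using i
    by (cases "i = n") (simp_all add: fps_X_power_mult_nth fps_X_power_nth scale_nth central_binomial_nth_0)
qed

lemma theta_R: "\<theta> * (fps_const (of_nat (2 * Suc n choose Suc n)) * \<R> ^ Suc n) = fps_const 2 * fps_X"
proof -
  have "\<theta> * (fps_const (of_nat (2 * Suc n choose Suc n)) * \<R> ^ Suc n) =
     fps_const 2 * (\<T> * ((fps_const (real (Suc n)) * fps_const (of_nat (2 * Suc n choose Suc n)))
         * \<R> ^ Suc n))"
    unfolding \<theta>_def fps_const_mult[symmetric] by (simp only: mult_ac)
  also have "\<dots> = fps_const 2 * (\<T> * (fps_const \<gamma> * \<R> ^ Suc n))"
    by (simp only: fps_const_mult \<gamma>_def)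
  finally show ?thesis unfolding T_inverse .
qed

text \<open>
  The relation between \<open>t\<close> and \<open>R\<close> enters here: it makes the one-point function start with 1.
\<close>

lemma pot_mom_top: "(pot * scale \<B> - mom) $ Suc n = fps_const 2"
proof -
  have "(pot * scale \<B>) $ (n + 1) = scale \<B> $ 1 - \<theta> * scale \<B> $ (n + 1)" by (rule pot_mult_nth)
  moreover have "scale \<B> $ 1 = fps_const 2 * \<R>" by (simp add: scale_nth central_binomial_fps_def)
  moreover have "\<theta> * scale \<B> $ (n + 1) = fps_const 2 * fps_X"
    using theta_R
      by (simp add: scale_nth central_binomial_fps_def del: power_Suc binomial_Suc_Suc mult_Suc_right)
  moreover have "mom $ Suc n = 0" using degree_mom by (simp add: degree_le_def)
  moreover have "fps_const 2 * \<R> - fps_const 2 * fps_X = fps_const 2"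
    by (simp only: \<R>_def flip: right_diff_distrib) simp
  ultimately show ?thesis by simp
qed

lemma pot_mom_factor: "pot * scale \<B> - mom = fps_X ^ Suc n * fps_shift (Suc n) (pot * scale \<B> - mom)"
proof (rule fps_ext)
  fix i
  show "(pot * scale \<B> - mom) $ i = (fps_X ^ Suc n * fps_shift (Suc n) (pot * scale \<B> - mom)) $ i"
    using pot_mom_low[of i] by (simp add: fps_X_power_mult_nth del: power_Suc)
qed

lemma scale_SB: "scale \<S> * scale \<B> = 1"
  by (simp only: scale_mult[symmetric] sqrt_fps_inverse scale_one)

lemma spectral_curve: "mom * scale \<S> = pot - fps_X ^ Suc n * (disc + disc)"
proof -
  have "mom = pot * scale \<B> - fps_X ^ Suc n * fps_shift (Suc n) (pot * scale \<B> - mom)"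
    by (subst pot_mom_factor[symmetric]) simp
  then have "mom * scale \<S> = (pot * scale \<B> - fps_X ^ Suc n * fps_shift (Suc n) (pot * scale \<B> - mom))
      * scale \<S>"
    by simp
  also have "\<dots> = pot * (scale \<S> * scale \<B>) - fps_X ^ Suc n * disc2"
    unfolding disc2_def left_diff_distrib by (simp only: mult_ac)
  finally show ?thesis unfolding scale_SB disc2_eq by simp
qed

lemma disc_0: "disc $ 0 = 1"
proof -
  have "disc2 $ 0 = fps_const 2"
    unfolding disc2_def fps_mult_nth_0 fps_shift_nth add_0 pot_mom_top
    by (simp add: scale_nth sqrt_fps_def central_binomial_nth_0)
  then show ?thesis by (simp add: disc_def)
qed

text \<open>
  The square of \<open>V' - 2 * W\<close> is a polynomial, since the square root disappears. The coefficients beyond its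
  degree vanish, which is the recursion.
\<close>

lemma disc_recursion: "disc $ Suc d = (disc * disc) $ d + \<theta> * disc $ (n + Suc d)"
proof -
  \<comment> \<open>The square is \<open>pot\<^sup>2 + z ^ \<nu> * W\<close>, and \<open>pot\<^sup>2\<close> stays below the degree in question.\<close>
  let ?W = "fps_X ^ Suc n * ((disc + disc) * (disc + disc)) - (pot * (disc + disc) + pot * (disc + disc))"
  have "(mom * scale \<S>) * (mom * scale \<S>) = mom * mom * scale \<D>"
    unfolding sqrt_fps_square[symmetric] power2_eq_square scale_mult by (simp only: mult_ac)
  moreover have "degree_le 1 \<D>" by (simp add: degree_le_def)
  then have "degree_le (n + n + 1) (mom * mom * scale \<D>)"
    by (intro degree_le_mult degree_mom degree_le_scale)
  moreover have "(mom * scale \<S>) * (mom * scale \<S>) = pot * pot + fps_X ^ Suc n * ?W"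
    unfolding spectral_curve by (simp only: algebra_simps)
  ultimately have "degree_le (n + n + 1) (pot * pot + fps_X ^ Suc n * ?W)" by simp
  moreover have "degree_le (n + n + 1) (pot * pot)"
    by (intro degree_le_mono[OF degree_le_mult[OF degree_pot degree_pot]]) simp
  ultimately have "degree_le (n + n + 1) (fps_X ^ Suc n * ?W)"
    using degree_le_diff by fastforce
  then have "(fps_X ^ Suc n * ?W) $ (Suc n + (n + Suc d)) = 0" by (simp add: degree_le_def del: power_Suc)
  then have "?W $ (n + Suc d) = 0" unfolding mult_X_power_nth .
  moreover have "(fps_X ^ Suc n * ((disc + disc) * (disc + disc))) $ (n + Suc d)
      = ((disc + disc) * (disc + disc)) $ d"
    using mult_X_power_nth[of "Suc n" "(disc + disc) * (disc + disc)" d]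
      by (simp only: add_Suc add_Suc_right)
  ultimately have *: "((disc + disc) * (disc + disc)) $ d
      = (pot * (disc + disc) + pot * (disc + disc)) $ (n + Suc d)"
    by (simp only: fps_sub_nth) simp
  have "((disc + disc) * (disc + disc)) $ d
      = (disc * disc) $ d + (disc * disc) $ d + (disc * disc) $ d + (disc * disc) $ d"
    by (simp only: distrib_left distrib_right fps_add_nth add.assoc)
  with * have **: "(disc * disc) $ d + (disc * disc) $ d + (disc * disc) $ d + (disc * disc) $ d =
     (disc $ Suc d - \<theta> * disc $ (n + Suc d)) + (disc $ Suc d - \<theta> * disc $ (n + Suc d))
         + ((disc $ Suc d - \<theta> * disc $ (n + Suc d)) + (disc $ Suc d - \<theta> * disc $ (n + Suc d)))"
    by (simp only: distrib_left fps_add_nth pot_mult_nth)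
  show ?thesis
  proof (rule fps_ext)
    fix i
    let ?a = "(disc * disc) $ d $ i" and ?b = "disc $ Suc d $ i - (\<theta> * disc $ (n + Suc d)) $ i"
    have "?a + ?a + ?a + ?a = ?b + ?b + (?b + ?b)"
      using arg_cong[OF **, of "\<lambda>x. x $ i"] by (simp only: fps_add_nth fps_sub_nth)
    then have "?a = ?b" by linarith
    then show "disc $ Suc d $ i = ((disc * disc) $ d + \<theta> * disc $ (n + Suc d)) $ i"
      by (simp only: fps_add_nth)
  qed
qed

text \<open>
  The series \<open>E\<close> to which \<open>sqrt_fps_mult_polynomial\<close> applies, integrated term by term.
\<close>

definition two_point :: "real \<Rightarrow> nat \<Rightarrow> real fps" where
  "two_point f e = Abs_fps (\<lambda>i. if i = 0 then f else if i \<le> e then 0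
     else 2 * f * of_nat (2 * e choose e) * (\<B> ^ 3) $ (i - Suc e) / real i)"

text \<open>
  The candidate for the planar two-point function with second degree \<open>2 * f\<close>, where \<open>f = e\<close> for even and
  \<open>f = e + 1/2\<close> for odd degrees.
\<close>

definition annulus :: "real \<Rightarrow> nat \<Rightarrow> real fps fps" where
  "annulus f e = fps_shift (Suc e) (scale (two_point f e))"

lemma annulus_nth: "annulus f e $ i
    = fps_const (2 * f * of_nat (2 * e choose e) * (\<B> ^ 3) $ i / real (Suc (e + i))) * \<R> ^ Suc (e + i)"
  by (simp add: annulus_def scale_nth two_point_def add.commute del: power_Suc)

lemma two_point_deriv:
  "fps_deriv (two_point f e) = fps_const (2 * f * of_nat (2 * e choose e)) * fps_X ^ e * \<B> ^ 3"
proof (rule fps_ext)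
  fix i
  have "fps_deriv (two_point f e) $ i = real (Suc i) * two_point f e $ Suc i" by simp
  also have "\<dots> = (if i < e then 0 else 2 * f * of_nat (2 * e choose e) * (\<B> ^ 3) $ (i - e))"
    by (simp add: two_point_def Suc_le_eq del: of_nat_Suc)
  also have "\<dots> = (fps_const (2 * f * of_nat (2 * e choose e)) * (fps_X ^ e * \<B> ^ 3)) $ i"
    by (simp add: fps_X_power_mult_nth)
  finally show "fps_deriv (two_point f e) $ i
      = (fps_const (2 * f * of_nat (2 * e choose e)) * fps_X ^ e * \<B> ^ 3) $ i"
    by (simp only: mult.assoc)
qed

text \<open>
  Let \<open>E\<close> be the scaled series \<open>two_point f e\<close>. Then \<open>(V' - 2 * W) * E\<close> is \<open>mom\<close> times the square root times
  \<open>E\<close>, a product of polynomials. The recursion is again the vanishing of the coefficients beyond the degree.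
\<close>

lemma annulus_recursion:
  "annulus f e $ i = fps_const (2 * f) * disc $ (e + i)
      + (if i = 0 then 0 else fps_const 2 * (disc * annulus f e) $ (i - 1))
     + \<theta> * annulus f e $ (n + i)"
proof -
  let ?annulus = "annulus f e" and ?f = "fps_const (fps_const f)" and ?N = "Suc (n + e + i)"
  have E: "scale (two_point f e) = ?f + fps_X ^ Suc e * ?annulus"
  proof (rule fps_ext)
    fix k show "scale (two_point f e) $ k = (?f + fps_X ^ Suc e * ?annulus) $ k"
      by (cases "k = 0") (auto simp: annulus_def fps_X_power_mult_nth scale_nth two_point_def simp del:
          power_Suc)
  qed
  have "degree_le e (\<S> * two_point f e)"
    by (rule sqrt_fps_mult_polynomial[OF _ two_point_deriv]) (simp add: two_point_def)
  then have "degree_le (n + e) (mom * scale (\<S> * two_point f e))"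
    by (intro degree_le_mult degree_mom degree_le_scale)
  moreover have "mom * scale (\<S> * two_point f e)
      = (pot - fps_X ^ Suc n * (disc + disc)) * (?f + fps_X ^ Suc e * ?annulus)"
    unfolding scale_mult E[symmetric] spectral_curve[symmetric] by (simp only: mult.assoc)
  also have "\<dots> = pot * ?f + fps_X ^ Suc e * (pot * ?annulus) - fps_X ^ Suc n * ((disc + disc) * ?f)
      - fps_X ^ Suc n * (fps_X ^ Suc e * ((disc + disc) * ?annulus))"
    by (simp only: algebra_simps)
  ultimately have "(pot * ?f + fps_X ^ Suc e * (pot * ?annulus) - fps_X ^ Suc n * ((disc + disc) * ?f)
      - fps_X ^ Suc n * (fps_X ^ Suc e * ((disc + disc) * ?annulus))) $ ?N = 0"
    by (simp only: degree_le_def)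
  moreover have "(pot * ?f) $ ?N = 0"
    using degree_le_mult[OF degree_pot degree_le_const] by (simp only: degree_le_def)
  moreover have "(fps_X ^ Suc e * (pot * ?annulus)) $ ?N = ?annulus $ i - \<theta> * ?annulus $ (n + i)"
    using mult_X_power_nth[of "Suc e" "pot * ?annulus" "n + i"] pot_mult_nth[of ?annulus i]
    by (simp only: add_Suc add_Suc_right add.left_commute add.commute add.assoc)
  moreover have "(fps_X ^ Suc n * ((disc + disc) * ?f)) $ ?N = fps_const (2 * f) * disc $ (e + i)"
  proof -
    have "(fps_X ^ Suc n * ((disc + disc) * ?f)) $ ?N = ((disc + disc) * ?f) $ (e + i)"
      using mult_X_power_nth[of "Suc n" "(disc + disc) * ?f" "e + i"] by (simp only: add_Suc add.assoc)
    also have "\<dots> = fps_const f * disc $ (e + i) + fps_const f * disc $ (e + i)"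
      by (simp only: fps_mult_right_const_nth fps_add_nth) (simp only: distrib_right distrib_left
          mult.commute)
    also have "\<dots> = (fps_const f + fps_const f) * disc $ (e + i)" by (simp only: distrib_right)
    finally show ?thesis by (simp only: fps_const_add mult_2)
  qed
  moreover have "(fps_X ^ Suc n * (fps_X ^ Suc e * ((disc + disc) * ?annulus))) $ ?N
      = (if i = 0 then 0 else fps_const 2 * (disc * ?annulus) $ (i - 1))"
  proof -
    have "(fps_X ^ Suc n * (fps_X ^ Suc e * ((disc + disc) * ?annulus))) $ ?N
        = (fps_X ^ Suc e * ((disc + disc) * ?annulus)) $ (e + i)"
      using mult_X_power_nth[of "Suc n" "fps_X ^ Suc e * ((disc + disc) * ?annulus)" "e + i"]
        by (simp only: add_Suc add.assoc)
    also have "\<dots> = (if i = 0 then 0 else ((disc + disc) * ?annulus) $ (i - 1))"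
      by (simp add: fps_X_power_mult_nth del: power_Suc)
    also have "((disc + disc) * ?annulus) $ (i - 1) = fps_const 2 * (disc * ?annulus) $ (i - 1)"
      by (simp only: distrib_right fps_add_nth fps_const_2_mult)
    finally show ?thesis .
  qed
  ultimately show ?thesis by (simp only: fps_add_nth fps_sub_nth) (simp add: algebra_simps)
qed

text \<open>
  Up to a unit this is \<open>dt/du\<close>, see \<open>T_deriv\<close>, and also the leading coefficient of \<open>mom\<close> at the branch
  points \<open>x\<^sup>2 = 4 * R\<close>, see \<open>mom_expansion\<close>.
\<close>

definition jac :: "real fps" where "jac = 1 - fps_const (real n) * fps_X"

lemma jac_inverse: "jac * inverse jac = 1"
  by (rule inverse_mult_eq_1') (simp add: jac_def)

lemma theta_gamma: "\<theta> * (fps_const (\<gamma> / 2) * \<R> ^ Suc n) = fps_const (real (Suc n)) * fps_X"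
proof -
  have "\<theta> * (fps_const (\<gamma> / 2) * \<R> ^ Suc n) =
     fps_const (1/2) * (fps_const (2 * real (Suc n)) * (\<T> * (fps_const \<gamma> * \<R> ^ Suc n)))"
  proof -
    have "fps_const (\<gamma> / 2) = fps_const (1/2) * fps_const \<gamma>" by (simp only: fps_const_mult) simp
    then show ?thesis unfolding \<theta>_def by (simp only: mult_ac)
  qed
  then show ?thesis unfolding T_inverse by (simp add: fps_const_mult_left)
qed

lemma R_minus: "\<R> - fps_const (real (Suc n)) * fps_X = jac"
  unfolding \<R>_def jac_def by (rule fps_ext) (simp add: fps_X_nth)

lemma T_deriv: "fps_const \<gamma> * fps_deriv \<T> * \<R> ^ Suc (Suc n) = jac"
proof -
  have dR: "fps_deriv \<R> = 1" by (simp add: \<R>_def)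
  have "fps_deriv (\<T> * (fps_const \<gamma> * \<R> ^ Suc n)) = 1" unfolding T_inverse by simp
  moreover have "fps_deriv (\<T> * (fps_const \<gamma> * \<R> ^ Suc n)) =
     \<T> * (fps_const \<gamma> * (fps_const (real (Suc n)) * \<R> ^ n)) + fps_deriv \<T> * (fps_const \<gamma> * \<R> ^ Suc n)"
    by (simp only: fps_deriv_mult fps_deriv_power dR fps_deriv_const diff_Suc_1) simp
  ultimately have "\<R> * (\<T> * (fps_const \<gamma> * (fps_const (real (Suc n)) * \<R> ^ n)) + fps_deriv \<T>
      * (fps_const \<gamma> * \<R> ^ Suc n)) = \<R> * 1"
    by (simp only:)
  then have "fps_const (real (Suc n)) * (\<T> * (fps_const \<gamma> * \<R> ^ Suc n)) + fps_const \<gamma> * fps_deriv \<T>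
      * \<R> ^ Suc (Suc n) = \<R>"
    by (simp only: distrib_left power_Suc mult_ac mult_1_right mult_1_left)
  then have "fps_const \<gamma> * fps_deriv \<T> * \<R> ^ Suc (Suc n) = \<R> - fps_const (real (Suc n)) * fps_X"
    unfolding T_inverse by (simp only: eq_diff_eq add.commute)
  then show ?thesis unfolding R_minus .
qed

definition fifth_coeff :: real where "fifth_coeff = real n * \<gamma> / 12"

lemma fifth_coeff_nth: "(fps_X * \<B> ^ 5) $ n = fifth_coeff"
proof -
  have "2 * (6 * (fps_X * \<B> ^ 5) $ n) = real n * (2 * (\<B> ^ 3) $ n)"
    unfolding central_binomial_fifth_nth by (simp only: mult.left_commute)
  then show ?thesis unfolding gamma_cube fifth_coeff_def by linarith
qed

definition mom_slope :: "real fps" where "mom_slope = - (\<theta> * (fps_const fifth_coeff * \<R> ^ n))"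

definition mom_rest :: "real fps fps" where "mom_rest
    = - (fps_const \<theta> * scale (fps_cutoff n (fps_X * \<B> ^ 5)))"

lemma scale_monomial: "scale (fps_const a * fps_X ^ k) = fps_const (fps_const a * \<R> ^ k) * fps_X ^ k"
  by (rule fps_ext) (simp add: scale_nth fps_X_power_nth)

lemma central_binomial_reduce: "\<B> ^ k = \<D> * \<B> ^ (k + 2)"
proof -
  have "\<D> * \<B> ^ (k + 2) = (\<D> * \<B>\<^sup>2) * \<B> ^ k" by (simp only: power_add mult_ac)
  then show ?thesis by (simp only: central_binomial_square mult_1)
qed

text \<open>
  The first two terms of the Taylor expansion of \<open>mom\<close> at the branch points, where \<open>1 - 4 * R * z\<close> vanishes.
  They are obtained by dividing the truncated series in \<open>mom\<close> twice by \<open>1 - 4 * X\<close>; the powers of \<open>\<B>\<close> go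
  up by two each time.
\<close>

lemma mom_expansion:
  "fps_const \<R> * fps_X * mom = fps_const jac * fps_X ^ Suc n
     + scale \<D> * (fps_const mom_slope * fps_X ^ n + scale \<D> * mom_rest)"
proof -
  have X: "fps_X * fps_cutoff (Suc n) \<B> = fps_cutoff (Suc (Suc n)) (fps_X * \<B>)"
  proof (rule fps_ext)
    fix i show "(fps_X * fps_cutoff (Suc n) \<B>) $ i = fps_cutoff (Suc (Suc n)) (fps_X * \<B>) $ i"
      by (cases i) simp_all
  qed
  have 1: "fps_X * \<B> = \<D> * (fps_X * \<B> ^ 3)"
    using central_binomial_reduce[of 1] by (simp add: mult.left_commute numeral_3_eq_3)
  have 3: "fps_X * \<B> ^ 3 = \<D> * (fps_X * \<B> ^ 5)"
    using central_binomial_reduce[of 3] by (simp add: mult.left_commute)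
  have b: "(fps_X * \<B> ^ 3) $ Suc n = \<gamma> / 2" using gamma_cube by simp
  have "fps_X * fps_cutoff (Suc n) \<B>
      = fps_const (\<gamma> / 2) * fps_X ^ Suc n + \<D> * fps_cutoff (Suc n) (fps_X * \<B> ^ 3)"
    unfolding X 1 fps_cutoff_geometric b ..
  also have "fps_cutoff (Suc n) (fps_X * \<B> ^ 3)
      = fps_const fifth_coeff * fps_X ^ n + \<D> * fps_cutoff n (fps_X * \<B> ^ 5)"
    unfolding 3 fps_cutoff_geometric fifth_coeff_nth ..
  finally have "scale (fps_X * fps_cutoff (Suc n) \<B>)
      = fps_const (fps_const (\<gamma> / 2) * \<R> ^ Suc n) * fps_X ^ Suc n
     + scale \<D> * (fps_const (fps_const fifth_coeff * \<R> ^ n) * fps_X ^ n + scale \<D>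
         * scale (fps_cutoff n (fps_X * \<B> ^ 5)))"
    by (simp only: scale_add scale_mult[of \<D>] scale_monomial)
  then have *: "fps_const \<R> * fps_X * scale (fps_cutoff (Suc n) \<B>)
      = fps_const (fps_const (\<gamma> / 2) * \<R> ^ Suc n) * fps_X ^ Suc n
     + scale \<D> * (fps_const (fps_const fifth_coeff * \<R> ^ n) * fps_X ^ n + scale \<D>
         * scale (fps_cutoff n (fps_X * \<B> ^ 5)))"
    by (simp only: scale_mult scale_X)
  have "fps_const \<R> * fps_X * mom
      = fps_const \<R> * fps_X ^ Suc n - fps_const \<theta> * (fps_const \<R> * fps_X * scale (fps_cutoff (Suc n) \<B>))"
    unfolding mom_def by (simp only: right_diff_distrib power_Suc mult_ac)
  also have "\<dots> = (fps_const \<R> - fps_const \<theta> * fps_const (fps_const (\<gamma> / 2) * \<R> ^ Suc n)) * fps_X ^ Suc n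
     + scale \<D> * (- (fps_const \<theta> * fps_const (fps_const fifth_coeff * \<R> ^ n)) * fps_X ^ n + scale \<D>
         * mom_rest)"
  proof -
    have "r * p - t * (e * p + d * (g * q + d * k)) = (r - t * e) * p + d * (- (t * g) * q + d * - (t * k))"
      for r p t e d g q k :: "real fps fps" by (simp add: algebra_simps)
    then show ?thesis unfolding * mom_rest_def .
  qed
  also have "fps_const \<R> - fps_const \<theta> * fps_const (fps_const (\<gamma> / 2) * \<R> ^ Suc n) = fps_const jac"
    by (simp only: fps_const_mult fps_const_sub theta_gamma R_minus)
  also have "- (fps_const \<theta> * fps_const (fps_const fifth_coeff * \<R> ^ n)) = fps_const mom_slope"
    by (simp only: fps_const_mult fps_const_neg mom_slope_def)
  finally show ?thesis .
qed

text \<open>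
  The genus 1 function has poles of order 5 and 3 at the branch points (in terms of the square root). The
  coefficients are chosen such that the two leading singular terms cancel in \<open>torus_polynomial\<close>, which is
  what \<open>A5_jac\<close> and \<open>A3_jac\<close> express.
\<close>

definition A5 :: "real fps" where "A5 = \<R>\<^sup>2 * inverse jac"
definition A3 :: "real fps" where "A3 = - (mom_slope * A5 * inverse jac)"

lemma A5_jac: "jac * A5 = \<R>\<^sup>2"
proof -
  have "jac * A5 = (jac * inverse jac) * \<R>\<^sup>2" unfolding A5_def by (simp only: mult_ac)
  then show ?thesis by (simp only: jac_inverse mult_1)
qed

lemma A3_jac: "jac * A3 + mom_slope * A5 = 0"
proof -
  have "jac * A3 = - ((jac * inverse jac) * (mom_slope * A5))" unfolding A3_def
    by (simp only: mult_minus_right mult_ac)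
  then show ?thesis by (simp only: jac_inverse mult_1) simp
qed

definition torus_disc :: "real fps fps" where
  "torus_disc = fps_X * (fps_X * (fps_const A5 * scale (\<B> ^ 5))) + fps_X * (fps_const A3 * scale (\<B> ^ 3))"

lemma torus_disc_0: "torus_disc $ 0 = 0"
  by (simp add: torus_disc_def)

text \<open>
  By \<open>spectral_curve\<close> the first two terms are \<open>mom\<close> times the square root times \<open>torus_disc\<close>. After
  multiplication by \<open>R\<close>, inserting \<open>mom_expansion\<close> leaves terms with denominators
  \<open>(1 - 4 * R * z)\<^sup>2\<close> and \<open>1 - 4 * R * z\<close>, which vanish by the choice of \<open>A5\<close> and \<open>A3\<close>, and a polynomial.
\<close>

lemma torus_polynomial:
  "degree_le n (pot * torus_disc - fps_X ^ Suc n * ((disc + disc) * torus_disc) - fps_X ^ Suc n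
      * scale (fps_X * \<B> ^ 4))"
    (is "degree_le n ?Q")
proof -
  have S5: "scale \<S> * scale (\<B> ^ 5) = scale (\<B> ^ 4)"
    and S3: "scale \<S> * scale (\<B> ^ 3) = scale \<D> * scale (\<B> ^ 4)"
  proof -
    have s: "\<S> * \<B> ^ Suc k = \<B> ^ k" for k
      unfolding power_Suc mult.assoc[symmetric] sqrt_fps_inverse by simp
    show "scale \<S> * scale (\<B> ^ 5) = scale (\<B> ^ 4)"
      using s[of 4] by (simp add: scale_mult[symmetric] del: power_Suc)
    have "\<S> * \<B> ^ 3 = \<D> * \<B> ^ 4"
    proof -
      have "\<S> * \<B> ^ Suc 2 = \<D> * \<B> ^ (2 + 2)" unfolding s by (rule central_binomial_reduce)
      then show ?thesis by (simp del: power_Suc)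
    qed
    then show "scale \<S> * scale (\<B> ^ 3) = scale \<D> * scale (\<B> ^ 4)"
      by (simp only: scale_mult[symmetric])
  qed
  have DB: "scale (\<B> ^ 4) * (scale \<D> * scale \<D>) = 1"
  proof -
    have "\<B> ^ 4 * (\<D> * \<D>) = (\<D> * \<B>\<^sup>2) * (\<D> * \<B>\<^sup>2)"
      by (simp only: mult_ac flip: power_add) (simp add: mult_ac flip: power_add)
    also have "\<dots> = 1" by (simp only: central_binomial_square mult_1)
    finally show ?thesis by (simp only: scale_mult[symmetric] scale_one)
  qed
  let ?L = "fps_X * fps_const A5 + fps_const A3 * scale \<D>"
  have "?Q = mom * scale \<S> * torus_disc - fps_X ^ Suc n * scale (fps_X * \<B> ^ 4)"
    unfolding spectral_curve by (simp only: left_diff_distrib mult.assoc)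
  also have "mom * scale \<S> * torus_disc
      = mom * (fps_X * (fps_X * (fps_const A5 * (scale \<S> * scale (\<B> ^ 5)))) + fps_X
          * (fps_const A3 * (scale \<S> * scale (\<B> ^ 3))))"
    unfolding torus_disc_def by (simp only: distrib_left mult_ac)
  also have "\<dots> = fps_X * mom * (scale (\<B> ^ 4) * ?L)"
    unfolding S5 S3 by (simp only: distrib_left mult_ac)
  finally have "fps_const \<R> * ?Q
      = (fps_const \<R> * fps_X * mom) * (scale (\<B> ^ 4) * ?L) - fps_const \<R>
          * (fps_X ^ Suc n * (fps_const \<R> * fps_X * scale (\<B> ^ 4)))"
    unfolding scale_mult[of fps_X] scale_X by (simp only: right_diff_distrib mult_ac)
  also have "\<dots> = scale (\<B> ^ 4) * (fps_X ^ Suc n * fps_X)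
      * (fps_const jac * fps_const A5 - fps_const \<R> * fps_const \<R>)
     + scale (\<B> ^ 4) * fps_X ^ Suc n * scale \<D>
         * (fps_const jac * fps_const A3 + fps_const mom_slope * fps_const A5)
     + (scale (\<B> ^ 4) * (scale \<D> * scale \<D>)) * (fps_const mom_slope * fps_const A3 * fps_X ^ n + mom_rest
         * ?L)"
  proof -
    have "(j * (x * xn) + d * (a * xn + d * k)) * (b * (x * a5 + a3 * d)) - r * ((x * xn) * (r * x * b)) =
       b * ((x * xn) * x) * (j * a5 - r * r) + b * (x * xn) * d * (j * a3 + a * a5) + (b * (d * d))
           * (a * a3 * xn + k * (x * a5 + a3 * d))"
      for j x xn d a k b a5 a3 r :: "real fps fps" by (simp add: algebra_simps)
    then show ?thesis unfolding mom_expansion power_Suc .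
  qed
  also have "fps_const jac * fps_const A5 - fps_const \<R> * fps_const \<R> = 0"
    by (simp only: fps_const_mult fps_const_sub A5_jac) (simp add: power2_eq_square)
  also have "fps_const jac * fps_const A3 + fps_const mom_slope * fps_const A5 = 0"
    by (simp only: fps_const_mult fps_const_add A3_jac) simp
  \<comment> \<open>The factor \<open>\<B> ^ 4\<close> cancels the square of \<open>1 - 4 * R * z\<close> in the last summand.\<close>
  finally have RQ: "fps_const \<R> * ?Q = fps_const mom_slope * fps_const A3 * fps_X ^ n + mom_rest * ?L"
    unfolding DB by simp
  have "degree_le 1 \<D>" by (simp add: degree_le_def)
  then have "degree_le 1 (fps_const A3 * scale \<D>)" by (intro degree_le_const_mult degree_le_scale)
  moreover have "degree_le 1 (fps_X * fps_const A5)" by (simp add: degree_le_def)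
  ultimately have L: "degree_le 1 ?L" using degree_le_add by blast
  have "degree_le n (mom_rest * ?L)"
  proof (cases n)
    case 0
    have z: "fps_cutoff n (fps_X * \<B> ^ 5) = 0"
      by (intro fps_ext) (simp only: fps_cutoff_nth 0 not_less0 if_False fps_zero_nth)
    have "scale 0 = 0" by (rule fps_ext) (simp add: scale_nth)
    then have "mom_rest = 0" by (simp only: mom_rest_def z mult_zero_right neg_equal_zero minus_zero)
    then show ?thesis by (simp add: degree_le_def)
  next
    case (Suc k)
    have "degree_le k mom_rest" unfolding mom_rest_def using Suc by (simp add: degree_le_def scale_nth)
    from degree_le_mult[OF this L] show ?thesis using Suc by simp
  qed
  moreover have "degree_le n (fps_const mom_slope * fps_const A3 * fps_X ^ n)"
    unfolding mult.assoc by (intro degree_le_const_mult degree_le_X_power)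
  ultimately have "degree_le n (fps_const \<R> * ?Q)" unfolding RQ using degree_le_add by blast
  then show ?thesis using R_nz by (simp only: degree_le_def fps_mult_left_const_nth mult_eq_0_iff) simp
qed

lemma torus_disc_recursion: "torus_disc $ Suc d
    = fps_const 2 * (disc * torus_disc) $ d + scale (fps_X * \<B> ^ 4) $ d + \<theta> * torus_disc $ (n + Suc d)"
proof -
  have N: "n + Suc d = Suc n + d" by simp
  have "(pot * torus_disc - fps_X ^ Suc n * ((disc + disc) * torus_disc) - fps_X ^ Suc n
      * scale (fps_X * \<B> ^ 4)) $ (n + Suc d) = 0"
    using torus_polynomial by (simp only: degree_le_def)
  then have "(pot * torus_disc) $ (n + Suc d) - ((disc + disc) * torus_disc) $ d - scale (fps_X * \<B> ^ 4) $ d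
      = 0"
    using mult_X_power_nth[of "Suc n" "(disc + disc)
        * torus_disc" d] mult_X_power_nth[of "Suc n" "scale (fps_X * \<B> ^ 4)" d]
    by (simp only: fps_sub_nth N)
  moreover have "((disc + disc) * torus_disc) $ d = fps_const 2 * (disc * torus_disc) $ d"
    by (simp only: distrib_right fps_add_nth fps_const_2_mult)
  ultimately show ?thesis unfolding pot_mult_nth by (simp add: algebra_simps)
qed

lemma torus_disc_top: "jac\<^sup>2 * torus_disc $ Suc n = fps_const fifth_coeff * \<R> ^ (n + 2)"
proof -
  have c: "scale (\<B> ^ 3) $ n = fps_const (\<gamma> / 2) * \<R> ^ n" using gamma_cube by (simp add: scale_nth)
  have "\<R> * (fps_X * (fps_const A5 * scale (\<B> ^ 5))) $ n = A5 * (fps_const \<R> * fps_X * scale (\<B> ^ 5)) $ n"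
    by (cases n) (simp_all add: mult.assoc mult_ac)
  also have "fps_const \<R> * fps_X * scale (\<B> ^ 5) = scale (fps_X * \<B> ^ 5)" by (simp only: scale_mult scale_X)
  also have "scale (fps_X * \<B> ^ 5) $ n = fps_const fifth_coeff * \<R> ^ n"
    by (simp only: scale_nth fifth_coeff_nth)
  finally have 5: "\<R> * (fps_X * (fps_const A5 * scale (\<B> ^ 5))) $ n
      = A5 * (fps_const fifth_coeff * \<R> ^ n)" .
  have "torus_disc $ Suc n = (fps_X * (fps_const A5 * scale (\<B> ^ 5))) $ n + A3 * scale (\<B> ^ 3) $ n"
    by (simp add: torus_disc_def)
  then have "\<R> * torus_disc $ Suc n
      = A5 * (fps_const fifth_coeff * \<R> ^ n) + \<R> * (A3 * (fps_const (\<gamma> / 2) * \<R> ^ n))"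
    by (simp only: distrib_left 5 c)
  then have "\<R> * (jac\<^sup>2 * torus_disc $ Suc n)
      = jac\<^sup>2 * (A5 * (fps_const fifth_coeff * \<R> ^ n) + \<R> * (A3 * (fps_const (\<gamma> / 2) * \<R> ^ n)))"
    by (simp only: mult.left_commute[of \<R>])
  also have "\<dots> = jac * (jac * A5) * (fps_const fifth_coeff * \<R> ^ n) + jac * (jac * A3)
      * (fps_const (\<gamma> / 2) * \<R> ^ Suc n)"
    by (simp only: power2_eq_square power_Suc distrib_left mult_ac)
  also have "jac * A3 = - (mom_slope * A5)" using A3_jac by (simp only: eq_neg_iff_add_eq_0)
  also have "jac * - (mom_slope * A5) * (fps_const (\<gamma> / 2) * \<R> ^ Suc n) =
      (jac * A5) * (fps_const fifth_coeff * \<R> ^ n) * (\<theta> * (fps_const (\<gamma> / 2) * \<R> ^ Suc n))"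
    unfolding mom_slope_def by (simp only: minus_mult_left[symmetric] mult_minus_right minus_minus mult_ac)
  also have "jac * (jac * A5) * (fps_const fifth_coeff * \<R> ^ n) + (jac * A5)
      * (fps_const fifth_coeff * \<R> ^ n) * (\<theta> * (fps_const (\<gamma> / 2) * \<R> ^ Suc n))
     = (jac + fps_const (real (Suc n)) * fps_X) * ((jac * A5) * (fps_const fifth_coeff * \<R> ^ n))"
  proof -
    have "j * p * q + p * q * x = (j + x) * (p * q)" for j p q x :: "real fps" by (simp add: algebra_simps)
    then show ?thesis unfolding theta_gamma .
  qed
  also have "jac + fps_const (real (Suc n)) * fps_X = \<R>" unfolding R_minus[symmetric] by simp
  finally have "\<R> * (jac\<^sup>2 * torus_disc $ Suc n) = \<R> * (fps_const fifth_coeff * \<R> ^ (n + 2))"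
    unfolding A5_jac by (simp only: power_add mult_ac)
  then show ?thesis using R_nz by (simp only: mult_cancel_left) simp
qed

end

section \<open>Identification of the generating functions\<close>

lemma sum_lessThan_double:
  "(\<Sum>a<2 * d. f a) = (\<Sum>a<d. f (2 * a) + f (Suc (2 * a)))" for f :: "nat \<Rightarrow> 'a::comm_monoid_add"
  by (induction d) (simp_all add: add.assoc)

lemma sum_even_terms:
  fixes f :: "nat \<Rightarrow> 'a::comm_monoid_add"
  assumes "\<And>a. odd a \<Longrightarrow> f a = 0"
  shows "(\<Sum>a<Suc (2 * d). f a) = (\<Sum>a<Suc d. f (2 * a))"
  using assms by (simp add: sum_lessThan_double)

lemma fps_mult_nth_lessThan: "(f * g) $ i = (\<Sum>a<Suc i. f $ a * g $ (i - a))"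
  by (simp add: fps_mult_nth atLeast0AtMost lessThan_Suc_atMost)

context
  fixes n :: nat
begin

text \<open>
  The two-point function and the genus 1 function satisfy linear recursions of the same form, which differ only
  in the inhomogeneous term \<open>s\<close>.
\<close>

lemma linear_recursion_unique:
  assumes U: "\<And>i. U $ Suc i = fps_const 2 * (disc n * U) $ i + s i + \<theta> n * U $ (n + Suc i)"
    and U0: "U $ 0 = 0"
    and V: "\<And>i. V $ Suc i = fps_const 2 * (disc n * V) $ i + s i + \<theta> n * V $ (n + Suc i)"
      and V0: "V $ 0 = 0"
  shows "U = V"
proof -
  define \<delta> where "\<delta> k = U $ k - V $ k" for k
  have "\<delta> k = (\<Sum>a<k. (fps_const 2 * disc n $ (k - 1 - a)) * \<delta> a)
      + (if k = 0 then 0 else fps_const (2 * real (Suc n))) * (\<T> n * \<delta> (n + k))" for k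
  proof (cases k)
    case 0 then show ?thesis by (simp add: \<delta>_def U0 V0)
  next
    case (Suc i)
    have "\<delta> k = fps_const 2 * ((U * disc n) $ i - (V * disc n) $ i) + \<theta> n * \<delta> (n + k)"
      unfolding \<delta>_def Suc U[of i] V[of i] mult.commute[of _ "disc n"]
        by (simp only: right_diff_distrib) simp
    also have "(U * disc n) $ i - (V * disc n) $ i = (\<Sum>a<Suc i. disc n $ (i - a) * \<delta> a)"
      unfolding fps_mult_nth_lessThan \<delta>_def
      by (simp only: sum_subtractf[symmetric] right_diff_distrib mult.commute)
    finally show ?thesis unfolding Suc \<theta>_def by (simp only: sum_distrib_left mult.assoc diff_Suc_1) simp
  qed
  then have "\<delta> k = 0" for k by (rule fps_recursion_zero[OF T_nth_0])
  then show ?thesis by (intro fps_ext) (simp only: \<delta>_def right_minus_eq)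
qed

text \<open>
  The generating functions of maps with one and with two marked vertices, in the variable \<open>u\<close>.
\<close>

definition disc_gf :: "nat \<Rightarrow> nat \<Rightarrow> real fps" where "disc_gf g k = egf (one_count (Suc n) g k) oo \<T> n"
definition annulus_gf :: "nat \<Rightarrow> nat \<Rightarrow> real fps" where "annulus_gf k l = egf (two_count (Suc n) k l) oo \<T> n"

lemmas compose_simps = fps_compose_add_distrib fps_compose_mult_distrib[OF T_nth_0] fps_compose_sum_distrib
  fps_const_compose fps_X_fps_compose_startby0[OF T_nth_0]

lemma compose_edge: "(fps_const (2 * real (Suc n)) * (fps_X * f)) oo \<T> n = \<theta> n * (f oo \<T> n)"
  unfolding \<theta>_def by (simp only: compose_simps mult.assoc)

lemma disc_gf_planar_recursion: "disc_gf 0 (Suc k)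
    = (\<Sum>a<k. disc_gf 0 (k - 1 - a) * disc_gf 0 a) + \<theta> n * disc_gf 0 (k + 2 * Suc n - 1)"
  unfolding disc_gf_def planar_one_count_recursion fps_compose_add_distrib compose_edge
    by (simp only: fps_compose_add_distrib fps_compose_sum_distrib fps_compose_mult_distrib[OF T_nth_0])

lemma disc_gf_torus_recursion: "disc_gf 1 (Suc k)
    = (\<Sum>a<k. annulus_gf (k - 1 - a) a + disc_gf 0 (k - 1 - a) * disc_gf 1 a + disc_gf 1 (k - 1 - a)
        * disc_gf 0 a)
    + \<theta> n * disc_gf 1 (k + 2 * Suc n - 1)"
  unfolding disc_gf_def annulus_gf_def torus_one_count_recursion fps_compose_add_distrib compose_edge
    by (simp only: fps_compose_add_distrib fps_compose_sum_distrib fps_compose_mult_distrib[OF T_nth_0])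

lemma annulus_gf_recursion: "annulus_gf (Suc k) l
    = (\<Sum>a<k. annulus_gf (k - 1 - a) l * disc_gf 0 a + disc_gf 0 (k - 1 - a) * annulus_gf a l)
    + fps_const (real l) * disc_gf 0 (k + l - 1) + \<theta> n * annulus_gf (k + 2 * Suc n - 1) l"
  unfolding disc_gf_def annulus_gf_def planar_two_count_recursion fps_compose_add_distrib compose_edge
    by (simp only: fps_compose_add_distrib fps_compose_sum_distrib fps_compose_mult_distrib[OF T_nth_0]
        fps_const_compose)

lemma disc_gf_parity: "odd k \<Longrightarrow> disc_gf g k = 0"
  by (simp add: disc_gf_def one_count_odd)

lemma annulus_gf_parity: "odd (k + l) \<Longrightarrow> annulus_gf k l = 0"
  unfolding annulus_gf_def by (subst two_count_odd) simp_all

lemma disc_gf_0: "disc_gf g 0 = (if g = 0 then 1 else 0)"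
  by (simp add: disc_gf_def one_count_0)

lemma annulus_gf_0: "annulus_gf 0 l = 0" "annulus_gf k 0 = 0"
  by (simp_all add: annulus_gf_def two_count_0)

text \<open>
  The recursion is quadratic, but the difference of two solutions satisfies a linear one with coefficients
  built from both.
\<close>

theorem disc_gf_planar_eq: "disc_gf 0 (2 * d) = disc n $ d"
proof -
  define X where "X d = disc_gf 0 (2 * d)" for d
  have X: "X (Suc i) = (\<Sum>a<Suc i. X (i - a) * X a) + \<theta> n * X (n + Suc i)" for i
  proof -
    have "X (Suc i) = (\<Sum>a<Suc (2 * i). disc_gf 0 (2 * i - a) * disc_gf 0 a) + \<theta> n * X (n + Suc i)"
      using disc_gf_planar_recursion[of "Suc (2 * i)"] by (simp add: X_def algebra_simps)
    also have "(\<Sum>a<Suc (2 * i). disc_gf 0 (2 * i - a) * disc_gf 0 a)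
        = (\<Sum>a<Suc i. disc_gf 0 (2 * i - 2 * a) * disc_gf 0 (2 * a))"
      by (rule sum_even_terms) (simp add: disc_gf_parity)
    finally show ?thesis by (simp only: X_def right_diff_distrib')
  qed
  define \<delta> where "\<delta> d = X d - disc n $ d" for d
  have "\<delta> k = (\<Sum>a<k. (X (k - 1 - a) + disc n $ (k - 1 - a)) * \<delta> a)
      + (if k = 0 then 0 else fps_const (2 * real (Suc n))) * (\<T> n * \<delta> (n + k))" for k
  proof (cases k)
    case 0 then show ?thesis by (simp add: \<delta>_def X_def disc_gf_0 disc_0)
  next
    case (Suc i)
    have rev: "(\<Sum>a<Suc i. disc n $ (i - a) * \<delta> a) = (\<Sum>a<Suc i. disc n $ a * \<delta> (i - a))"
    proof -
      have "(\<Sum>a<Suc i. disc n $ (i - a) * \<delta> a)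
          = (\<Sum>a<Suc i. disc n $ (Suc i - Suc a) * \<delta> (i - (Suc i - Suc a)))"
        by (rule sum.cong[OF refl]) simp
      also have "\<dots> = (\<Sum>a<Suc i. disc n $ a * \<delta> (i - a))" by (rule sum.nat_diff_reindex)
      finally show ?thesis .
    qed
    have "\<delta> k = ((\<Sum>a<Suc i. X (i - a) * X a) - (\<Sum>a<Suc i. disc n $ a * disc n $ (i - a))) + \<theta> n * \<delta> (n + k)"
      unfolding \<delta>_def Suc X[of i] disc_recursion[of n i] fps_mult_nth_lessThan by (simp add: algebra_simps)
    also have "(\<Sum>a<Suc i. X (i - a) * X a) - (\<Sum>a<Suc i. disc n $ a * disc n $ (i - a)) =
       (\<Sum>a<Suc i. X (i - a) * \<delta> a) + (\<Sum>a<Suc i. disc n $ a * \<delta> (i - a))"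
      unfolding sum_subtractf[symmetric] sum.distrib[symmetric] \<delta>_def
      by (intro sum.cong refl) (simp add: algebra_simps)
    also have "\<dots> = (\<Sum>a<Suc i. (X (i - a) + disc n $ (i - a)) * \<delta> a)"
      unfolding rev[symmetric] sum.distrib[symmetric] by (simp only: distrib_right)
    finally show ?thesis unfolding Suc \<theta>_def by (simp only: mult.assoc diff_Suc_1) simp
  qed
  then have "\<delta> d = 0" by (rule fps_recursion_zero[OF T_nth_0])
  then show ?thesis by (simp add: \<delta>_def X_def)
qed

lemma shifted_annulus_recursion: "(fps_X * annulus f e) $ Suc i
    = fps_const 2 * (disc n * (fps_X * annulus f e)) $ i + fps_const (2 * f) * disc n $ (e + i)
    + \<theta> n * (fps_X * annulus f e) $ (n + Suc i)"
proof -
  have "(disc n * (fps_X * annulus f e)) $ i = (if i = 0 then 0 else (disc n * annulus f e) $ (i - 1))"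
    by (simp add: mult.left_commute)
  then show ?thesis using annulus_recursion[where n = n and f = f and e = e and i = i]
    by (cases "i = 0") (simp_all add: algebra_simps)
qed

lemma convolution_double: "(\<Sum>a<Suc i. U $ (i - a) * disc n $ a + disc n $ (i - a) * U $ a)
    = fps_const 2 * (disc n * U) $ i"
proof -
  have "(\<Sum>a<Suc i. U $ (i - a) * disc n $ a + disc n $ (i - a) * U $ a)
      = (disc n * U) $ i + (U * disc n) $ i"
    unfolding sum.distrib fps_mult_nth_lessThan by (simp only: mult.commute)
  then show ?thesis by (simp only: fps_const_2_mult mult.commute[of U])
qed

theorem annulus_gf_even_eq: "annulus_gf (2 * Suc i) (2 * e) = annulus (real e) e $ i"
proof -
  define U where "U = Abs_fps (\<lambda>d. annulus_gf (2 * d) (2 * e))"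
  have "U = fps_X * annulus (real e) e"
  proof (rule linear_recursion_unique[where s = "\<lambda>i. fps_const (2 * real e) * disc n $ (e + i)"])
    fix i
    have "annulus_gf (2 * Suc i) (2 * e)
        = (\<Sum>a<Suc (2 * i). annulus_gf (2 * i - a) (2 * e) * disc_gf 0 a + disc_gf 0 (2 * i - a)
            * annulus_gf a (2 * e))
       + fps_const (real (2 * e)) * disc n $ (e + i) + \<theta> n * annulus_gf (2 * (n + Suc i)) (2 * e)"
      using annulus_gf_recursion[of "Suc (2 * i)" "2 * e"] disc_gf_planar_eq[of "e + i"]
        by (simp add: algebra_simps)
    also have "(\<Sum>a<Suc (2 * i). annulus_gf (2 * i - a) (2 * e) * disc_gf 0 a + disc_gf 0 (2 * i - a)
        * annulus_gf a (2 * e))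
      = (\<Sum>a<Suc i. annulus_gf (2 * i - 2 * a) (2 * e) * disc_gf 0 (2 * a) + disc_gf 0 (2 * i - 2 * a)
          * annulus_gf (2 * a) (2 * e))"
      by (rule sum_even_terms) (simp add: disc_gf_parity annulus_gf_parity)
    also have "\<dots> = (\<Sum>a<Suc i. U $ (i - a) * disc n $ a + disc n $ (i - a) * U $ a)"
      by (simp add: U_def disc_gf_planar_eq flip: right_diff_distrib')
    finally show "U $ Suc i = fps_const 2 * (disc n * U) $ i + fps_const (2 * real e) * disc n $ (e + i)
        + \<theta> n * U $ (n + Suc i)"
      unfolding convolution_double by (simp add: U_def disc_gf_planar_eq)
  next
    show "(fps_X * annulus (real e) e) $ Suc i
        = fps_const 2 * (disc n * (fps_X * annulus (real e) e)) $ i + fps_const (2 * real e)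
            * disc n $ (e + i)
       + \<theta> n * (fps_X * annulus (real e) e) $ (n + Suc i)" for i by (rule shifted_annulus_recursion)
  qed (simp_all add: U_def annulus_gf_0)
  then have "U $ Suc i = (fps_X * annulus (real e) e) $ Suc i" by simp
  then show ?thesis by (simp add: U_def)
qed

theorem annulus_gf_odd_eq: "annulus_gf (Suc (2 * i)) (Suc (2 * e)) = annulus (real e + 1/2) e $ i"
proof -
  define U where "U = fps_X * Abs_fps (\<lambda>d. annulus_gf (Suc (2 * d)) (Suc (2 * e)))"
  let ?l = "Suc (2 * e)"
  have "U = fps_X * annulus (real e + 1/2) e"
  proof (rule linear_recursion_unique[where s = "\<lambda>i. fps_const (2 * (real e + 1/2)) * disc n $ (e + i)"])
    fix i
    have "annulus_gf (Suc (2 * i)) ?l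
        = (\<Sum>a<2 * i. annulus_gf (2 * i - 1 - a) ?l * disc_gf 0 a + disc_gf 0 (2 * i - 1 - a)
            * annulus_gf a ?l)
       + fps_const (real ?l) * disc n $ (e + i) + \<theta> n * annulus_gf (Suc (2 * (n + i))) ?l"
      using annulus_gf_recursion[of "2 * i" ?l] disc_gf_planar_eq[of "e + i"] by (simp add: algebra_simps)
    also have "(\<Sum>a<2 * i. annulus_gf (2 * i - 1 - a) ?l * disc_gf 0 a + disc_gf 0 (2 * i - 1 - a)
        * annulus_gf a ?l)
      = (\<Sum>a<i. annulus_gf (2 * i - 1 - 2 * a) ?l * disc_gf 0 (2 * a) + disc_gf 0 (2 * i - 1 - Suc (2 * a))
          * annulus_gf (Suc (2 * a)) ?l)"
      unfolding sum_lessThan_double by (intro sum.cong refl) (simp add: disc_gf_parity annulus_gf_parity)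
    also have "\<dots> = (\<Sum>a<i. U $ (i - a) * disc n $ a) + (\<Sum>a<i. disc n $ (i - Suc a) * U $ Suc a)"
      unfolding sum.distrib
    proof (intro arg_cong2[of _ _ _ _ "(+)"] sum.cong refl)
      fix a assume a: "a \<in> {..<i}"
      then have "2 * i - 1 - 2 * a = Suc (2 * (i - a - 1))" by auto
      then show "annulus_gf (2 * i - 1 - 2 * a) ?l * disc_gf 0 (2 * a) = U $ (i - a) * disc n $ a"
        using a by (simp add: U_def disc_gf_planar_eq)
      have "2 * i - 1 - Suc (2 * a) = 2 * (i - Suc a)" using a by auto
      then show "disc_gf 0 (2 * i - 1 - Suc (2 * a)) * annulus_gf (Suc (2 * a)) ?l
          = disc n $ (i - Suc a) * U $ Suc a"
        by (simp add: U_def disc_gf_planar_eq)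
    qed
    also have "\<dots> = (\<Sum>a<Suc i. U $ (i - a) * disc n $ a + disc n $ (i - a) * U $ a)"
    proof -
      have "U $ 0 = 0" by (simp add: U_def)
      then have "(\<Sum>a<Suc i. disc n $ (i - a) * U $ a) = (\<Sum>a<i. disc n $ (i - Suc a) * U $ Suc a)"
        unfolding sum.lessThan_Suc_shift by simp
      moreover have "(\<Sum>a<Suc i. U $ (i - a) * disc n $ a) = (\<Sum>a<i. U $ (i - a) * disc n $ a)"
        using \<open>U $ 0 = 0\<close> by simp
      ultimately show ?thesis unfolding sum.distrib by simp
    qed
    finally show "U $ Suc i = fps_const 2 * (disc n * U) $ i + fps_const (2 * (real e + 1/2))
        * disc n $ (e + i) + \<theta> n * U $ (n + Suc i)"
      unfolding convolution_double by (simp add: U_def disc_gf_planar_eq algebra_simps)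
  next
    show "(fps_X * annulus (real e + 1/2) e) $ Suc i
        = fps_const 2 * (disc n * (fps_X * annulus (real e + 1/2) e)) $ i
       + fps_const (2 * (real e + 1/2)) * disc n $ (e + i) + \<theta> n
           * (fps_X * annulus (real e + 1/2) e) $ (n + Suc i)" for i
      by (rule shifted_annulus_recursion)
  qed (simp_all add: U_def)
  then have "U $ Suc i = (fps_X * annulus (real e + 1/2) e) $ Suc i" by simp
  then show ?thesis by (simp add: U_def)
qed

text \<open>
  This is the contribution of the nonseparating loops on the torus. Pairs of even degrees and pairs of odd
  degrees are summed separately; both are convolutions of \<open>\<B> ^ 3\<close> with itself, and
  \<open>weighted_sum_identity\<close> adds them up.
\<close>

lemma annulus_gf_diagonal_sum: "(\<Sum>a<Suc (2 * i). annulus_gf (2 * i - a) a) = scale (fps_X * \<B> ^ 4) $ i"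
proof (cases i)
  case 0 then show ?thesis by (simp add: annulus_gf_0 scale_nth)
next
  case (Suc m)
  let ?b = "\<lambda>k. (\<B> ^ 3) $ k"
  have b: "real (Suc k) * of_nat (2 * Suc k choose Suc k) = 2 * ?b k" for k
    unfolding central_binomial_cube_nth central_binomial_Suc by simp
  have even: "annulus_gf (2 * i - 2 * Suc e) (2 * Suc e)
      = fps_const (4 * (?b e * ?b (m - 1 - e)) / real i) * \<R> ^ i" if e: "e < m" for e
  proof -
    have "2 * i - 2 * Suc e = 2 * Suc (m - 1 - e)" using e Suc by auto
    then have "annulus_gf (2 * i - 2 * Suc e) (2 * Suc e) = annulus (real (Suc e)) (Suc e) $ (m - 1 - e)"
      by (simp only: annulus_gf_even_eq)
    also have "\<dots> = fps_const (2 * (real (Suc e) * of_nat (2 * Suc e choose Suc e))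
        * ?b (m - 1 - e) / real i) * \<R> ^ i"
    proof -
      have "Suc (Suc e + (m - 1 - e)) = i" using e Suc by auto
      then show ?thesis unfolding annulus_nth by (simp only: mult.assoc)
    qed
    finally show ?thesis unfolding b by (simp add: mult.assoc)
  qed
  have odd: "annulus_gf (2 * i - Suc (2 * e)) (Suc (2 * e))
      = fps_const (?b e * ?b (m - e) / real i) * \<R> ^ i" if e: "e < Suc m" for e
  proof -
    have "2 * i - Suc (2 * e) = Suc (2 * (m - e))" using e Suc by auto
    then have "annulus_gf (2 * i - Suc (2 * e)) (Suc (2 * e)) = annulus (real e + 1/2) e $ (m - e)"
      by (simp only: annulus_gf_odd_eq)
    also have "\<dots> = fps_const ((2 * real e + 1) * of_nat (2 * e choose e) * ?b (m - e) / real i) * \<R> ^ i"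
    proof -
      have "Suc (e + (m - e)) = i" using e Suc by auto
      moreover have "2 * (real e + 1/2) = 2 * real e + 1" by simp
      ultimately show ?thesis unfolding annulus_nth by (simp only:)
    qed
    finally show ?thesis unfolding central_binomial_cube_nth[of e] .
  qed
  have "(\<Sum>a<Suc (2 * i). annulus_gf (2 * i - a) a)
      = (\<Sum>a<i. annulus_gf (2 * i - 2 * a) (2 * a)) + (\<Sum>a<i. annulus_gf (2 * i - Suc (2 * a)) (Suc (2 * a)))"
    by (simp add: sum_lessThan_double sum.distrib annulus_gf_0)
  also have "(\<Sum>a<i. annulus_gf (2 * i - 2 * a) (2 * a))
      = (\<Sum>e<m. annulus_gf (2 * i - 2 * Suc e) (2 * Suc e))"
    unfolding Suc sum.lessThan_Suc_shift by (simp add: annulus_gf_0)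
  also have "\<dots> = (\<Sum>e<m. fps_const (4 * (?b e * ?b (m - 1 - e)) / real i) * \<R> ^ i)"
    by (rule sum.cong[OF refl]) (simp only: even lessThan_iff)
  also have "\<dots> = fps_const (4 * (\<Sum>e<m. ?b e * ?b (m - 1 - e)) / real i) * \<R> ^ i"
    by (simp only: fps_const_setsum sum_distrib_right sum_distrib_left sum_divide_distrib)
  also have "(\<Sum>a<i. annulus_gf (2 * i - Suc (2 * a)) (Suc (2 * a)))
      = (\<Sum>e<Suc m. fps_const (?b e * ?b (m - e) / real i) * \<R> ^ i)"
    by (intro sum.cong) (simp only: Suc, rule odd, simp)
  also have "\<dots> = fps_const ((\<Sum>e<Suc m. ?b e * ?b (m - e)) / real i) * \<R> ^ i"
    by (simp only: fps_const_setsum sum_distrib_right sum_divide_distrib)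
  also have "fps_const (4 * (\<Sum>e<m. ?b e * ?b (m - 1 - e)) / real i) * \<R> ^ i
      + fps_const ((\<Sum>e<Suc m. ?b e * ?b (m - e)) / real i) * \<R> ^ i
     = fps_const ((4 * (\<Sum>e<m. ?b e * ?b (m - 1 - e)) + (\<Sum>e<Suc m. ?b e * ?b (m - e))) / real i) * \<R> ^ i"
    by (simp only: distrib_right[symmetric] fps_const_add add_divide_distrib)
  also have "4 * (\<Sum>e<m. ?b e * ?b (m - 1 - e)) + (\<Sum>e<Suc m. ?b e * ?b (m - e))
      = real i * (fps_X * \<B> ^ 4) $ i"
  proof -
    have B6: "\<B> ^ 6 = \<B> ^ 3 * \<B> ^ 3" by (simp flip: power_add)
    have "(\<B> ^ 6) $ m = (\<Sum>e<Suc m. ?b e * ?b (m - e))" unfolding B6 by (rule fps_mult_nth_lessThan)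
    moreover have "(fps_X * \<B> ^ 6) $ m = (\<Sum>e<m. ?b e * ?b (m - 1 - e))"
    proof (cases m)
      case 0 then show ?thesis by simp
    next
      case (Suc k)
      have "(fps_X * \<B> ^ 6) $ m = (\<B> ^ 3 * \<B> ^ 3) $ k" unfolding Suc B6[symmetric] by simp
      then show ?thesis unfolding fps_mult_nth_lessThan[of "\<B> ^ 3"] by (simp only: Suc diff_Suc_1)
    qed
    moreover have "real i * (fps_X * \<B> ^ 4) $ i = fps_deriv (fps_X * \<B> ^ 4) $ m"
      by (simp only: Suc fps_deriv_nth Suc_eq_plus1)
    moreover have "fps_deriv (fps_X * \<B> ^ 4) $ m = (\<B> ^ 6) $ m + 4 * (fps_X * \<B> ^ 6) $ m"
      unfolding weighted_sum_identity distrib_right mult_1 mult.assoc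
        by (simp only: fps_add_nth fps_mult_left_const_nth)
    ultimately show ?thesis by (simp only:)
  qed
  finally show ?thesis using Suc by (simp add: scale_nth)
qed

theorem disc_gf_torus_eq: "disc_gf 1 (2 * d) = torus_disc n $ d"
proof -
  define U where "U = Abs_fps (\<lambda>d. disc_gf 1 (2 * d))"
  have "U = torus_disc n"
  proof (rule linear_recursion_unique[where s = "\<lambda>i. scale (fps_X * \<B> ^ 4) $ i"])
    fix i
    have "disc_gf 1 (2 * Suc i)
        = (\<Sum>a<Suc (2 * i). annulus_gf (2 * i - a) a + disc_gf 0 (2 * i - a) * disc_gf 1 a
            + disc_gf 1 (2 * i - a) * disc_gf 0 a)
       + \<theta> n * disc_gf 1 (2 * (n + Suc i))"
      using disc_gf_torus_recursion[of "Suc (2 * i)"] by (simp add: algebra_simps)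
    also have "(\<Sum>a<Suc (2 * i). annulus_gf (2 * i - a) a + disc_gf 0 (2 * i - a) * disc_gf 1 a
        + disc_gf 1 (2 * i - a) * disc_gf 0 a) =
      (\<Sum>a<Suc (2 * i). annulus_gf (2 * i - a) a)
          + (\<Sum>a<Suc (2 * i). disc_gf 1 (2 * i - a) * disc_gf 0 a + disc_gf 0 (2 * i - a) * disc_gf 1 a)"
      unfolding sum.distrib by (simp only: add_ac)
    also have "(\<Sum>a<Suc (2 * i). disc_gf 1 (2 * i - a) * disc_gf 0 a + disc_gf 0 (2 * i - a) * disc_gf 1 a) =
       (\<Sum>a<Suc i. disc_gf 1 (2 * i - 2 * a) * disc_gf 0 (2 * a) + disc_gf 0 (2 * i - 2 * a)
           * disc_gf 1 (2 * a))"
      by (rule sum_even_terms) (simp add: disc_gf_parity)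
    also have "\<dots> = (\<Sum>a<Suc i. U $ (i - a) * disc n $ a + disc n $ (i - a) * U $ a)"
      by (simp add: U_def disc_gf_planar_eq flip: right_diff_distrib')
    finally show "U $ Suc i = fps_const 2 * (disc n * U) $ i + scale (fps_X * \<B> ^ 4) $ i + \<theta> n
        * U $ (n + Suc i)"
      unfolding convolution_double annulus_gf_diagonal_sum by (simp add: U_def)
  next
    show "torus_disc n $ Suc i
        = fps_const 2 * (disc n * torus_disc n) $ i + scale (fps_X * \<B> ^ 4) $ i + \<theta> n
            * torus_disc n $ (n + Suc i)" for i
      by (rule torus_disc_recursion)
  qed (simp_all add: U_def disc_gf_0 torus_disc_0)
  then have "U $ d = torus_disc n $ d" by simp
  then show ?thesis by (simp add: U_def)
qed

end

section \<open>Coefficient extraction\<close>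

lemma R_power_nth: "(\<R> ^ m) $ i = of_nat (m choose i)"
proof (induction m arbitrary: i)
  case 0 then show ?case by (cases i) simp_all
next
  case (Suc m)
  have "\<R> ^ Suc m = \<R> ^ m + fps_X * \<R> ^ m" by (simp add: \<R>_def distrib_right)
  then show ?case by (cases i) (simp_all add: Suc.IH)
qed

lemma gamma_eq_c_const: "real (c_const (Suc n)) = \<gamma> n"
proof -
  have "Suc n * (2 * Suc n choose Suc n) = Suc n * (2 * (Suc (2 * n) choose n))"
    using Suc_times_binomial[of n "Suc (2 * n)"] by simp
  then have "Suc n * (2 * Suc n choose Suc n) = c_const (Suc n)"
    by (simp add: c_const_def)
  then show ?thesis unfolding \<gamma>_def of_nat_mult[symmetric] by (rule arg_cong[OF sym])
qed

text \<open>
  The counting sequence is read off from its generating function in the variable \<open>u\<close> without inverting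
  \<open>\<T>\<close>.
\<close>

lemma coefficient_extraction:
  "f N = fact N * ((egf f oo \<T> n) * (fps_deriv (\<T> n) * (fps_const (\<gamma> n) * \<R> ^ Suc n) ^ Suc N)) $ N"
  using fps_Lagrange_inversion[OF T_inverse T_nth_0, of "egf f" N] by (simp add: egf_def del: power_Suc)

lemma lagrange_factor:
  "fps_deriv (\<T> n) * (fps_const (\<gamma> n) * \<R> ^ Suc n) ^ Suc N =
   fps_const (\<gamma> n ^ N) * (fps_const (\<gamma> n) * fps_deriv (\<T> n)) * \<R> ^ (Suc n * Suc N)"
proof -
  have "(fps_const (\<gamma> n) * \<R> ^ Suc n) ^ Suc N = fps_const (\<gamma> n) ^ Suc N * \<R> ^ (Suc n * Suc N)"
    by (simp only: power_mult_distrib power_mult)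
  also have "fps_const (\<gamma> n) ^ Suc N = fps_const (\<gamma> n) * fps_const (\<gamma> n ^ N)"
    by (simp only: power_Suc fps_const_power)
  finally show ?thesis by (simp only: mult_ac)
qed

lemma jac_nz: "jac n \<noteq> 0"
  using jac_inverse[of n] by auto

lemma inverse_jac_nth: "inverse (jac n) $ k = real n ^ k"
proof -
  have "jac n * Abs_fps (\<lambda>k. real n ^ k) = 1"
  proof (rule fps_ext)
    fix k show "(jac n * Abs_fps (\<lambda>k. real n ^ k)) $ k = (1 :: real fps) $ k"
      by (cases k) (simp_all add: jac_def left_diff_distrib mult.assoc)
  qed
  then have "jac n * Abs_fps (\<lambda>k. real n ^ k) = jac n * inverse (jac n)" by (simp only: jac_inverse)
  then have "inverse (jac n) = Abs_fps (\<lambda>k. real n ^ k)" using jac_nz by (metis mult_left_cancel)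
  then show ?thesis by simp
qed

text \<open>
  One of the \<open>N + 1\<close> vertices plays the role of the marked one. The powers of \<open>1 - n * u\<close> in the genus 1
  function and in \<open>dt/du\<close> cancel except for one in the denominator, whose geometric series gives the sum
  over \<open>k\<close>.
\<close>

theorem torus_map_count:
  "real (\<kappa> 1 (Suc n) (Suc N)) = fact N * \<gamma> n ^ Suc N / 12 *
     (\<Sum>k = 1..Suc N. real n ^ k * real ((Suc n * Suc N) choose (Suc N - k)))"
proof -
  let ?\<nu> = "Suc n"
  have "real (\<kappa> 1 ?\<nu> (Suc N)) = one_count ?\<nu> 1 (2 * ?\<nu>) N"
    using map_count_eq_degree_count[of ?\<nu> "Suc N" 1] by (simp add: one_count_def)
  also have "\<dots> = fact N * (disc_gf n 1 (2 * ?\<nu>)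
      * (fps_deriv (\<T> n) * (fps_const (\<gamma> n) * \<R> ^ ?\<nu>) ^ Suc N)) $ N"
    unfolding disc_gf_def by (rule coefficient_extraction)
  also have "disc_gf n 1 (2 * ?\<nu>) * (fps_deriv (\<T> n) * (fps_const (\<gamma> n) * \<R> ^ ?\<nu>) ^ Suc N) =
      fps_const (\<gamma> n ^ N) * (torus_disc n $ ?\<nu> * (fps_const (\<gamma> n) * fps_deriv (\<T> n))) * \<R> ^ (?\<nu> * Suc N)"
    unfolding disc_gf_torus_eq lagrange_factor by (simp only: mult_ac)
  also have "torus_disc n $ ?\<nu> * (fps_const (\<gamma> n) * fps_deriv (\<T> n))
      = fps_const (fifth_coeff n) * inverse (jac n)"
  proof -
    let ?V = "torus_disc n $ ?\<nu> * (fps_const (\<gamma> n) * fps_deriv (\<T> n))"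
    have "(jac n)\<^sup>2 * ?V = fps_const (fifth_coeff n)
        * (fps_const (\<gamma> n) * fps_deriv (\<T> n) * \<R> ^ Suc (Suc n))"
      using arg_cong[OF torus_disc_top, of "\<lambda>x. x * (fps_const (\<gamma> n) * fps_deriv (\<T> n))" n]
      by (simp only: mult_ac add_2_eq_Suc')
    then have "jac n * (jac n * ?V) = jac n * fps_const (fifth_coeff n)"
      unfolding T_deriv by (simp only: power2_eq_square mult_ac)
    then have "jac n * ?V = fps_const (fifth_coeff n)" using jac_nz by (metis mult_left_cancel)
    then have eq: "inverse (jac n) * (jac n * ?V) = inverse (jac n) * fps_const (fifth_coeff n)"
      by (simp only:)
    have "?V = (jac n * inverse (jac n)) * ?V" by (simp only: jac_inverse mult_1)
    also have "\<dots> = inverse (jac n) * (jac n * ?V)" by (simp only: mult_ac)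
    finally show ?thesis unfolding eq by (simp only: mult.commute)
  qed
  also have "fps_const (\<gamma> n ^ N) * (fps_const (fifth_coeff n) * inverse (jac n)) * \<R> ^ (?\<nu> * Suc N) =
     fps_const (\<gamma> n ^ N * fifth_coeff n) * (inverse (jac n) * \<R> ^ (?\<nu> * Suc N))"
    by (simp only: mult.assoc fps_const_mult_left)
  also have "\<dots> $ N = \<gamma> n ^ N * fifth_coeff n * (\<Sum>k=0..N. real n ^ k * real ((?\<nu> * Suc N) choose (N - k)))"
    by (simp only: fps_mult_left_const_nth fps_mult_nth[of "inverse (jac n)"] inverse_jac_nth R_power_nth)
  also have "\<gamma> n ^ N * fifth_coeff n * (\<Sum>k=0..N. real n ^ k * real ((?\<nu> * Suc N) choose (N - k))) =
     \<gamma> n ^ Suc N / 12 * (\<Sum>k=0..N. real n ^ Suc k * real ((?\<nu> * Suc N) choose (Suc N - Suc k)))"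
    unfolding fifth_coeff_def power_Suc[of "real n"] diff_Suc_Suc mult.assoc sum_distrib_left[symmetric]
      by simp
  also have "(\<Sum>k=0..N. real n ^ Suc k * real ((?\<nu> * Suc N) choose (Suc N - Suc k))) =
     (\<Sum>k = 1..Suc N. real n ^ k * real ((?\<nu> * Suc N) choose (Suc N - k)))"
    unfolding One_nat_def by (rule sum.shift_bounds_cl_Suc_ivl[symmetric])
  finally show ?thesis by simp
qed

text \<open>
  With two vertices playing the role of the marked ones, the two-point function is a single power of \<open>R\<close>. The
  factor \<open>dt/du\<close> contributes \<open>1 - n * u = \<nu> - n * R\<close>, so the coefficient is a difference of two binomial
  coefficients, which combine to a quotient of factorials.
\<close>

theorem planar_map_count_ge_2:
  "real (\<kappa> 0 (Suc n) (Suc (Suc N))) =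
     \<gamma> n ^ Suc (Suc N) * fact (Suc n * Suc (Suc N) - 1) / fact (n * Suc (Suc N) + 2)"
proof -
  let ?\<nu> = "Suc n" and ?j = "Suc (Suc N)"
  define m where "m = n * ?j + 1 + N"
  have m: "Suc m = ?\<nu> * ?j" by (simp add: m_def)
  have "real (\<kappa> 0 ?\<nu> ?j) = two_count ?\<nu> (2 * ?\<nu>) (2 * ?\<nu>) N"
    using map_count_eq_degree_count[of ?\<nu> ?j 0] by (simp add: two_count_def)
  also have "\<dots> = fact N * (annulus_gf n (2 * ?\<nu>) (2 * ?\<nu>)
      * (fps_deriv (\<T> n) * (fps_const (\<gamma> n) * \<R> ^ ?\<nu>) ^ Suc N)) $ N"
    unfolding annulus_gf_def by (rule coefficient_extraction)
  also have "annulus_gf n (2 * ?\<nu>) (2 * ?\<nu>) = fps_const (\<gamma> n ^ 2 / (2 * real ?\<nu>)) * \<R> ^ (2 * ?\<nu>)"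
  proof -
    have "annulus_gf n (2 * ?\<nu>) (2 * ?\<nu>) = annulus (real ?\<nu>) ?\<nu> $ n" by (rule annulus_gf_even_eq)
    also have "\<dots> = fps_const (real ?\<nu> * of_nat (2 * ?\<nu> choose ?\<nu>) * (2 * (\<B> ^ 3) $ n) / real (Suc (?\<nu> + n)))
        * \<R> ^ Suc (?\<nu> + n)"
      unfolding annulus_nth by (simp only: mult_ac)
    also have "\<dots> = fps_const (\<gamma> n ^ 2 / real (Suc (?\<nu> + n))) * \<R> ^ Suc (?\<nu> + n)"
      unfolding gamma_cube \<gamma>_def[symmetric] power2_eq_square ..
    also have "Suc (?\<nu> + n) = 2 * ?\<nu>" by simp
    finally show ?thesis by (simp only: of_nat_mult of_nat_numeral)
  qed
  also have "fps_const (\<gamma> n ^ 2 / (2 * real ?\<nu>)) * \<R> ^ (2 * ?\<nu>)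
      * (fps_deriv (\<T> n) * (fps_const (\<gamma> n) * \<R> ^ ?\<nu>) ^ Suc N)
     = fps_const (\<gamma> n ^ ?j / (2 * real ?\<nu>)) * (jac n * \<R> ^ m)"
  proof -
    have e: "2 * ?\<nu> + ?\<nu> * Suc N = Suc (Suc n) + m" by (simp add: m_def)
    have "fps_const (\<gamma> n ^ 2 / (2 * real ?\<nu>)) * \<R> ^ (2 * ?\<nu>)
        * (fps_deriv (\<T> n) * (fps_const (\<gamma> n) * \<R> ^ ?\<nu>) ^ Suc N)
      = (fps_const (\<gamma> n ^ 2 / (2 * real ?\<nu>)) * fps_const (\<gamma> n ^ N))
          * ((fps_const (\<gamma> n) * fps_deriv (\<T> n)) * \<R> ^ (2 * ?\<nu> + ?\<nu> * Suc N))"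
      unfolding lagrange_factor by (simp only: power_add mult_ac)
    also have "(fps_const (\<gamma> n) * fps_deriv (\<T> n)) * \<R> ^ (2 * ?\<nu> + ?\<nu> * Suc N) = jac n * \<R> ^ m"
      unfolding e power_add mult.assoc[symmetric] T_deriv[symmetric] ..
    also have "fps_const (\<gamma> n ^ 2 / (2 * real ?\<nu>)) * fps_const (\<gamma> n ^ N)
        = fps_const (\<gamma> n ^ ?j / (2 * real ?\<nu>))"
      by (simp add: power2_eq_square)
    finally show ?thesis .
  qed
  also have "(fps_const (\<gamma> n ^ ?j / (2 * real ?\<nu>)) * (jac n * \<R> ^ m)) $ N =
     \<gamma> n ^ ?j / (2 * real ?\<nu>) * (real ?\<nu> * real (m choose N) - real n * real (Suc m choose N))"
  proof -
    have "jac n = fps_const (real ?\<nu>) - fps_const (real n) * \<R>"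
      unfolding jac_def \<R>_def by (rule fps_ext) (simp add: fps_X_nth)
    then have "jac n * \<R> ^ m = fps_const (real ?\<nu>) * \<R> ^ m - fps_const (real n) * \<R> ^ Suc m"
      by (simp only: left_diff_distrib power_Suc mult.assoc)
    then show ?thesis by (simp only: fps_mult_left_const_nth fps_sub_nth R_power_nth)
  qed
  also have "fact N * (\<gamma> n ^ ?j / (2 * real ?\<nu>)
      * (real ?\<nu> * real (m choose N) - real n * real (Suc m choose N)))
     = \<gamma> n ^ ?j * fact m / fact (n * ?j + 2)"
  proof -
    let ?p = "n * ?j + 1"
    have p: "m - N = ?p" "Suc m - N = Suc ?p" "N \<le> m" "N \<le> Suc m" by (simp_all add: m_def)
    have b1: "fact N * real (m choose N) = fact m / fact ?p"
      using binomial_fact[OF p(3), where 'a = real] p(1) by simp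
    have b2: "fact N * real (Suc m choose N) = real (Suc m) * fact m / (real (Suc ?p) * fact ?p)"
      using binomial_fact[OF p(4), where 'a = real] p(2) by (simp add: fact_Suc del: of_nat_Suc)
    have "fact N * (real ?\<nu> * real (m choose N) - real n * real (Suc m choose N)) =
       real ?\<nu> * (fact N * real (m choose N)) - real n * (fact N * real (Suc m choose N))"
      by (simp add: algebra_simps)
    also have "\<dots> = (fact m / (real (Suc ?p) * fact ?p)) * (real ?\<nu> * real (Suc ?p) - real n * real (Suc m))"
      unfolding b1 b2 by (simp add: field_simps del: of_nat_Suc)
    also have "real ?\<nu> * real (Suc ?p) - real n * real (Suc m) = 2 * real ?\<nu>"
      unfolding m by (simp add: algebra_simps)
    also have "real (Suc ?p) * fact ?p = fact (n * ?j + 2)" using fact_Suc[of ?p] by simp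
    finally have "fact N * (real ?\<nu> * real (m choose N) - real n * real (Suc m choose N))
        = fact m / fact (n * ?j + 2) * (2 * real ?\<nu>)" .
    then have "fact N * (\<gamma> n ^ ?j / (2 * real ?\<nu>)
        * (real ?\<nu> * real (m choose N) - real n * real (Suc m choose N))) =
       \<gamma> n ^ ?j / (2 * real ?\<nu>) * (fact m / fact (n * ?j + 2) * (2 * real ?\<nu>))"
      by (simp only: mult.left_commute[of "fact N"])
    then show ?thesis by (simp del: power_Suc of_nat_Suc)
  qed
  finally show ?thesis using m by (metis diff_Suc_1)
qed

text \<open>
  At \<open>u = 0\<close> there are no ordinary vertices, and the recursion becomes the Catalan recursion, which is solved
  by completing the square.
\<close>

lemma disc_constant_term: "disc n $ d $ 0 = real (2 * d choose d) / real (Suc d)"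
proof -
  define C where "C = Abs_fps (\<lambda>d. disc n $ d $ 0)"
  have "\<theta> n $ 0 = 0" by (simp add: \<theta>_def T_nth_0)
  then have rec: "C $ Suc d = (C * C) $ d" for d
    using disc_recursion[of n d] by (simp add: C_def fps_mult_nth fps_sum_nth)
  have "C = 1 + fps_X * (C * C)"
  proof (rule fps_ext)
    fix d show "C $ d = (1 + fps_X * (C * C)) $ d"
      by (cases d) (simp_all add: rec disc_0 C_def[THEN arg_cong, of "\<lambda>f. f $ 0"])
  qed
  then have sq: "(1 - fps_const 2 * (fps_X * C))\<^sup>2 = \<S>\<^sup>2"
  proof -
    \<comment> \<open>For \<open>c = 2\<close> the last coefficient is zero, and the bracket before it vanishes by the recursion.\<close>
    have "(1 - c * (x * C'))\<^sup>2
        = 1 - (c * c) * x + (c * c) * (x * (1 + x * (C' * C') - C')) + (c * c - c - c) * (x * C')"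
      for c x C' :: "real fps" by (simp add: power2_eq_square algebra_simps)
    from this[of "fps_const 2" fps_X C] show ?thesis
      unfolding sqrt_fps_square \<open>C = 1 + fps_X * (C * C)\<close>[symmetric] by simp
  qed
  then have "(1 - fps_const 2 * (fps_X * C) - \<S>) * (1 - fps_const 2 * (fps_X * C) + \<S>) = 0"
    by (simp add: power2_eq_square algebra_simps)
  moreover have "(1 - fps_const 2 * (fps_X * C) + \<S>) $ 0 \<noteq> 0"
    by (simp add: sqrt_fps_def central_binomial_nth_0)
  then have "1 - fps_const 2 * (fps_X * C) + \<S> \<noteq> 0" by (metis fps_zero_nth)
  ultimately have S: "\<S> = 1 - fps_const 2 * (fps_X * C)" by simp
  have "fps_deriv \<S> $ d = - (2 * real (2 * d choose d))"
    unfolding sqrt_fps_deriv by (simp add: central_binomial_fps_def)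
  moreover have "fps_deriv \<S> $ d = - (2 * (real (Suc d) * C $ d))" unfolding S fps_deriv_nth by simp
  ultimately have "real (Suc d) * C $ d = real (2 * d choose d)" by linarith
  then show ?thesis by (simp add: C_def field_simps)
qed

theorem planar_map_count_1: "real (\<kappa> 0 (Suc n) 1) = \<gamma> n * fact n / fact (n + 2)"
proof -
  let ?\<nu> = "Suc n"
  have "real (\<kappa> 0 ?\<nu> 1) = one_count ?\<nu> 0 (2 * ?\<nu>) 0"
    by (subst map_count_eq_degree_count) (simp_all add: one_count_def)
  also have "\<dots> = disc_gf n 0 (2 * ?\<nu>) $ 0" by (simp add: disc_gf_def egf_def fps_compose_nth)
  also have "\<dots> = real (2 * ?\<nu> choose ?\<nu>) / real (Suc ?\<nu>)" unfolding disc_gf_planar_eq disc_constant_term ..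
  also have "\<dots> = \<gamma> n * fact n / fact (n + 2)"
  proof -
    have "fact (n + 2) = real (Suc ?\<nu>) * (real ?\<nu> * fact n)" by (simp add: algebra_simps)
    then show ?thesis unfolding \<gamma>_def by (simp del: of_nat_Suc binomial_Suc_Suc mult_Suc_right)
  qed
  finally show ?thesis .
qed

text \<open>
  A single planar vertex is a case of its own, because it cannot supply two marked vertices.
\<close>

theorem theorem1p3:
  fixes \<nu> j :: nat
  assumes "\<nu> \<ge> 1" and "j \<ge> 1"
  shows "real (\<kappa> 0 \<nu> j) =
           real (c_const \<nu>) ^ j * fact (\<nu> * j - 1) / fact ((\<nu> - 1) * j + 2)
       \<and> real (\<kappa> 1 \<nu> j) =
           fact (j - 1) * real (c_const \<nu>) ^ j / 12 *
             (\<Sum>k = 1..j. real (\<nu> - 1) ^ k * real ((\<nu> * j) choose (j - k)))"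
proof -
  obtain n where \<nu>: "\<nu> = Suc n" using assms(1) by (cases \<nu>) auto
  obtain N where j: "j = Suc N" using assms(2) by (cases j) auto
  have c: "real (c_const \<nu>) = \<gamma> n" unfolding \<nu> by (rule gamma_eq_c_const)
  have "real (\<kappa> 0 \<nu> j) = real (c_const \<nu>) ^ j * fact (\<nu> * j - 1) / fact ((\<nu> - 1) * j + 2)"
  proof (cases N)
    case 0 then show ?thesis unfolding c unfolding \<nu> j using planar_map_count_1[of n] by simp
  next
    case (Suc M) then show ?thesis unfolding c unfolding \<nu> j Suc diff_Suc_1
      by (simp only: planar_map_count_ge_2)
  qed
  moreover have "real (\<kappa> 1 \<nu> j) = fact (j - 1) * real (c_const \<nu>) ^ j / 12 *
             (\<Sum>k = 1..j. real (\<nu> - 1) ^ k * real ((\<nu> * j) choose (j - k)))"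
    unfolding c unfolding \<nu> j diff_Suc_1 by (rule torus_map_count)
  ultimately show ?thesis by blast
qed

end
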